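(* Let $\mathcal{G}$ be a finite triangulation of the sphere, with vertex set $V$, whose faces are properly $2$-coloured black and white (no two faces of the same colour share an edge). Let $W$ be the set of white triangles and $B$ the set of black triangles. Let $\mathcal{A}_W$ be the abelian group with generating set $V$ subject to the relations $r+c+s=0$ for every white triangle with vertex set $\{r,c,s\}$, and let $\mathcal{A}_B$ be the abelian group with generating set $V$ subject to the relations $r+c+s=0$ for every black triangle with vertex set $\{r,c,s\}$. Then $\mathcal{A}_W\cong\mathcal{A}_B$.
   Context: A triangulation of the sphere is a $2$-cell embedding of a finite graph (multiple edges allowed, no loops) in the sphere in which every face is bounded by a $3$-cycle; each triangle has three distinct incident vertices. Two triangles of different colours may have the same vertex set; a triangle is determined by its colour and its vertex set. *)

theory Defs
  imports "HOL-Analysis.Analysis" "HOL-Algebra.Free_Abelian_Groups"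
begin

text \<open>
  A multigraph on vertices \<open>verts\<close> and edges \<open>edges\<close> with end-point map \<open>ends\<close>, together with a
  drawing: \<open>point v\<close> is the position of the vertex \<open>v\<close>, and \<open>curve e\<close> parametrises the edge \<open>e\<close>.
\<close>

record ('v, 'e) drawn_graph =
  verts :: "'v set"
  edges :: "'e set"
  ends  :: "'e \<Rightarrow> 'v set"
  point :: "'v \<Rightarrow> real ^ 3"
  curve :: "'e \<Rightarrow> real \<Rightarrow> real ^ 3"

definition finite_loopless_multigraph :: "('v, 'e) drawn_graph \<Rightarrow> bool" where
  "finite_loopless_multigraph G \<longleftrightarrow>
     finite (verts G) \<and> finite (edges G) \<and>
     (\<forall>e\<in>edges G. ends G e \<subseteq> verts G \<and> card (ends G e) = 2)"

abbreviation unit_sphere :: "(real ^ 3) set" where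
  "unit_sphere \<equiv> sphere 0 1"

text \<open>
  Edges are simple arcs joining their end points; an edge meets the vertex set only in its
  end points, and two distinct edges meet only in vertices.
\<close>

definition embedded_in_sphere :: "('v, 'e) drawn_graph \<Rightarrow> bool" where
  "embedded_in_sphere G \<longleftrightarrow>
     inj_on (point G) (verts G) \<and> point G ` verts G \<subseteq> unit_sphere \<and>
     (\<forall>e\<in>edges G.
        arc (curve G e) \<and> path_image (curve G e) \<subseteq> unit_sphere \<and>
        {pathstart (curve G e), pathfinish (curve G e)} = point G ` ends G e \<and>
        path_image (curve G e) \<inter> point G ` verts G = point G ` ends G e) \<and>
     (\<forall>e\<in>edges G. \<forall>f\<in>edges G. e \<noteq> f \<longrightarrow>
        path_image (curve G e) \<inter> path_image (curve G f) \<subseteq> point G ` verts G)"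

definition drawing :: "('v, 'e) drawn_graph \<Rightarrow> (real ^ 3) set" where
  "drawing G = point G ` verts G \<union> (\<Union>e\<in>edges G. path_image (curve G e))"

definition faces :: "('v, 'e) drawn_graph \<Rightarrow> (real ^ 3) set set" where
  "faces G = components (unit_sphere - drawing G)"

definition two_cell_embedding :: "('v, 'e) drawn_graph \<Rightarrow> bool" where
  "two_cell_embedding G \<longleftrightarrow>
     embedded_in_sphere G \<and> (\<forall>F\<in>faces G. F homeomorphic ball (0 :: real ^ 2) 1)"

definition face_boundary :: "(real ^ 3) set \<Rightarrow> (real ^ 3) set" where
  "face_boundary F = top_of_set unit_sphere frontier_of F"

definition boundary_edges :: "('v, 'e) drawn_graph \<Rightarrow> (real ^ 3) set \<Rightarrow> 'e set" where
  "boundary_edges G F = {e \<in> edges G. path_image (curve G e) \<subseteq> face_boundary F}"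

definition boundary_verts :: "('v, 'e) drawn_graph \<Rightarrow> (real ^ 3) set \<Rightarrow> 'v set" where
  "boundary_verts G F = {v \<in> verts G. point G v \<in> face_boundary F}"

text \<open>The edges \<open>a\<close>, \<open>b\<close>, \<open>c\<close> below are distinct because their sets of end points are.\<close>

definition bounded_by_3_cycle :: "('v, 'e) drawn_graph \<Rightarrow> (real ^ 3) set \<Rightarrow> bool" where
  "bounded_by_3_cycle G F \<longleftrightarrow>
     (\<exists>u\<in>verts G. \<exists>v\<in>verts G. \<exists>w\<in>verts G. \<exists>a\<in>edges G. \<exists>b\<in>edges G. \<exists>c\<in>edges G.
        distinct [u, v, w] \<and>
        ends G a = {u, v} \<and> ends G b = {v, w} \<and> ends G c = {w, u} \<and>
        face_boundary F =
          path_image (curve G a) \<union> path_image (curve G b) \<union> path_image (curve G c))"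

definition sphere_triangulation :: "('v, 'e) drawn_graph \<Rightarrow> bool" where
  "sphere_triangulation G \<longleftrightarrow>
     finite_loopless_multigraph G \<and> two_cell_embedding G \<and>
     (\<forall>F\<in>faces G. bounded_by_3_cycle G F)"

definition proper_face_2_colouring ::
    "('v, 'e) drawn_graph \<Rightarrow> (real ^ 3) set set \<Rightarrow> (real ^ 3) set set \<Rightarrow> bool" where
  "proper_face_2_colouring G W B \<longleftrightarrow>
     W \<union> B = faces G \<and> W \<inter> B = {} \<and>
     (\<forall>C\<in>{W, B}. \<forall>F\<in>C. \<forall>F'\<in>C. F \<noteq> F' \<longrightarrow> boundary_edges G F \<inter> boundary_edges G F' = {})"

text \<open>
  The abelian group with generating set \<open>S\<close> and relations \<open>x = 0\<close> for \<open>x \<in> R\<close>, where \<open>R\<close> is a set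
  of elements of the free abelian group on \<open>S\<close>.
\<close>

definition abelian_presentation :: "'v set \<Rightarrow> ('v \<Rightarrow>\<^sub>0 int) set \<Rightarrow> ('v \<Rightarrow>\<^sub>0 int) set monoid" where
  "abelian_presentation S R = free_Abelian_group S Mod generate (free_Abelian_group S) R"

definition triangle_relations ::
    "('v, 'e) drawn_graph \<Rightarrow> (real ^ 3) set set \<Rightarrow> ('v \<Rightarrow>\<^sub>0 int) set" where
  "triangle_relations G T =
     {frag_of r + frag_of c + frag_of s | r c s. \<exists>F\<in>T. boundary_verts G F = {r, c, s}}"

definition triangle_group ::
    "('v, 'e) drawn_graph \<Rightarrow> (real ^ 3) set set \<Rightarrow> ('v \<Rightarrow>\<^sub>0 int) set monoid" where
  "triangle_group G T = abelian_presentation (verts G) (triangle_relations G T)"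

end

theory Submission
  imports Defs
begin

text \<open>
  A spanning tree \<open>D\<close> of the dual graph has an acyclic primal complement: by the Jordan curve theorem,
  a cycle avoiding \<open>D\<close> would separate faces which \<open>D\<close> connects. Colours of the vertices are propagated
  along \<open>D\<close>; at a leaf of the remaining forest, the alternation of black and white triangles around
  the vertex forces agreement along the last edge as well. So the vertices split into three
  classes \<open>R\<close>, \<open>C\<close>, \<open>S\<close> which every triangle meets once each.

  Each edge \<open>e = cs\<close> between \<open>C\<close> and \<open>S\<close> lies in one white triangle, with apex \<open>a e \<in> R\<close>, and one black
  triangle, with apex \<open>b e \<in> R\<close>. The white relations say that \<open>c + s = - a e\<close>. They determine \<open>C\<close> and
  \<open>S\<close> from \<open>R\<close> and one base vertex, and they can be solved as soon as the alternating sums around the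
  vertices of \<open>R\<close> vanish. Hence the white group is the direct sum of \<open>\<int>\<close> and the cokernel of a
  Laplacian on \<open>R\<close>, that of the digraph with an arc between \<open>b e\<close> and \<open>a e\<close> for each \<open>e\<close>. Exchanging the
  colours transposes the Laplacian, and a square integer matrix and its transpose have isomorphic
  cokernels because row and column operations make the matrix diagonal.
\<close>

text \<open>The order of the triangles around a vertex is replaced by double counting: every edge at
  the vertex lies in one white and one black triangle, so a sum over the white triangles there,
  rewritten over the edges, equals the black one.

  Solving the white relations is a discrete form of "closed implies exact". The edges between
  \<open>C\<close> and \<open>S\<close> form one graph through their ends and a second one, on
  \<open>R\<close>, through their two apexes. A spanning tree of the second has a complement that is
  a forest of the first. On a forest the differences of a potential can be prescribed freely; the
  conditions at \<open>R\<close> then force the right differences along the tree, as a flow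
  supported on a tree vanishes. These conditions hold only modulo the rows of the Laplacian, so
  flows are compared modulo a subgroup.

  The relations fix sums, not differences, of neighbouring values; a sign change on one of the two
  classes mediates. The base vertex enters the matrix as an index with zero row and column, so the
  free summand is part of the cokernel and one statement on square matrices suffices.\<close>

section \<open>Additive subgroups and presented abelian groups\<close>

text \<open>Stated on the ambient type, where the product of \<open>free_Abelian_group S\<close> is
  \<open>+\<close>, so that "supported in \<open>S\<close>" and "zero modulo the relations" are
  instances of one notion.\<close>

definition add_subgroup :: "'a::ab_group_add set \<Rightarrow> bool" where
  "add_subgroup N \<longleftrightarrow> 0 \<in> N \<and> (\<forall>x\<in>N. \<forall>y\<in>N. x - y \<in> N)"

lemma add_subgroupD:
  assumes "add_subgroup N"
  shows add_subgroup_0: "0 \<in> N"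
    and add_subgroup_diff: "x \<in> N \<Longrightarrow> y \<in> N \<Longrightarrow> x - y \<in> N"
    and add_subgroup_minus: "x \<in> N \<Longrightarrow> - x \<in> N"
    and add_subgroup_add: "x \<in> N \<Longrightarrow> y \<in> N \<Longrightarrow> x + y \<in> N"
proof -
  show 0: "0 \<in> N" and d: "x \<in> N \<Longrightarrow> y \<in> N \<Longrightarrow> x - y \<in> N" for x y
    using assms by (auto simp: add_subgroup_def)
  show m: "x \<in> N \<Longrightarrow> - x \<in> N" for x
    using d[OF 0] by simp
  show "x \<in> N \<Longrightarrow> y \<in> N \<Longrightarrow> x + y \<in> N"
    using d[of x "- y"] m[of y] by simp
qed

lemma add_subgroup_sum:
  "add_subgroup N \<Longrightarrow> (\<And>i. i \<in> I \<Longrightarrow> f i \<in> N) \<Longrightarrow> sum f I \<in> N"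
  by (induction I rule: infinite_finite_induct) (auto intro: add_subgroupD)

lemma add_subgroup_frag_cmul:
  assumes "add_subgroup N" "x \<in> N"
  shows "frag_cmul k x \<in> N"
proof -
  have "frag_cmul (int n) x \<in> N" for n
    by (induction n) (use assms in \<open>auto simp: frag_cmul_distrib intro: add_subgroupD\<close>)
  moreover have "frag_cmul (- int n) x = - frag_cmul (int n) x" for n
    by simp
  ultimately show ?thesis
    using add_subgroup_minus[OF assms(1)] by (cases k rule: int_cases2) metis+
qed

abbreviation frags :: "'v set \<Rightarrow> ('v \<Rightarrow>\<^sub>0 int) set" where
  "frags S \<equiv> {x. Poly_Mapping.keys x \<subseteq> S}"

abbreviation relators :: "'v set \<Rightarrow> ('v \<Rightarrow>\<^sub>0 int) set \<Rightarrow> ('v \<Rightarrow>\<^sub>0 int) set" where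
  "relators S R \<equiv> generate (free_Abelian_group S) R"

lemma add_subgroup_frags: "add_subgroup (frags S)"
  using keys_diff by (fastforce simp: add_subgroup_def)

lemma add_subgroup_relators:
  assumes "R \<subseteq> frags S"
  shows "add_subgroup (relators S R)"
proof -
  interpret group "free_Abelian_group S" by simp
  have c: "R \<subseteq> carrier (free_Abelian_group S)"
    using assms by auto
  note sub = generate_is_subgroup[OF c]
  have "0 \<in> relators S R"
    using subgroup.one_closed[OF sub] by simp
  moreover have "x - y \<in> relators S R" if "x \<in> relators S R" "y \<in> relators S R" for x y
  proof -
    have "Poly_Mapping.keys y \<subseteq> S"
      using subgroup.mem_carrier[OF sub that(2)] by simp
    then show ?thesis
      using subgroup.m_closed[OF sub that(1) subgroup.m_inv_closed[OF sub that(2)]] by simp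
  qed
  ultimately show ?thesis
    by (simp add: add_subgroup_def)
qed

lemma relators_incl: "x \<in> R \<Longrightarrow> x \<in> relators S R"
  by (rule generate.incl)

lemma relators_least:
  assumes "R \<subseteq> frags S" "R \<subseteq> N" "add_subgroup N"
  shows "relators S R \<subseteq> N"
proof
  fix x assume "x \<in> relators S R"
  then show "x \<in> N"
  proof induction
    case (inv h)
    \<comment> \<open>Inversion in \<open>free_Abelian_group S\<close> is negation on its carrier
      only; \<open>R \<subseteq> frags S\<close> puts \<open>h\<close> there.\<close>
    then show ?case
      using assms by (subst inv_free_Abelian_group) (auto intro: add_subgroupD)
  qed (use assms in \<open>auto intro: add_subgroupD\<close>)
qed

lemma relators_frags: "R \<subseteq> frags S \<Longrightarrow> relators S R \<subseteq> frags S"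
  by (rule relators_least) (auto simp: add_subgroup_frags)

lemma frag_extend_in_subgroup:
  assumes "add_subgroup N" "\<And>v. v \<in> S \<Longrightarrow> a v \<in> N" "x \<in> frags S"
  shows "frag_extend a x \<in> N"
  unfolding frag_extend_def
  by (rule add_subgroup_sum) (use assms in \<open>auto intro!: add_subgroup_frag_cmul\<close>)

lemma add_subgroup_vimage_frag_extend:
  "add_subgroup N \<Longrightarrow> add_subgroup {x. frag_extend a x \<in> N}"
  by (auto simp: add_subgroup_def frag_extend_diff)

lemma frag_extend_relators:
  assumes "R \<subseteq> frags S" "add_subgroup N" "\<And>x. x \<in> R \<Longrightarrow> frag_extend a x \<in> N" "x \<in> relators S R"
  shows "frag_extend a x \<in> N"
  using relators_least[OF assms(1) _ add_subgroup_vimage_frag_extend[OF assms(2)], of a] assms(3,4)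
  by blast

text \<open>Both terms of the difference are additive in \<open>x\<close>, so a congruence modulo
  \<open>N\<close> on generators spreads to all of \<open>frags S\<close>.\<close>

lemma frag_extend_in_subgroup_induct:
  assumes N: "add_subgroup N" and a: "\<And>v. v \<in> S \<Longrightarrow> frag_extend b (a v) - frag_of v \<in> N"
    and x: "x \<in> frags S"
  shows "frag_extend b (frag_extend a x) - x \<in> N"
  using x
proof (intro free_Abelian_group_induct[where S=S and x=x and P="\<lambda>x. frag_extend b (frag_extend a x) - x \<in> N"])
  fix x y
  assume xy: "frag_extend b (frag_extend a x) - x \<in> N" "frag_extend b (frag_extend a y) - y \<in> N"
  have "frag_extend b (frag_extend a (x - y)) - (x - y)
      = (frag_extend b (frag_extend a x) - x) - (frag_extend b (frag_extend a y) - y)"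
    by (simp add: frag_extend_diff)
  then show "frag_extend b (frag_extend a (x - y)) - (x - y) \<in> N"
    by (simp only: add_subgroup_diff[OF N xy])
qed (use N a in \<open>auto simp: add_subgroup_0\<close>)

text \<open>\<open>aR\<close> and \<open>bR\<close> let the maps given on generators descend to the
  quotients, \<open>ba\<close> and \<open>ab\<close> make them mutually inverse there. The first
  isomorphism theorem is applied to \<open>frag_extend a\<close> followed by the projection;
  \<open>b\<close> supplies surjectivity and the kernel.\<close>

theorem abelian_presentation_iso:
  fixes a :: "'v \<Rightarrow> ('w \<Rightarrow>\<^sub>0 int)" and b :: "'w \<Rightarrow> ('v \<Rightarrow>\<^sub>0 int)"
  assumes R: "R \<subseteq> frags S" and R': "R' \<subseteq> frags S'"
    and a: "\<And>v. v \<in> S \<Longrightarrow> a v \<in> frags S'" and b: "\<And>w. w \<in> S' \<Longrightarrow> b w \<in> frags S"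
    and aR: "\<And>x. x \<in> R \<Longrightarrow> frag_extend a x \<in> relators S' R'"
    and bR: "\<And>x. x \<in> R' \<Longrightarrow> frag_extend b x \<in> relators S R"
    and ba: "\<And>v. v \<in> S \<Longrightarrow> frag_extend b (a v) - frag_of v \<in> relators S R"
    and ab: "\<And>w. w \<in> S' \<Longrightarrow> frag_extend a (b w) - frag_of w \<in> relators S' R'"
  shows "abelian_presentation S R \<cong> abelian_presentation S' R'"
proof -
  let ?X = "free_Abelian_group S" and ?Y = "free_Abelian_group S'"
  let ?N = "relators S R" and ?M = "relators S' R'"
  let ?h = "\<lambda>x. ?M #>\<^bsub>?Y\<^esub> frag_extend a x"
  interpret X: group ?X by simp
  interpret Y: comm_group ?Y by (rule abelian_free_Abelian_group)
  have N: "add_subgroup ?N" and M: "add_subgroup ?M"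
    using R R' by (auto intro: add_subgroup_relators)
  have subM: "subgroup ?M ?Y"
    using R' by (intro Y.generate_is_subgroup) auto
  then have norm: "?M \<lhd> ?Y"
    by (rule Y.subgroup_imp_normal)
  interpret M: normal ?M ?Y by (rule norm)
  interpret Q: group "?Y Mod ?M" by (rule M.factorgroup_is_group)
  have ac: "frag_extend a x \<in> carrier ?Y" if "x \<in> carrier ?X" for x
    using frag_extend_in_subgroup[where S=S and N="frags S'" and a=a and x=x] add_subgroup_frags a that by auto
  have hom: "?h \<in> hom ?X (?Y Mod ?M)"
  proof (rule homI)
    fix x assume "x \<in> carrier ?X"
    then show "?h x \<in> carrier (?Y Mod ?M)"
      using ac[of x] unfolding FactGroup_def RCOSETS_def by auto
  next
    fix x y assume "x \<in> carrier ?X" "y \<in> carrier ?X"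
    then show "?h (x \<otimes>\<^bsub>?X\<^esub> y) = ?h x \<otimes>\<^bsub>?Y Mod ?M\<^esub> ?h y"
      using ac[of x] ac[of y] M.rcos_sum[of "frag_extend a x" "frag_extend a y"]
      by (simp add: frag_extend_add)
  qed
  interpret h: group_hom ?X "?Y Mod ?M" ?h
    by unfold_locales (rule hom)
  have surj: "?h ` carrier ?X = carrier (?Y Mod ?M)"
  proof (intro equalityI subsetI)
    fix c assume "c \<in> carrier (?Y Mod ?M)"
    then obtain y where y: "y \<in> carrier ?Y" "c = ?M #>\<^bsub>?Y\<^esub> y"
      by (auto simp: FactGroup_def RCOSETS_def)
    let ?x = "frag_extend b y"
    have x: "?x \<in> carrier ?X"
      using frag_extend_in_subgroup[where S=S' and N="frags S" and a=b and x=y] add_subgroup_frags b y by auto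
    have "frag_extend a ?x - y \<in> ?M"
      using frag_extend_in_subgroup_induct[where S=S' and N="?M" and a=b and b=a and x=y] M ab y by auto
    then have "frag_extend a ?x \<in> ?M #>\<^bsub>?Y\<^esub> y"
      by (auto simp: r_coset_def intro!: bexI[of _ "frag_extend a ?x - y"])
    then have "?h ?x = c"
      using Y.repr_independence[OF _ _ subM] y by auto
    with x show "c \<in> ?h ` carrier ?X" by blast
  qed auto
  have ker: "kernel ?X (?Y Mod ?M) ?h = ?N"
  proof (intro equalityI subsetI)
    fix x assume "x \<in> kernel ?X (?Y Mod ?M) ?h"
    then have x: "x \<in> carrier ?X" and "?h x = ?M"
      by (auto simp: kernel_def FactGroup_def)
    then have "frag_extend a x \<in> ?M"
      using Y.rcos_self[OF ac[OF x] subM] by simp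
    then have "frag_extend b (frag_extend a x) \<in> ?N"
      by (intro frag_extend_relators[OF R' N bR])
    moreover have "frag_extend b (frag_extend a x) - x \<in> ?N"
      using frag_extend_in_subgroup_induct[where S=S and N="?N" and a=a and b=b and x=x] N ba x by auto
    ultimately have "frag_extend b (frag_extend a x) - (frag_extend b (frag_extend a x) - x) \<in> ?N"
      by (rule add_subgroup_diff[OF N])
    then show "x \<in> ?N" by simp
  next
    fix x assume x: "x \<in> ?N"
    then have "frag_extend a x \<in> ?M"
      by (intro frag_extend_relators[OF R M aR])
    then have "?h x = ?M"
      using Y.coset_join2[OF _ subM] ac relators_frags[OF R] x by auto
    then show "x \<in> kernel ?X (?Y Mod ?M) ?h"
      using relators_frags[OF R] x by (auto simp: kernel_def FactGroup_def)
  qed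
  show ?thesis
    using h.FactGroup_iso[OF surj] by (simp add: ker abelian_presentation_def)
qed

lemma abelian_presentation_sym:
  assumes "R \<subseteq> frags S" "abelian_presentation S R \<cong> X"
  shows "X \<cong> abelian_presentation S R"
proof -
  interpret comm_group "free_Abelian_group S" by (rule abelian_free_Abelian_group)
  have "relators S R \<lhd> free_Abelian_group S"
    using assms(1) by (intro subgroup_imp_normal generate_is_subgroup) auto
  then have "group (abelian_presentation S R)"
    unfolding abelian_presentation_def by (rule normal.factorgroup_is_group)
  then show ?thesis
    using assms(2) by (rule group.iso_sym)
qed

lemma abelian_presentation_cong:
  assumes "R \<subseteq> frags S" "R' \<subseteq> frags S" "R \<subseteq> relators S R'" "R' \<subseteq> relators S R"
  shows "abelian_presentation S R = abelian_presentation S R'"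
proof -
  have "relators S R = relators S R'"
    using assms by (intro equalityI relators_least add_subgroup_relators)
  then show ?thesis by (simp add: abelian_presentation_def)
qed

subsection \<open>The cokernels of a square integer matrix and of its transpose\<close>

definition row_relator :: "'v set \<Rightarrow> ('v \<Rightarrow> 'v \<Rightarrow> int) \<Rightarrow> 'v \<Rightarrow> ('v \<Rightarrow>\<^sub>0 int)" where
  "row_relator I M i = (\<Sum>j\<in>I. frag_cmul (M i j) (frag_of j))"

text \<open>The rows of \<open>M\<close> are the relations. Rows and columns share the index set
  \<open>I\<close>, so a matrix and its transpose present groups on the same generators.\<close>

definition coker :: "'v set \<Rightarrow> ('v \<Rightarrow> 'v \<Rightarrow> int) \<Rightarrow> ('v \<Rightarrow>\<^sub>0 int) set monoid" where
  "coker I M = abelian_presentation I (row_relator I M ` I)"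

abbreviation (input) transp :: "('v \<Rightarrow> 'v \<Rightarrow> int) \<Rightarrow> 'v \<Rightarrow> 'v \<Rightarrow> int" where
  "transp M \<equiv> (\<lambda>i j. M j i)"

definition rowop :: "'v \<Rightarrow> 'v \<Rightarrow> int \<Rightarrow> ('v \<Rightarrow> 'v \<Rightarrow> int) \<Rightarrow> 'v \<Rightarrow> 'v \<Rightarrow> int" where
  "rowop i l k M = (\<lambda>a b. if a = i then M i b + k * M l b else M a b)"

definition colop :: "'v \<Rightarrow> 'v \<Rightarrow> int \<Rightarrow> ('v \<Rightarrow> 'v \<Rightarrow> int) \<Rightarrow> 'v \<Rightarrow> 'v \<Rightarrow> int" where
  "colop i l k M = (\<lambda>a b. if b = i then M a i + k * M a l else M a b)"

lemma transp_rowop: "transp (rowop i l k M) = colop i l k (transp M)"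
  by (intro ext) (simp add: rowop_def colop_def)

lemma transp_colop: "transp (colop i l k M) = rowop i l k (transp M)"
  by (intro ext) (simp add: rowop_def colop_def)

lemma row_relator_frags: "row_relator I M i \<in> frags I"
  unfolding row_relator_def
  by (rule add_subgroup_sum[OF add_subgroup_frags], rule add_subgroup_frag_cmul[OF add_subgroup_frags])
    auto

lemma row_relators_frags: "row_relator I M ` J \<subseteq> frags I"
  by (intro image_subsetI row_relator_frags)

lemma row_relator_rowop:
  "row_relator I (rowop i l k M) a =
     (if a = i then row_relator I M i + frag_cmul k (row_relator I M l) else row_relator I M a)"
  by (simp add: row_relator_def rowop_def frag_cmul_distrib sum.distrib frag_cmul_sum o_def)

lemma rowop_inverse:
  assumes "i \<noteq> l"
  shows "rowop i l (- k) (rowop i l k M) = M"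
  using assms by (intro ext) (simp add: rowop_def)

text \<open>A row operation replaces the relations by others with the same span, so the groups are
  equal and not merely isomorphic.\<close>

lemma coker_rowop:
  assumes "i \<in> I" "l \<in> I" "i \<noteq> l"
  shows "coker I (rowop i l k M) = coker I M"
proof -
  have *: "row_relator I (rowop i l k M) ` I \<subseteq> relators I (row_relator I M ` I)" for k M
  proof -
    note sg = add_subgroup_relators[OF row_relators_frags]
    have r: "row_relator I M a \<in> relators I (row_relator I M ` I)" if "a \<in> I" for a
      using that by (intro relators_incl) auto
    show ?thesis
      using add_subgroup_add[OF sg r add_subgroup_frag_cmul[OF sg r]] r assms
      by (auto simp: row_relator_rowop)
  qed
  have **: "row_relator I M ` I \<subseteq> relators I (row_relator I (rowop i l k M) ` I)"
    using *[of "- k" "rowop i l k M"] by (simp add: rowop_inverse[OF assms(3)])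
  show ?thesis
    unfolding coker_def
    by (rule abelian_presentation_cong[OF row_relators_frags row_relators_frags * **])
qed

text \<open>Adding \<open>k\<close> times column \<open>l\<close> to column \<open>i\<close> has the
  same effect on the relations as substituting the generator \<open>l\<close> by itself plus
  \<open>k\<close> times the generator \<open>i\<close>.\<close>

lemma row_relator_colop:
  assumes "finite I" "i \<in> I" "l \<in> I" "i \<noteq> l"
  shows "row_relator I (colop i l k M) a =
    frag_extend (\<lambda>v. if v = l then frag_of l + frag_cmul k (frag_of i) else frag_of v) (row_relator I M a)"
    (is "_ = frag_extend ?a _")
proof -
  have "frag_extend ?a (row_relator I M a) = (\<Sum>j\<in>I. frag_cmul (M a j) (?a j))"
    using assms(1) by (simp add: row_relator_def frag_extend_sum frag_extend_cmul o_def)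
  also have "\<dots> = (\<Sum>j\<in>I. frag_cmul (M a j) (frag_of j)
      + (if j = l then frag_cmul (M a l) (frag_cmul k (frag_of i)) else 0))"
    by (intro sum.cong) (auto simp: frag_cmul_distrib2)
  also have "\<dots> = row_relator I M a + frag_cmul (M a l * k) (frag_of i)"
    using assms by (simp add: sum.distrib row_relator_def)
  also have "\<dots> = (\<Sum>j\<in>I. frag_cmul (M a j) (frag_of j)
      + (if j = i then frag_cmul (k * M a l) (frag_of i) else 0))"
    using assms by (simp add: sum.distrib row_relator_def mult.commute)
  also have "\<dots> = row_relator I (colop i l k M) a"
    unfolding row_relator_def
    by (intro sum.cong) (auto simp: frag_cmul_distrib colop_def)
  finally show ?thesis by simp
qed

lemma colop_inverse:
  assumes "i \<noteq> l"
  shows "colop i l (- k) (colop i l k M) = M"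
  using assms by (intro ext) (simp add: colop_def)

text \<open>A column operation changes the generators, hence gives an isomorphism only; the
  substitution with \<open>- k\<close> is the inverse.\<close>

lemma coker_colop:
  assumes "finite I" "i \<in> I" "l \<in> I" "i \<noteq> l"
  shows "coker I M \<cong> coker I (colop i l k M)"
proof -
  let ?a = "\<lambda>k v. if v = l then frag_of l + frag_cmul k (frag_of i) else frag_of v"
  note rc = row_relator_colop[OF assms]
  have z: "0 \<in> relators I (row_relator I M ` I)" for M
    by (rule add_subgroup_0[OF add_subgroup_relators[OF row_relators_frags]])
  have inv: "frag_extend (?a (- k)) (row_relator I (colop i l k M) x) = row_relator I M x" for x
    using rc[of "- k" "colop i l k M" x] by (simp add: colop_inverse[OF assms(4)])
  have fr: "?a k v \<in> frags I" if "v \<in> I" for k v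
  proof -
    have "frag_of i \<in> frags I" "frag_of l \<in> frags I" "frag_of v \<in> frags I"
      using assms that by auto
    then have "frag_of l + frag_cmul k (frag_of i) \<in> frags I" "frag_of v \<in> frags I"
      using add_subgroup_frags add_subgroup_add add_subgroup_frag_cmul by metis+
    then show ?thesis by (cases "v = l") simp_all
  qed
  have aa: "frag_extend (?a k) (?a k' v) = (if v = l then frag_of l + frag_cmul (k + k') (frag_of i) else frag_of v)"
    for k k' v
    using assms(4) by (simp add: frag_extend_add frag_extend_cmul frag_cmul_distrib add_ac)
  show ?thesis
    unfolding coker_def
  proof (rule abelian_presentation_iso[of _ _ _ _ "?a k" "?a (- k)",
        OF row_relators_frags row_relators_frags fr fr])
    show "frag_extend (?a k) x \<in> relators I (row_relator I (colop i l k M) ` I)"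
      if "x \<in> row_relator I M ` I" for x
      using that by (auto simp flip: rc intro: relators_incl)
    show "frag_extend (?a (- k)) x \<in> relators I (row_relator I M ` I)"
      if "x \<in> row_relator I (colop i l k M) ` I" for x
      using that by (auto simp: inv intro: relators_incl)
  qed (use z in \<open>simp_all add: aa\<close>)
qed

section \<open>Diagonalisation by elementary operations\<close>

text \<open>\<open>U\<close> is the block still to be diagonalised; confining the operations to it
  protects the rows and columns already cleared.\<close>

inductive elem_step :: "'v set \<Rightarrow> ('v \<Rightarrow> 'v \<Rightarrow> int) \<Rightarrow> ('v \<Rightarrow> 'v \<Rightarrow> int) \<Rightarrow> bool" for U where
  row: "i \<in> U \<Longrightarrow> l \<in> U \<Longrightarrow> i \<noteq> l \<Longrightarrow> elem_step U M (rowop i l k M)"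
| col: "i \<in> U \<Longrightarrow> l \<in> U \<Longrightarrow> i \<noteq> l \<Longrightarrow> elem_step U M (colop i l k M)"

text \<open>Transposition exchanges row and column operations, so a step of either kind acts by an
  equality on one of the two cokernels and by an isomorphism on the other.\<close>

lemma coker_transp_elem_step:
  assumes I: "finite I" "U \<subseteq> I" and s: "elem_step U M M'"
    and M': "coker I M' \<cong> coker I (transp M')"
  shows "coker I M \<cong> coker I (transp M)"
  using s
proof cases
  case (row i l k)
  have "coker I M \<cong> coker I (transp M')"
    using M' coker_rowop[of i I l k M] row I by (metis subsetD)
  moreover have "coker I (transp M) \<cong> coker I (transp M')"
    unfolding row(1) transp_rowop by (rule coker_colop) (use row I in auto)
  then have "coker I (transp M') \<cong> coker I (transp M)"
    unfolding coker_def by (rule abelian_presentation_sym[OF row_relators_frags])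
  ultimately show ?thesis by (rule iso_trans)
next
  case (col i l k)
  have "coker I M \<cong> coker I M'"
    unfolding col(1) by (rule coker_colop) (use col I in auto)
  moreover have "coker I (transp M') = coker I (transp M)"
    unfolding col(1) transp_colop by (rule coker_rowop) (use col I in auto)
  ultimately show ?thesis
    using iso_trans[OF _ M', of "coker I M"] by (simp only:)
qed

lemma coker_transp_elem_steps:
  assumes I: "finite I" "U \<subseteq> I" and r: "(elem_step U)\<^sup>*\<^sup>* M M'"
    and M': "coker I M' \<cong> coker I (transp M')"
  shows "coker I M \<cong> coker I (transp M)"
  using r
proof (induction rule: converse_rtranclp_induct)
  case base
  show ?case by (rule M')
next
  case (step y z)
  then show ?case by (intro coker_transp_elem_step[OF I step(1)])
qed

definition diagonal_off :: "'v set \<Rightarrow> 'v set \<Rightarrow> ('v \<Rightarrow> 'v \<Rightarrow> int) \<Rightarrow> bool" where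
  "diagonal_off I U M \<longleftrightarrow> (\<forall>i\<in>I. \<forall>j\<in>I. i \<noteq> j \<longrightarrow> i \<notin> U \<or> j \<notin> U \<longrightarrow> M i j = 0)"

lemma diagonal_off_elem_steps:
  assumes "U \<subseteq> I" "(elem_step U)\<^sup>*\<^sup>* M M'" "diagonal_off I U M"
  shows "diagonal_off I U M'"
  using assms(2,3)
proof (induction rule: rtranclp_induct)
  case (step y z)
  note IH = step(3)[OF step(4)]
  from step(2) show ?case
  proof cases
    case (row i l k)
    have "z a b = 0" if "a \<in> I" "b \<in> I" "a \<noteq> b" "a \<notin> U \<or> b \<notin> U" for a b
    proof (cases "a = i")
      case True
      then have "b \<notin> U" "b \<noteq> l" using row that by auto
      then have "y i b = 0" "y l b = 0"
        using IH row that True assms(1) by (auto simp: diagonal_off_def)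
      then show ?thesis by (simp add: row(1) rowop_def True)
    qed (use IH that row in \<open>simp add: diagonal_off_def rowop_def\<close>)
    then show ?thesis by (auto simp: diagonal_off_def)
  next
    case (col i l k)
    have "z a b = 0" if "a \<in> I" "b \<in> I" "a \<noteq> b" "a \<notin> U \<or> b \<notin> U" for a b
    proof (cases "b = i")
      case True
      then have "a \<notin> U" "a \<noteq> l" using col that by auto
      then have "y a i = 0" "y a l = 0"
        using IH col that True assms(1) by (auto simp: diagonal_off_def)
      then show ?thesis by (simp add: col(1) colop_def True)
    qed (use IH that col in \<open>simp add: diagonal_off_def colop_def\<close>)
    then show ?thesis by (auto simp: diagonal_off_def)
  qed
qed

text \<open>\<open>dv\<close> speaks of every reachable matrix with pivot \<open>d\<close>, since
  each clearing operation passes to a new matrix. Adding a multiple of the pivot column to column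
  \<open>l\<close> leaves the entries cleared before untouched.\<close>

lemma clear_row:
  assumes U: "i \<in> U" and nz: "d \<noteq> 0"
    and M: "M i i = d"
    and dv: "\<And>M' l. (elem_step U)\<^sup>*\<^sup>* M M' \<Longrightarrow> l \<in> U \<Longrightarrow> M' i i = d \<Longrightarrow> d dvd M' i l"
    and T: "finite T" "T \<subseteq> U - {i}"
  shows "\<exists>M'. (elem_step U)\<^sup>*\<^sup>* M M' \<and> M' i i = d \<and> (\<forall>l\<in>T. M' i l = 0)"
  using T
proof (induction T rule: finite_induct)
  case empty
  show ?case using M by blast
next
  case (insert l T)
  then obtain M' where M': "(elem_step U)\<^sup>*\<^sup>* M M'" "M' i i = d" "\<forall>l\<in>T. M' i l = 0"
    by auto
  let ?M = "colop l i (- (M' i l div d)) M'"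
  have l: "l \<in> U" "l \<noteq> i" using insert by auto
  then have "elem_step U M' ?M" using U by (intro elem_step.col) auto
  then have "(elem_step U)\<^sup>*\<^sup>* M ?M" using M'(1) by auto
  moreover have "?M i i = d" using l M' by (simp add: colop_def)
  moreover have "?M i l = 0" using dv[OF M'(1) l(1) M'(2)] M'(2) by (simp add: colop_def)
  moreover have "\<forall>t\<in>T. ?M i t = 0" using insert M' by (auto simp: colop_def)
  ultimately show ?case by blast
qed

text \<open>Only multiples of row \<open>i\<close> are added to other rows, so row \<open>i\<close>
  stays cleared while its column is being cleared.\<close>

lemma clear_col:
  assumes U: "i \<in> U" and nz: "d \<noteq> 0"
    and M: "M i i = d" and r0: "\<forall>l\<in>U - {i}. M i l = 0"
    and dv: "\<And>M' l. (elem_step U)\<^sup>*\<^sup>* M M' \<Longrightarrow> l \<in> U \<Longrightarrow> M' i i = d \<Longrightarrow> d dvd M' l i"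
    and T: "finite T" "T \<subseteq> U - {i}"
  shows "\<exists>M'. (elem_step U)\<^sup>*\<^sup>* M M' \<and> M' i i = d \<and> (\<forall>l\<in>U - {i}. M' i l = 0) \<and> (\<forall>l\<in>T. M' l i = 0)"
  using T
proof (induction T rule: finite_induct)
  case empty
  show ?case using M r0 by blast
next
  case (insert l T)
  then obtain M' where M': "(elem_step U)\<^sup>*\<^sup>* M M'" "M' i i = d" "\<forall>l\<in>U - {i}. M' i l = 0"
      "\<forall>l\<in>T. M' l i = 0"
    by auto
  let ?M = "rowop l i (- (M' l i div d)) M'"
  have l: "l \<in> U" "l \<noteq> i" using insert by auto
  then have "elem_step U M' ?M" using U by (intro elem_step.row) auto
  then have "(elem_step U)\<^sup>*\<^sup>* M ?M" using M'(1) by auto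
  moreover have "?M i i = d" using l M' by (simp add: rowop_def)
  moreover have "?M l i = 0" using dv[OF M'(1) l(1) M'(2)] M'(2) by (simp add: rowop_def)
  moreover have "\<forall>t\<in>T. ?M t i = 0" using insert M' by (auto simp: rowop_def)
  moreover have "\<forall>t\<in>U - {i}. ?M i t = 0" using l M' by (auto simp: rowop_def)
  ultimately show ?case by blast
qed

lemma abs_mod_less_of_not_dvd:
  fixes d m :: int
  assumes "\<not> d dvd m" "d \<noteq> 0"
  shows "m mod d \<noteq> 0" "\<bar>m mod d\<bar> < \<bar>d\<bar>"
  using assms abs_mod_less[of d m] by (auto simp: dvd_eq_mod_eq_0)

text \<open>Among the block entries of all reachable matrices, a nonzero one of least absolute value
  divides its whole row and column: otherwise one more operation would produce a smaller nonzero
  remainder.\<close>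

lemma isolate_pivot:
  fixes M :: "'v \<Rightarrow> 'v \<Rightarrow> int"
  assumes U: "finite U" and nz: "a \<in> U" "b \<in> U" "M a b \<noteq> 0"
  shows "\<exists>i\<in>U. \<exists>M'. (elem_step U)\<^sup>*\<^sup>* M M' \<and> (\<forall>l\<in>U - {i}. M' i l = 0 \<and> M' l i = 0)"
proof -
  let ?P = "\<lambda>(M', i, j). (elem_step U)\<^sup>*\<^sup>* M M' \<and> i \<in> U \<and> j \<in> U \<and> M' i j \<noteq> 0"
  let ?f = "\<lambda>(M', i, j). nat \<bar>M' i j :: int\<bar>"
  have "?P (M, a, b)" using nz by simp
  from ex_has_least_nat[of ?P, OF this, of ?f]
  obtain x where x: "?P x" "\<And>y. ?P y \<Longrightarrow> ?f x \<le> ?f y" by blast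
  obtain M1 i j where xe: "x = (M1, i, j)" by (cases x)
  define d where "d = M1 i j"
  have M1: "(elem_step U)\<^sup>*\<^sup>* M M1" and ij: "i \<in> U" "j \<in> U" and d0: "d \<noteq> 0"
    using x(1) by (auto simp: xe d_def)
  have mn: "\<bar>d\<bar> \<le> \<bar>M' r s\<bar>" if "(elem_step U)\<^sup>*\<^sup>* M M'" "r \<in> U" "s \<in> U" "M' r s \<noteq> 0" for M' r s
    using x(2)[of "(M', r, s)"] that by (simp add: xe d_def)
  have dvr: "d dvd M' r s" if M': "(elem_step U)\<^sup>*\<^sup>* M M'" and rs: "r \<in> U" "s \<in> U"
    and p: "p \<in> U" "M' r p = d" for M' r s p
  proof (cases "s = p")
    case True
    then show ?thesis using p by simp
  next
    case False
    let ?M = "colop s p (- (M' r s div d)) M'"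
    have "elem_step U M' ?M" using rs p False by (intro elem_step.col) auto
    then have "(elem_step U)\<^sup>*\<^sup>* M ?M" using M' by auto
    moreover have "?M r s = M' r s mod d"
      using p by (simp add: colop_def minus_mult_div_eq_mod[symmetric] mult.commute)
    ultimately show ?thesis
      using mn[of ?M r s] rs abs_mod_less_of_not_dvd[of d "M' r s"] d0 by force
  qed
  have dvc: "d dvd M' r s" if M': "(elem_step U)\<^sup>*\<^sup>* M M'" and rs: "r \<in> U" "s \<in> U"
    and p: "p \<in> U" "M' p s = d" for M' r s p
  proof (cases "r = p")
    case True
    then show ?thesis using p by simp
  next
    case False
    let ?M = "rowop r p (- (M' r s div d)) M'"
    have "elem_step U M' ?M" using rs p False by (intro elem_step.row) auto
    then have "(elem_step U)\<^sup>*\<^sup>* M ?M" using M' by auto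
    moreover have "?M r s = M' r s mod d"
      using p by (simp add: rowop_def minus_mult_div_eq_mod[symmetric] mult.commute)
    ultimately show ?thesis
      using mn[of ?M r s] rs abs_mod_less_of_not_dvd[of d "M' r s"] d0 by force
  qed
  obtain M2 where M2: "(elem_step U)\<^sup>*\<^sup>* M M2" "M2 i i = d"
  proof (cases "i = j")
    case True
    then show ?thesis using that M1 d_def by simp
  next
    case False
    \<comment> \<open>Brings the pivot to the diagonal. As \<open>d\<close> divides
      \<open>M1 i i\<close>, the new diagonal entry is \<open>M1 i i + d - M1 i i\<close>.\<close>
    let ?M = "colop i j (1 - M1 i i div d) M1"
    have "elem_step U M1 ?M" using ij False by (intro elem_step.col) auto
    then have "(elem_step U)\<^sup>*\<^sup>* M ?M" using M1 by auto
    moreover have "?M i i = d"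
      using dvr[OF M1 ij(1) ij(1) ij(2)] by (simp add: colop_def d_def[symmetric] algebra_simps)
    ultimately show ?thesis using that by blast
  qed
  have "\<exists>M'. (elem_step U)\<^sup>*\<^sup>* M2 M' \<and> M' i i = d \<and> (\<forall>l\<in>U - {i}. M' i l = 0)"
  proof (rule clear_row[where U = U and d = d and M = M2])
    show "d dvd M' i l" if "(elem_step U)\<^sup>*\<^sup>* M2 M'" "l \<in> U" "M' i i = d" for M' l
      by (rule dvr[OF rtranclp_trans[OF M2(1) that(1)] ij(1) that(2) ij(1) that(3)])
  qed (use U ij d0 M2 in auto)
  then obtain M3 where "(elem_step U)\<^sup>*\<^sup>* M2 M3" and M3': "M3 i i = d" "\<forall>l\<in>U - {i}. M3 i l = 0"
    by blast
  note M3 = rtranclp_trans[OF M2(1) this(1)] M3'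
  have "\<exists>M'. (elem_step U)\<^sup>*\<^sup>* M3 M' \<and> M' i i = d \<and> (\<forall>l\<in>U - {i}. M' i l = 0)
      \<and> (\<forall>l\<in>U - {i}. M' l i = 0)"
  proof (rule clear_col[where U = U and d = d and M = M3])
    show "d dvd M' l i" if "(elem_step U)\<^sup>*\<^sup>* M3 M'" "l \<in> U" "M' i i = d" for M' l
      by (rule dvc[OF rtranclp_trans[OF M3(1) that(1)] that(2) ij(1) ij(1) that(3)])
  qed (use U ij d0 M3 in auto)
  then obtain M4 where M4: "(elem_step U)\<^sup>*\<^sup>* M3 M4" "\<forall>l\<in>U - {i}. M4 i l = 0 \<and> M4 l i = 0"
    by blast
  show ?thesis
    using ij(1) rtranclp_trans[OF M3(1) M4(1)] M4(2) by blast
qed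

text \<open>Each isolated pivot leaves the block \<open>U\<close>, and from a zero block any index
  may be dropped. For empty \<open>U\<close> the matrix is diagonal on \<open>I\<close>, hence
  symmetric there.\<close>

lemma coker_transp_aux:
  assumes I: "finite I" "U \<subseteq> I" and M: "diagonal_off I U M"
  shows "coker I M \<cong> coker I (transp M)"
  using I(2) M
proof (induction "card U" arbitrary: U M)
  case (0 U)
  have "finite U" by (rule finite_subset[OF 0(2) I(1)])
  then have U: "U = {}" using 0 by simp
  then have "M i j = M j i" if "i \<in> I" "j \<in> I" for i j
    using 0(3) that U by (cases "i = j") (auto simp: diagonal_off_def)
  then have "row_relator I (transp M) i = row_relator I M i" if "i \<in> I" for i
    unfolding row_relator_def using that by (intro sum.cong) auto
  then have "coker I (transp M) = coker I M"
    unfolding coker_def by (simp cong: image_cong)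
  then show ?case by (simp add: iso_refl)
next
  case (Suc n U M)
  have finU: "finite U" by (rule finite_subset[OF Suc(3) I(1)])
  show ?case
  proof (cases "\<forall>a\<in>U. \<forall>b\<in>U. M a b = 0")
    case True
    from Suc(2) obtain i where i: "i \<in> U"
      by (metis card.empty ex_in_conv nat.distinct(1))
    have "diagonal_off I (U - {i}) M"
      using True Suc(4) i by (auto simp: diagonal_off_def)
    moreover have "n = card (U - {i})" using Suc(2) i finU by simp
    moreover have "U - {i} \<subseteq> I" using Suc(3) by blast
    ultimately show ?thesis by (intro Suc(1))
  next
    case False
    then obtain a b where "a \<in> U" "b \<in> U" "M a b \<noteq> 0" by blast
    from isolate_pivot[where M = M, OF finU this] obtain i M' where M': "i \<in> U" "(elem_step U)\<^sup>*\<^sup>* M M'"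
        "\<forall>l\<in>U - {i}. M' i l = 0 \<and> M' l i = 0"
      by blast
    have "diagonal_off I (U - {i}) M'"
      using M' diagonal_off_elem_steps[OF Suc(3) M'(2) Suc(4)] by (auto simp: diagonal_off_def)
    moreover have "n = card (U - {i})" using Suc(2) M'(1) finU by simp
    moreover have "U - {i} \<subseteq> I" using Suc(3) by blast
    ultimately have "coker I M' \<cong> coker I (transp M')" by (intro Suc(1))
    then show ?thesis
      by (rule coker_transp_elem_steps[OF I(1) Suc(3) M'(2)])
  qed
qed

theorem coker_transp:
  assumes "finite I"
  shows "coker I M \<cong> coker I (transp M)"
  by (rule coker_transp_aux[OF assms order_refl]) (simp add: diagonal_off_def)

subsection \<open>Forests and spanning trees\<close>

definition edge_reach :: "('e \<Rightarrow> 'v set) \<Rightarrow> 'e set \<Rightarrow> 'v \<Rightarrow> 'v \<Rightarrow> bool" where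
  "edge_reach bd F = (\<lambda>x y. \<exists>e\<in>F. bd e = {x, y})\<^sup>*\<^sup>*"

text \<open>A forest, expressed by every edge being a bridge. Parallel edges thus count as a cycle,
  as they must in a multigraph.\<close>

definition acyclic_edges :: "('e \<Rightarrow> 'v set) \<Rightarrow> 'e set \<Rightarrow> bool" where
  "acyclic_edges bd F \<longleftrightarrow> (\<forall>e\<in>F. \<forall>a b. bd e = {a, b} \<longrightarrow> \<not> edge_reach bd (F - {e}) a b)"

lemma edge_reach_refl [simp]: "edge_reach bd F a a"
  by (simp add: edge_reach_def)

lemma edge_reach_step:
  "edge_reach bd F a b \<Longrightarrow> e \<in> F \<Longrightarrow> bd e = {b, c} \<Longrightarrow> edge_reach bd F a c"
  unfolding edge_reach_def by (erule rtranclp.rtrancl_into_rtrancl) blast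

lemma edge_reach_mono:
  assumes "F \<subseteq> F'" "edge_reach bd F a b"
  shows "edge_reach bd F' a b"
  using assms(2) unfolding edge_reach_def
  by (rule rtranclp_mono[THEN predicate2D, rotated]) (use assms(1) in blast)

lemma acyclic_edges_subset:
  assumes "acyclic_edges bd F'" "F \<subseteq> F'"
  shows "acyclic_edges bd F"
proof -
  have "F - {e} \<subseteq> F' - {e}" for e using assms(2) by blast
  then show ?thesis
    using assms edge_reach_mono unfolding acyclic_edges_def by (metis subsetD)
qed

text \<open>A new edge of a forest joins two distinct components; shifting the potential by a
  constant on one of them adjusts the difference along this edge and along no other.\<close>

lemma forest_potential:
  fixes \<phi> :: "'e \<Rightarrow> 'a::ab_group_add"
  assumes "finite F" "acyclic_edges bd F" "\<And>e. e \<in> F \<Longrightarrow> bd e = {s e, t e}"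
    and H: "add_subgroup H" "\<And>e. e \<in> F \<Longrightarrow> \<phi> e \<in> H"
  shows "\<exists>p. (\<forall>v. p v \<in> H) \<and> (\<forall>e\<in>F. p (t e) - p (s e) = \<phi> e)"
  using assms
proof (induction F rule: finite_induct)
  case empty
  then show ?case using add_subgroup_0 by (intro exI[of _ "\<lambda>_. 0"]) auto
next
  case (insert e F)
  have "acyclic_edges bd F"
    by (rule acyclic_edges_subset[OF insert.prems(1)]) auto
  then have "\<exists>p. (\<forall>v. p v \<in> H) \<and> (\<forall>e\<in>F. p (t e) - p (s e) = \<phi> e)"
    using insert.prems by (intro insert.IH) auto
  then obtain p where "\<forall>v. p v \<in> H" "\<forall>e\<in>F. p (t e) - p (s e) = \<phi> e" by blast
  then have p: "\<And>v. p v \<in> H" "\<And>e. e \<in> F \<Longrightarrow> p (t e) - p (s e) = \<phi> e" by blast+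
  define X where "X = {v. edge_reach bd F (t e) v}"
  define d where "d = \<phi> e - (p (t e) - p (s e))"
  have d: "d \<in> H"
    unfolding d_def using insert.prems p by (intro add_subgroup_diff) auto
  have "bd e = {t e, s e}"
    using insert.prems(2)[of e] by auto
  then have "\<not> edge_reach bd (insert e F - {e}) (t e) (s e)"
    using insert.prems(1) unfolding acyclic_edges_def by blast
  then have s: "s e \<notin> X" "t e \<in> X"
    using insert.hyps(2) by (simp_all add: X_def)
  have X: "s f \<in> X \<longleftrightarrow> t f \<in> X" if "f \<in> F" for f
  proof -
    have "bd f = {s f, t f}" "bd f = {t f, s f}"
      using insert.prems(2)[of f] that by auto
    then show ?thesis
      unfolding X_def using that by (blast intro: edge_reach_step)
  qed
  let ?q = "\<lambda>v. if v \<in> X then p v + d else p v"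
  have "?q v \<in> H" for v
    using add_subgroup_add[OF insert.prems(3) p(1) d] p(1) by simp
  moreover have "?q (t f) - ?q (s f) = \<phi> f" if "f \<in> insert e F" for f
  proof (cases "f = e")
    case True
    then show ?thesis using s by (simp add: d_def)
  next
    case False
    then have "f \<in> F" using that by simp
    then show ?thesis using p(2)[of f] X[of f] by (cases "s f \<in> X") (auto simp: algebra_simps)
  qed
  ultimately show ?case by (intro exI[of _ ?q] conjI allI ballI)
qed

text \<open>Choose an edge \<open>e\<close> and an end \<open>u\<close> of it with the fewest
  vertices reachable from \<open>u\<close> without \<open>e\<close>. A second edge \<open>f\<close>
  at \<open>u\<close> would lead to a vertex \<open>x\<close> from which, without \<open>f\<close>,
  strictly fewer vertices are reachable.\<close>

lemma acyclic_edges_leaf: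
  assumes fin: "finite F" and ne: "F \<noteq> {}" and ac: "acyclic_edges bd F"
    and c2: "\<And>e. e \<in> F \<Longrightarrow> card (bd e) = 2"
  shows "\<exists>e\<in>F. \<exists>v\<in>bd e. \<forall>f\<in>F. v \<in> bd f \<longrightarrow> f = e"
proof -
  define X where "X = (\<lambda>(e, u). {v. edge_reach bd (F - {e}) u v})"
  have "finite (X (e, u))" for e u
  proof (rule finite_subset)
    show "X (e, u) \<subseteq> insert u (\<Union>(bd ` F))"
    proof
      fix v assume "v \<in> X (e, u)"
      then have "edge_reach bd (F - {e}) u v" by (simp add: X_def)
      then show "v \<in> insert u (\<Union>(bd ` F))"
        unfolding edge_reach_def by cases auto
    qed
    have "finite (bd e)" if "e \<in> F" for e
      using c2[OF that] by (intro card_ge_0_finite) simp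
    then show "finite (insert u (\<Union>(bd ` F)))" using fin by simp
  qed
  note finX = this
  obtain e0 where e0: "e0 \<in> F" using ne by blast
  then obtain u0 where "u0 \<in> bd e0" using c2[OF e0] by (metis card.empty ex_in_conv zero_neq_numeral)
  then have "(case (e0, u0) of (e, u) \<Rightarrow> e \<in> F \<and> u \<in> bd e)" using e0 by simp
  from ex_has_least_nat[where m = "card \<circ> X" and P = "\<lambda>(e, u). e \<in> F \<and> u \<in> bd e", OF this]
  obtain e u where eu: "e \<in> F" "u \<in> bd e"
    and mn: "\<And>f x. f \<in> F \<Longrightarrow> x \<in> bd f \<Longrightarrow> card (X (e, u)) \<le> card (X (f, x))"
    by (auto simp: split_paired_all)
  have "f = e" if f: "f \<in> F" "u \<in> bd f" for f
  proof (rule ccontr)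
    assume "f \<noteq> e"
    obtain x where x: "bd f = {u, x}" "x \<noteq> u"
    proof -
      obtain y z where "bd f = {y, z}" "y \<noteq> z"
        using c2[OF f(1)] by (auto simp: card_2_iff)
      then show thesis using f(2) that[of y] that[of z] by (auto simp: insert_commute)
    qed
    then have fx: "bd f = {x, u}" by auto
    have u: "u \<notin> X (f, x)"
      using ac f(1) fx unfolding acyclic_edges_def X_def by auto
    \<comment> \<open>A walk from \<open>x\<close> without \<open>f\<close> cannot return to
      \<open>u\<close>, hence never uses \<open>e\<close>.\<close>
    have "edge_reach bd (F - {e}) u v" if "edge_reach bd (F - {f}) x v" for v
      using that unfolding edge_reach_def[of bd "F - {f}"]
    proof (induction rule: rtranclp_induct)
      case base
      show ?case by (rule edge_reach_step[of _ _ _ u f]) (use f \<open>f \<noteq> e\<close> x in auto)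
    next
      case (step y z)
      then obtain g where g: "g \<in> F - {f}" "bd g = {y, z}" by blast
      have y: "y \<in> X (f, x)"
        using step(1) by (simp add: X_def edge_reach_def)
      then have "z \<in> X (f, x)"
        using g by (auto simp: X_def intro: edge_reach_step)
      then have "g \<noteq> e" using y u eu(2) g(2) by auto
      then show ?case using g step(3) by (auto intro: edge_reach_step)
    qed
    then have "X (f, x) \<subseteq> X (e, u)" by (auto simp: X_def)
    moreover have "u \<in> X (e, u)" by (simp add: X_def)
    ultimately have "card (X (f, x)) < card (X (e, u))"
      using u finX by (intro psubset_card_mono) auto
    then show False using mn[OF f(1), of x] x by auto
  qed
  then show ?thesis using eu by blast
qed

section \<open>Spanning trees, flows and potentials\<close>

text \<open>A tree is recorded through its growth: the node added last is a leaf, so rule induction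
  strips leaves.\<close>

inductive tree_on :: "('e \<Rightarrow> 'n set) \<Rightarrow> 'e set \<Rightarrow> 'n set \<Rightarrow> 'e set \<Rightarrow> bool" for inc E where
  root: "tree_on inc E {x} {}"
| grow: "tree_on inc E X D \<Longrightarrow> e \<in> E \<Longrightarrow> inc e = {f, g} \<Longrightarrow> f \<in> X \<Longrightarrow> g \<notin> X \<Longrightarrow>
    tree_on inc E (insert g X) (insert e D)"

lemma tree_on_edges: "tree_on inc E X D \<Longrightarrow> D \<subseteq> E"
  by (induction rule: tree_on.induct) auto

lemma tree_on_inc: "tree_on inc E X D \<Longrightarrow> e \<in> D \<Longrightarrow> inc e \<subseteq> X"
  by (induction rule: tree_on.induct) auto

text \<open>\<open>conn\<close> is connectedness in terms of cuts, the form that closure arguments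
  on sets of faces deliver.\<close>

lemma spanning_tree_exists:
  assumes fin: "finite N" and ne: "N \<noteq> {}"
    and conn: "\<And>X. X \<subseteq> N \<Longrightarrow> X \<noteq> {} \<Longrightarrow> X \<noteq> N \<Longrightarrow> \<exists>e\<in>E. \<exists>f\<in>X. \<exists>g\<in>N - X. inc e = {f, g}"
  shows "\<exists>D. tree_on inc E N D"
proof -
  have "\<exists>X D. X \<subseteq> N \<and> card X = Suc k \<and> tree_on inc E X D" if "Suc k \<le> card N" for k
    using that
  proof (induction k)
    case 0
    obtain x where "x \<in> N" using ne by blast
    then show ?case by (intro exI[of _ "{x}"] exI[of _ "{}"]) (auto intro: tree_on.root)
  next
    case (Suc k)
    then obtain X D where X: "X \<subseteq> N" "card X = Suc k" "tree_on inc E X D" by auto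
    then have "X \<noteq> {}" "X \<noteq> N" using Suc.prems by auto
    then obtain e f g where e: "e \<in> E" "f \<in> X" "g \<in> N - X" "inc e = {f, g}"
      using conn[OF X(1)] by blast
    then have "tree_on inc E (insert g X) (insert e D)"
      using X(3) by (intro tree_on.grow) auto
    moreover have "card (insert g X) = Suc (Suc k)"
      using e X finite_subset[OF X(1) fin] by simp
    ultimately show ?case
      using X(1) e(3) by (intro exI[of _ "insert g X"] exI[of _ "insert e D"]) auto
  qed
  from this[of "card N - 1"] obtain X D where "X \<subseteq> N" "card X = card N" "tree_on inc E X D"
    using fin ne by (auto simp: card_gt_0_iff Suc_le_eq)
  then show ?thesis using card_subset_eq[OF fin] by auto
qed

lemma tree_on_connected:
  assumes "tree_on inc E X D" "\<And>e f g. e \<in> D \<Longrightarrow> inc e = {f, g} \<Longrightarrow> f \<in> Y \<Longrightarrow> g \<in> Y"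
    and "x \<in> X" "x \<in> Y"
  shows "X \<subseteq> Y"
proof -
  have "\<forall>x\<in>X. \<forall>y\<in>X. x \<in> Y \<longrightarrow> y \<in> Y"
    using assms(1,2)
  proof (induction rule: tree_on.induct)
    case (root x)
    then show ?case by auto
  next
    case (grow X D e f g)
    have IH: "\<forall>x\<in>X. \<forall>y\<in>X. x \<in> Y \<longrightarrow> y \<in> Y"
      by (rule grow.IH) (use grow.prems in blast)
    have "f \<in> Y \<longleftrightarrow> g \<in> Y"
      using grow.prems[of e f g] grow.prems[of e g f] grow.hyps by auto
    then show ?case using IH grow.hyps by auto
  qed
  then show ?thesis using assms(3,4) by blast
qed

text \<open>\<open>\<phi>\<close> is a flow modulo \<open>N\<close> that vanishes off a tree. At the
  last leaf \<open>g\<close> every other edge touching \<open>g\<close> lies off the tree, so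
  conservation at \<open>g\<close> forces \<open>\<phi> e0\<close> into \<open>N\<close>; then
  \<open>e0\<close> counts as off the tree and \<open>g\<close> is dropped.\<close>

lemma tree_on_peel:
  fixes \<phi> :: "'e \<Rightarrow> 'a::ab_group_add"
  assumes tree: "tree_on inc E X D" and fin: "finite E" and N: "add_subgroup N"
    and inc: "\<And>e. e \<in> E \<Longrightarrow> inc e = {a e, b e}"
    and flat: "\<And>r. r \<in> X \<Longrightarrow> (\<Sum>e | e \<in> E \<and> a e = r. \<phi> e) - (\<Sum>e | e \<in> E \<and> b e = r. \<phi> e) \<in> N"
    and off: "\<And>e. e \<in> E - D \<Longrightarrow> \<phi> e \<in> N"
    and e: "e \<in> E"
  shows "\<phi> e \<in> N"
  using tree flat off e
proof (induction arbitrary: e rule: tree_on.induct)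
  case (root x)
  then show ?case by simp
next
  case (grow X D e0 f g)
  have fg: "f \<noteq> g" using grow by auto
  have tch: "\<phi> e' \<in> N" if "e' \<in> E" "e' \<noteq> e0" "a e' = g \<or> b e' = g" for e'
  proof -
    have "e' \<notin> D"
      using tree_on_inc[OF grow(1), of e'] inc[OF that(1)] that(3) grow(5) by auto
    then show ?thesis using grow(8) that by auto
  qed
  have sum_ab: "(\<Sum>e | e \<in> E \<and> a e = g. \<phi> e) - (\<Sum>e | e \<in> E \<and> b e = g. \<phi> e) \<in> N"
    using grow(7) by simp
  have "{a e0, b e0} = {f, g}"
    using inc[of e0] grow by simp
  \<comment> \<open>As \<open>f \<noteq> g\<close>, the value \<open>\<phi> e0\<close> occurs in
    exactly one of the two sums at \<open>g\<close>.\<close>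
  then consider "a e0 = g" "b e0 = f" | "a e0 = f" "b e0 = g"
    by (auto simp: doubleton_eq_iff)
  then have e0: "\<phi> e0 \<in> N"
  proof cases
    case 1
    have s: "(\<Sum>e | e \<in> E \<and> a e = g. \<phi> e) = \<phi> e0 + (\<Sum>e \<in> {e \<in> E. a e = g} - {e0}. \<phi> e)"
      by (rule sum.remove) (use fin grow 1 in auto)
    have "(\<Sum>e \<in> {e \<in> E. a e = g} - {e0}. \<phi> e) \<in> N" "(\<Sum>e | e \<in> E \<and> b e = g. \<phi> e) \<in> N"
      by (rule add_subgroup_sum[OF N]; use tch 1 fg in auto)+
    from add_subgroup_add[OF N sum_ab add_subgroup_diff[OF N this(2,1)]]
    show ?thesis by (simp add: s)
  next
    case 2
    have s: "(\<Sum>e | e \<in> E \<and> b e = g. \<phi> e) = \<phi> e0 + (\<Sum>e \<in> {e \<in> E. b e = g} - {e0}. \<phi> e)"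
      by (rule sum.remove) (use fin grow 2 in auto)
    have "(\<Sum>e \<in> {e \<in> E. b e = g} - {e0}. \<phi> e) \<in> N" "(\<Sum>e | e \<in> E \<and> a e = g. \<phi> e) \<in> N"
      by (rule add_subgroup_sum[OF N]; use tch 2 fg in auto)+
    from add_subgroup_diff[OF N add_subgroup_diff[OF N this(2,1)] sum_ab]
    show ?thesis by (simp add: s)
  qed
  have "\<phi> e' \<in> N" if "e' \<in> E - D" for e'
    using e0 grow(8) that by (cases "e' = e0") auto
  then show ?case
    using grow.IH[of e] grow(7,9) by simp
qed

text \<open>The potential is fixed on the forest \<open>E - D\<close>. Its error is again a flow
  modulo \<open>N\<close>, because differences of a potential satisfy the conditions at
  \<open>X\<close> exactly, and it vanishes off the tree \<open>D\<close>; so it vanishes modulo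
  \<open>N\<close> everywhere.\<close>

theorem flat_imp_exact:
  fixes \<phi> :: "'e \<Rightarrow> 'a::ab_group_add" and s t :: "'e \<Rightarrow> 'v"
  assumes fin: "finite E"
    and bd: "\<And>e. e \<in> E \<Longrightarrow> bd e = {s e, t e}"
    and inc: "\<And>e. e \<in> E \<Longrightarrow> inc e = {a e, b e}"
    and tree: "tree_on inc E X D" and ac: "acyclic_edges bd (E - D)"
    and N: "add_subgroup N" and H: "add_subgroup H" "\<And>e. e \<in> E \<Longrightarrow> \<phi> e \<in> H"
    and flat: "\<And>r. r \<in> X \<Longrightarrow> (\<Sum>e | e \<in> E \<and> a e = r. \<phi> e) - (\<Sum>e | e \<in> E \<and> b e = r. \<phi> e) \<in> N"
    and exact_flat: "\<And>(p :: 'v \<Rightarrow> 'a) r. r \<in> X \<Longrightarrow>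
      (\<Sum>e | e \<in> E \<and> a e = r. p (t e) - p (s e)) = (\<Sum>e | e \<in> E \<and> b e = r. p (t e) - p (s e))"
  obtains p where "\<And>v. p v \<in> H" "\<And>e. e \<in> E \<Longrightarrow> p (t e) - p (s e) - \<phi> e \<in> N"
proof -
  have "\<exists>p. (\<forall>v. p v \<in> H) \<and> (\<forall>e\<in>E - D. p (t e) - p (s e) = \<phi> e)"
    by (rule forest_potential[OF _ ac]) (use fin bd H in auto)
  then obtain p where "\<forall>v. p v \<in> H" "\<forall>e\<in>E - D. p (t e) - p (s e) = \<phi> e" by blast
  then have p: "\<And>v. p v \<in> H" "\<And>e. e \<in> E - D \<Longrightarrow> p (t e) - p (s e) = \<phi> e" by blast+
  let ?\<psi> = "\<lambda>e. p (t e) - p (s e) - \<phi> e"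
  have "?\<psi> e \<in> N" if "e \<in> E" for e
  proof (rule tree_on_peel[where \<phi> = ?\<psi>, OF tree fin N inc _ _ that])
    fix r assume r: "r \<in> X"
    show "(\<Sum>e | e \<in> E \<and> a e = r. ?\<psi> e) - (\<Sum>e | e \<in> E \<and> b e = r. ?\<psi> e) \<in> N"
      using add_subgroup_minus[OF N flat[OF r]] exact_flat[OF r, of p]
      by (simp add: sum_subtractf)
  qed (use p N add_subgroup_0 in auto)
  then show ?thesis using that p by blast
qed

subsection \<open>Combinatorial triangulations and their 3-colourings\<close>

text \<open>The interface between topology and combinatorics. Faces and edges are abstract, since
  several may have the same vertices. Rotation around a vertex survives only as \<open>link\<close>:
  the triangles there are connected across edges at that vertex. \<open>jordan\<close> says that an
  edge set containing a cycle separates the faces.\<close>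

locale coloured_triangulation =
  fixes V :: "'v set" and E :: "'e set" and bd :: "'e \<Rightarrow> 'v set"
    and W B :: "'f set" and tv :: "'f \<Rightarrow> 'v set" and te :: "'f \<Rightarrow> 'e set"
  assumes finV: "finite V" and finE: "finite E" and finF: "finite (W \<union> B)"
    and WB: "W \<inter> B = {}" and ne: "W \<union> B \<noteq> {}"
    and bd: "e \<in> E \<Longrightarrow> card (bd e) = 2"
    and tri: "f \<in> W \<union> B \<Longrightarrow> tv f \<subseteq> V" "f \<in> W \<union> B \<Longrightarrow> card (tv f) = 3"
      "f \<in> W \<union> B \<Longrightarrow> te f \<subseteq> E"
      "f \<in> W \<union> B \<Longrightarrow> bij_betw bd (te f) {A. A \<subseteq> tv f \<and> card A = 2}"
    and own_ex1: "C \<in> {W, B} \<Longrightarrow> e \<in> E \<Longrightarrow> \<exists>!f. f \<in> C \<and> e \<in> te f"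
    and cover: "v \<in> V \<Longrightarrow> \<exists>f\<in>W \<union> B. v \<in> tv f"
    and link: "v \<in> V \<Longrightarrow> X \<subseteq> {f \<in> W \<union> B. v \<in> tv f} \<Longrightarrow> X \<noteq> {} \<Longrightarrow>
      (\<And>e f g. e \<in> E \<Longrightarrow> v \<in> bd e \<Longrightarrow> f \<in> X \<Longrightarrow> e \<in> te f \<Longrightarrow> g \<in> W \<union> B \<Longrightarrow> e \<in> te g \<Longrightarrow> g \<in> X) \<Longrightarrow>
      X = {f \<in> W \<union> B. v \<in> tv f}"
    and dual: "X \<subseteq> W \<union> B \<Longrightarrow> X \<noteq> {} \<Longrightarrow>
      (\<And>e f g. e \<in> E \<Longrightarrow> f \<in> X \<Longrightarrow> e \<in> te f \<Longrightarrow> g \<in> W \<union> B \<Longrightarrow> e \<in> te g \<Longrightarrow> g \<in> X) \<Longrightarrow>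
      X = W \<union> B"
    and jordan: "F \<subseteq> E \<Longrightarrow> \<not> acyclic_edges bd F \<Longrightarrow>
      \<exists>X \<subseteq> W \<union> B. X \<noteq> {} \<and> X \<noteq> W \<union> B \<and>
        (\<forall>e\<in>E - F. \<forall>f\<in>X. \<forall>g\<in>W \<union> B. e \<in> te f \<longrightarrow> e \<in> te g \<longrightarrow> g \<in> X)"
begin

definition own :: "'f set \<Rightarrow> 'e \<Rightarrow> 'f" where
  "own C e = (THE f. f \<in> C \<and> e \<in> te f)"

lemma own:
  assumes "C \<in> {W, B}" "e \<in> E"
  shows "own C e \<in> C" "own C e \<in> W \<union> B" "e \<in> te (own C e)" "f \<in> C \<Longrightarrow> e \<in> te f \<Longrightarrow> f = own C e"
proof -
  have *: "own C e \<in> C \<and> e \<in> te (own C e)"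
    unfolding own_def by (rule theI'[OF own_ex1[OF assms]])
  then show "own C e \<in> C" "own C e \<in> W \<union> B" "e \<in> te (own C e)"
    using assms by auto
  show "f = own C e" if "f \<in> C" "e \<in> te f"
    using own_ex1[OF assms] * that by blast
qed

definition inc :: "'e \<Rightarrow> 'f set" where
  "inc e = {own W e, own B e}"

lemma inc_eq:
  assumes "e \<in> E" "f \<in> W \<union> B" "g \<in> W \<union> B" "e \<in> te f" "e \<in> te g" "f \<noteq> g"
  shows "inc e = {f, g}"
proof -
  have "h = own W e \<or> h = own B e" if "h \<in> W \<union> B" "e \<in> te h" for h
    using that own(4)[of W e h] own(4)[of B e h] assms(1) by auto
  from this[OF assms(2,4)] this[OF assms(3,5)] assms(6) show ?thesis
    by (auto simp: inc_def)
qed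

lemma incD:
  assumes "e \<in> E" "f \<in> inc e"
  shows "f \<in> W \<union> B" "e \<in> te f"
  using assms own(2,3)[of W e] own(2,3)[of B e] by (auto simp: inc_def)

lemma bd_subset_tv: "f \<in> W \<union> B \<Longrightarrow> e \<in> te f \<Longrightarrow> bd e \<subseteq> tv f"
  using bij_betwE[OF tri(4)] by blast

lemma finite_tv: "f \<in> W \<union> B \<Longrightarrow> finite (tv f)"
  using tri(1) finV finite_subset by blast

lemma bd_in_V: "e \<in> E \<Longrightarrow> bd e \<subseteq> V"
  using own(2,3)[of W e] bd_subset_tv[of "own W e" e] tri(1)[of "own W e"] by blast

definition other :: "'v \<Rightarrow> 'e \<Rightarrow> 'v" where
  "other v e = the_elem (bd e - {v})"

lemma other_eq:
  assumes "bd e = {v, x}" "v \<noteq> x"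
  shows "other v e = x"
proof -
  have "bd e - {v} = {x}" using assms by auto
  then show ?thesis by (simp add: other_def)
qed

lemma bd_other:
  assumes "e \<in> E" "v \<in> bd e"
  shows "bd e = {v, other v e}" "other v e \<noteq> v"
proof -
  obtain y z where "bd e = {y, z}" "y \<noteq> z"
    using bd[OF assms(1)] by (auto simp: card_2_iff)
  then obtain x where "bd e = {v, x}" "v \<noteq> x"
    using assms(2) by (cases "v = y") (auto simp: insert_commute)
  then show "bd e = {v, other v e}" "other v e \<noteq> v"
    using other_eq by auto
qed

lemma bij_betw_other:
  assumes f: "f \<in> W \<union> B" and v: "v \<in> tv f"
  shows "bij_betw (other v) {e \<in> te f. v \<in> bd e} (tv f - {v})"
proof (rule bij_betw_imageI)
  have te: "e \<in> E" if "e \<in> te f" for e using tri(3)[OF f] that by blast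
  show "inj_on (other v) {e \<in> te f. v \<in> bd e}"
  proof (rule inj_onI)
    fix e e' assume e: "e \<in> {e \<in> te f. v \<in> bd e}" "e' \<in> {e \<in> te f. v \<in> bd e}" "other v e = other v e'"
    then have "bd e = bd e'"
      using bd_other(1)[OF te, of e v] bd_other(1)[OF te, of e' v] by auto
    then show "e = e'"
      using bij_betw_imp_inj_on[OF tri(4)[OF f]] e by (auto dest: inj_onD)
  qed
  show "other v ` {e \<in> te f. v \<in> bd e} = tv f - {v}"
  proof (intro equalityI subsetI)
    fix x assume "x \<in> other v ` {e \<in> te f. v \<in> bd e}"
    then obtain e where e: "e \<in> te f" "v \<in> bd e" "x = other v e" by blast
    then show "x \<in> tv f - {v}"
      using bd_other[OF te[OF e(1)] e(2)] bd_subset_tv[OF f e(1)] by auto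
  next
    fix x assume x: "x \<in> tv f - {v}"
    then have "{v, x} \<in> bd ` te f"
      using bij_betw_imp_surj_on[OF tri(4)[OF f]] v by auto
    then obtain e where "e \<in> te f" "bd e = {v, x}" by auto
    then show "x \<in> other v ` {e \<in> te f. v \<in> bd e}"
      using x by (auto simp: other_eq intro!: image_eqI[of _ _ e])
  qed
qed

text \<open>Double counting: a triangle of colour \<open>C\<close> at \<open>v\<close> has two edges
  at \<open>v\<close>, leading to its other two vertices, and each edge at \<open>v\<close> lies in
  one triangle of that colour. When \<open>h\<close> ignores the triangle and \<open>Y\<close> is
  everything, the right-hand side is the same for both colours.\<close>

lemma sum_around:
  fixes h :: "'f \<Rightarrow> 'v \<Rightarrow> 'a::comm_monoid_add"
  assumes C: "C \<in> {W, B}" and Y: "Y \<subseteq> {f \<in> C. v \<in> tv f}"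
  shows "(\<Sum>f\<in>Y. \<Sum>x\<in>tv f - {v}. h f x)
    = (\<Sum>e | e \<in> E \<and> v \<in> bd e \<and> own C e \<in> Y. h (own C e) (other v e))"
proof -
  let ?S = "{e. e \<in> E \<and> v \<in> bd e \<and> own C e \<in> Y}"
  have fY: "finite Y"
    using finF finite_subset[of Y "W \<union> B"] Y C by auto
  have "(\<Sum>f\<in>Y. \<Sum>x\<in>tv f - {v}. h f x) = (\<Sum>f\<in>Y. \<Sum>e | e \<in> ?S \<and> own C e = f. h (own C e) (other v e))"
  proof (rule sum.cong)
    fix f assume f: "f \<in> Y"
    then have f': "f \<in> W \<union> B" "v \<in> tv f" "f \<in> C" using Y C by auto
    have "{e. e \<in> ?S \<and> own C e = f} = {e \<in> te f. v \<in> bd e}"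
      using f f' own[OF C] tri(3)[OF f'(1)] by blast
    then have "(\<Sum>e | e \<in> ?S \<and> own C e = f. h (own C e) (other v e))
        = (\<Sum>e | e \<in> te f \<and> v \<in> bd e. h f (other v e))"
      using own(4)[OF C _ f'(3)] tri(3)[OF f'(1)] by (intro sum.cong) auto
    also have "\<dots> = (\<Sum>x\<in>tv f - {v}. h f x)"
      by (rule sum.reindex_bij_betw[OF bij_betw_other[OF f'(1,2)]])
    finally show "(\<Sum>x\<in>tv f - {v}. h f x) = (\<Sum>e | e \<in> ?S \<and> own C e = f. h (own C e) (other v e))"
      by simp
  qed simp
  also have "\<dots> = (\<Sum>e\<in>?S. h (own C e) (other v e))"
    by (rule sum.group) (use finE fY in auto)
  finally show ?thesis .
qed

lemma own_around:
  assumes "C \<in> {W, B}" "e \<in> E" "v \<in> bd e"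
  shows "own C e \<in> {f \<in> C. v \<in> tv f}"
  using own(1-3)[OF assms(1,2)] bd_subset_tv[of "own C e" e] assms(3) by auto

lemma card_edges_around:
  assumes C: "C \<in> {W, B}" and Y: "Y \<subseteq> {f \<in> C. v \<in> tv f}"
  shows "card {e \<in> E. v \<in> bd e \<and> own C e \<in> Y} = 2 * card Y"
proof -
  have "card (tv f - {v}) = 2" if "f \<in> Y" for f
    using that Y C tri(2)[of f] finite_tv[of f] by (subst card_Diff_singleton) auto
  then show ?thesis
    using sum_around[OF C Y, where h = "\<lambda>_ _. 1 :: nat"] by (simp add: mult.commute)
qed

section \<open>Three-colouring the vertices\<close>

definition proper3 :: "('v \<Rightarrow> nat) \<Rightarrow> 'f \<Rightarrow> bool" where
  "proper3 c f \<longleftrightarrow> inj_on c (tv f) \<and> c ` tv f \<subseteq> {..<3}"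

lemma proper3_image:
  assumes "f \<in> W \<union> B" "proper3 c f"
  shows "c ` tv f = {..<3}"
  using assms tri(2)[of f] unfolding proper3_def by (intro card_subset_eq) (auto simp: card_image)

text \<open>Each triangle of colour \<open>C\<close> at \<open>v\<close> has exactly one vertex
  coloured \<open>k\<close>, so an indicator function in \<open>sum_around\<close> counts triangles
  by edges. The colouring may still vary with the triangle.\<close>

lemma card_colour_around:
  assumes C: "C \<in> {W, B}" and k: "k < 3" "k \<noteq> c0"
    and c: "\<And>f. f \<in> C \<Longrightarrow> v \<in> tv f \<Longrightarrow> proper3 (c f) f \<and> c f v = c0"
  shows "card {e \<in> E. v \<in> bd e \<and> c (own C e) (other v e) = k} = card {f \<in> C. v \<in> tv f}"
proof -
  have 1: "(\<Sum>x\<in>tv f - {v}. if c f x = k then 1 else 0 :: nat) = 1" if f: "f \<in> C" "v \<in> tv f" for f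
  proof -
    have f': "f \<in> W \<union> B" using f C by auto
    have "k \<in> c f ` tv f"
      using proper3_image[OF f', of "c f"] c[OF f] k by auto
    then obtain x where x: "x \<in> tv f" "c f x = k" by blast
    then have "x \<noteq> v" using c[OF f] k by auto
    then have "{y \<in> tv f - {v}. c f y = k} = {x}"
      using x c[OF f] unfolding proper3_def by (auto dest: inj_onD)
    then show ?thesis
      using sum.inter_filter[of "tv f - {v}" "\<lambda>_. 1 :: nat" "\<lambda>x. c f x = k"] finite_tv[OF f'] by simp
  qed
  have "{e \<in> E. v \<in> bd e \<and> own C e \<in> {f \<in> C. v \<in> tv f}} = {e \<in> E. v \<in> bd e}"
    using own_around[OF C] by blast
  then have "card {f \<in> C. v \<in> tv f}
      = (\<Sum>e | e \<in> E \<and> v \<in> bd e. if c (own C e) (other v e) = k then 1 else 0 :: nat)"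
    using sum_around[OF C order_refl, where v = v and h = "\<lambda>f x. if c f x = k then 1 else 0 :: nat"] 1
    by simp
  also have "\<dots> = card {e \<in> E. v \<in> bd e \<and> c (own C e) (other v e) = k}"
    using sum.inter_filter[of "{e \<in> E. v \<in> bd e}" "\<lambda>_. 1 :: nat" "\<lambda>e. c (own C e) (other v e) = k"] finE
    by (simp add: conj_assoc)
  finally show ?thesis by simp
qed

text \<open>Every triangle carries its own colouring \<open>c f\<close>; this is the condition for
  the two colourings beside \<open>e\<close> to fit together along \<open>e\<close>.\<close>

definition agree :: "('f \<Rightarrow> 'v \<Rightarrow> nat) \<Rightarrow> 'e \<Rightarrow> bool" where
  "agree c e \<longleftrightarrow> (\<forall>v\<in>bd e. c (own W e) v = c (own B e) v)"

lemma agreeD: "agree c e \<Longrightarrow> v \<in> bd e \<Longrightarrow> c (own W e) v = c (own B e) v"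
  by (simp add: agree_def)

lemma agree_incD:
  assumes "agree c e" "f \<in> inc e" "g \<in> inc e" "v \<in> bd e"
  shows "c f v = c g v"
proof -
  have "c h v = c (own W e) v" if "h \<in> inc e" for h
  proof -
    have "h = own W e \<or> h = own B e" using that by (simp add: inc_def)
    then show ?thesis using agreeD[OF assms(1,4)] by (elim disjE) simp_all
  qed
  from this[OF assms(2)] this[OF assms(3)] show ?thesis by simp
qed

text \<open>A triangle attached to the tree shares an edge with its predecessor, which settles two
  of its colours; the third vertex takes the remaining one.\<close>

lemma colour_along_tree:
  assumes "tree_on inc E X D" "X \<subseteq> W \<union> B"
  shows "\<exists>c. (\<forall>f\<in>X. proper3 (c f) f) \<and> (\<forall>e\<in>D. agree c e)"
  using assms
proof (induction rule: tree_on.induct)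
  case (root f)
  then obtain h where "bij_betw h (tv f) {..<3::nat}"
    using finite_same_card_bij[of "tv f" "{..<3::nat}"] finite_tv[of f] tri(2)[of f] by auto
  then show ?case
    by (intro exI[of _ "\<lambda>_. h"]) (auto simp: proper3_def bij_betw_def)
next
  case (grow X D e f g)
  then obtain c where c: "\<forall>f\<in>X. proper3 (c f) f" "\<forall>e\<in>D. agree c e" by auto
  have f: "f \<in> W \<union> B" "e \<in> te f" and g: "g \<in> W \<union> B" "e \<in> te g"
    using incD[of e] grow by auto
  have bdf: "bd e \<subseteq> tv f" "bd e \<subseteq> tv g"
    using bd_subset_tv f g by auto
  have "card (c f ` bd e) \<le> 2"
    using bd[of e] grow(2) card_image_le[of "bd e" "c f"] finite_subset[OF bdf(1) finite_tv[OF f(1)]]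
    by auto
  then have "\<not> {..<3} \<subseteq> c f ` bd e"
    using card_mono[of "c f ` bd e" "{..<3}"] finite_subset[OF bdf(1) finite_tv[OF f(1)]] by auto
  then obtain k where k: "k < 3" "k \<notin> c f ` bd e" by auto
  define h where "h = (\<lambda>v. if v \<in> bd e then c f v else k)"
  have pf: "proper3 (c f) f" using c grow by auto
  have "card (tv g - bd e) = 1"
    using card_Diff_subset[OF _ bdf(2)] finite_subset[OF bdf(2) finite_tv[OF g(1)]]
      tri(2)[OF g(1)] bd[OF grow(2)] by simp
  then obtain z where z: "tv g - bd e = {z}" by (auto simp: card_1_singleton_iff)
  then have "tv g = insert z (bd e)" "z \<notin> bd e" using bdf by auto
  moreover have "inj_on (c f) (bd e)" "c f ` bd e \<subseteq> {..<3}"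
    using pf bdf(1) unfolding proper3_def by (auto intro: inj_on_subset)
  ultimately have hg: "proper3 h g"
    using k by (auto simp: proper3_def h_def inj_on_def)
  let ?c = "c(g := h)"
  have "agree ?c e"
  proof -
    have "f \<noteq> g" using grow(4,5) by blast
    then have "?c f' v = c f v" if "v \<in> bd e" "f' \<in> inc e" for v f'
      using that grow(3) by (auto simp: h_def)
    then show ?thesis unfolding agree_def inc_def by simp
  qed
  moreover have "agree ?c e'" if "e' \<in> D" for e'
  proof -
    have "own W e' \<noteq> g" "own B e' \<noteq> g"
      using tree_on_inc[OF grow(1) that] grow(5) by (auto simp: inc_def)
    then show ?thesis using c(2) that by (simp add: agree_def)
  qed
  moreover have "proper3 (?c f') f'" if "f' \<in> insert g X" for f'
    using that c(1) hg by (cases "f' = g") auto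
  ultimately have "(\<forall>f\<in>insert g X. proper3 (?c f) f) \<and> (\<forall>e\<in>insert e D. agree ?c e)"
    by blast
  then show ?case by (intro exI[of _ ?c])
qed

lemma acyclic_off_tree:
  assumes "tree_on inc E (W \<union> B) D"
  shows "acyclic_edges bd (E - D)"
proof (rule ccontr)
  assume "\<not> acyclic_edges bd (E - D)"
  from jordan[OF Diff_subset this]
  obtain X where X: "X \<subseteq> W \<union> B" "X \<noteq> {}" "X \<noteq> W \<union> B"
    and cl: "\<forall>e\<in>E - (E - D). \<forall>f\<in>X. \<forall>g\<in>W \<union> B. e \<in> te f \<longrightarrow> e \<in> te g \<longrightarrow> g \<in> X"
    by blast
  have DE: "D \<subseteq> E" by (rule tree_on_edges[OF assms])
  have cl': "g \<in> X" if "e \<in> D" "inc e = {f, g}" "f \<in> X" for e f g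
  proof -
    have "e \<in> E - (E - D)" "e \<in> te f" "e \<in> te g" "g \<in> W \<union> B"
      using that DE incD[of e] by auto
    then show ?thesis using cl that(3) by blast
  qed
  obtain x where "x \<in> X" using X by blast
  then have x: "x \<in> W \<union> B" "x \<in> X" using X(1) by auto
  have "W \<union> B \<subseteq> X"
    by (rule tree_on_connected[where x = x, OF assms]) (use cl' x in blast)+
  then show False using X by blast
qed

lemma agree_at_leaf:
  assumes c: "\<And>f. f \<in> W \<union> B \<Longrightarrow> proper3 (c f) f"
    and e: "e \<in> E" "v \<in> bd e" and others: "\<And>e'. e' \<in> E \<Longrightarrow> v \<in> bd e' \<Longrightarrow> e' \<noteq> e \<Longrightarrow> agree c e'"
  shows "agree c e"
proof -
  have WBs: "W \<in> {W, B}" "B \<in> {W, B}" by auto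
  have vV: "v \<in> V" using bd_in_V[OF e(1)] e(2) by blast
  define c0 where "c0 = c (own W e) v"
  define X where "X = {f \<in> W \<union> B. v \<in> tv f \<and> c f v = c0}"
  let ?Ev = "{e \<in> E. v \<in> bd e}"
  have fin: "finite {e' \<in> E. v \<in> bd e' \<and> P e'}" for P
    using finE by simp
  \<comment> \<open>Each triangle at \<open>v\<close> contributes two edges, so both edge sets \<open>?S W\<close> and \<open>?S B\<close> have even size;
    they agree off \<open>e\<close>, hence also at \<open>e\<close>.\<close>
  have same: "own W e' \<in> X \<longleftrightarrow> own B e' \<in> X" if e': "e' \<in> E" "v \<in> bd e'" for e'
  proof (cases "e' = e")
    case False
    then show ?thesis
      using agreeD[OF others[OF e'] e'(2)] own_around[OF WBs(1) e'] own_around[OF WBs(2) e']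
      by (auto simp: X_def)
  next
    case True
    let ?S = "\<lambda>C. {e' \<in> E. v \<in> bd e' \<and> own C e' \<in> X}"
    have ev: "even (card (?S C))" if C: "C \<in> {W, B}" for C
    proof -
      have "?S C = {e' \<in> E. v \<in> bd e' \<and> own C e' \<in> X \<inter> {f \<in> C. v \<in> tv f}}"
        using own_around[OF C] by auto
      then show ?thesis using card_edges_around[OF C, where Y = "X \<inter> {f \<in> C. v \<in> tv f}" and v = v] by simp
    qed
    have WX: "own W e \<in> X"
      using own_around[OF WBs(1) e] by (auto simp: X_def c0_def)
    have "own B e \<in> X"
    proof (rule ccontr)
      assume nB: "own B e \<notin> X"
      have "own W e' \<in> X \<longleftrightarrow> own B e' \<in> X" if "e' \<in> E" "v \<in> bd e'" "e' \<noteq> e" for e'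
        using agreeD[OF others[OF that] that(2)] own_around[OF WBs(1) that(1,2)]
          own_around[OF WBs(2) that(1,2)]
        by (auto simp: X_def)
      then have "?S W = insert e (?S B)" using WX nB e by blast
      then have "card (?S W) = Suc (card (?S B))" using nB fin by simp
      then show False using ev[OF WBs(1)] ev[OF WBs(2)] by simp
    qed
    then show ?thesis using WX True by simp
  qed
  \<comment> \<open>Colour \<open>c0\<close> at \<open>v\<close> passes across every edge at
    \<open>v\<close>, so connectivity of the link gives it to all triangles there.\<close>
  have "X = {f \<in> W \<union> B. v \<in> tv f}"
  proof (rule link[OF vV])
    show "X \<noteq> {}" using own_around[OF WBs(1) e] by (auto simp: X_def c0_def)
    fix e' f g assume "e' \<in> E" "v \<in> bd e'" "f \<in> X" "e' \<in> te f" "g \<in> W \<union> B" "e' \<in> te g"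
    then show "g \<in> X"
      using inc_eq[of e' f g] same[of e'] by (cases "f = g") (auto simp: X_def inc_def doubleton_eq_iff)
  qed (auto simp: X_def)
  then have c0: "c f v = c0" if "f \<in> W \<union> B" "v \<in> tv f" for f
    using that by (auto simp: X_def)
  \<comment> \<open>Now that \<open>v\<close> has one colour, the edges at \<open>v\<close> whose
    far end is coloured \<open>k\<close> by the white triangle number half the degree of
    \<open>v\<close>, and likewise for black. A disagreement at \<open>e\<close> alone would make
    the two numbers differ by one.\<close>
  define k where "k = c (own W e) (other v e)"
  have oW: "own W e \<in> W" "v \<in> tv (own W e)" "other v e \<in> tv (own W e)" "other v e \<noteq> v"
    using own_around[OF WBs(1) e] bd_subset_tv[OF own(2,3)[OF WBs(1) e(1)]] bd_other[OF e] by auto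
  then have k: "k < 3" "k \<noteq> c0"
    using c[of "own W e"] unfolding proper3_def k_def c0_def by (auto dest: inj_onD)
  let ?K = "\<lambda>C. {e' \<in> E. v \<in> bd e' \<and> c (own C e') (other v e') = k}"
  have K: "card (?K C) = card {f \<in> C. v \<in> tv f}" if "C \<in> {W, B}" for C
    by (rule card_colour_around[where c = c, OF that k]) (use c c0 that in auto)
  have half: "card ?Ev = 2 * card {f \<in> C. v \<in> tv f}" if C: "C \<in> {W, B}" for C
  proof -
    have "?Ev = {e' \<in> E. v \<in> bd e' \<and> own C e' \<in> {f \<in> C. v \<in> tv f}}"
      using own_around[OF C] by blast
    then show ?thesis using card_edges_around[OF C order_refl, where v = v] by simp
  qed
  have KK: "card (?K W) = card (?K B)"
    using K[OF WBs(1)] K[OF WBs(2)] half[OF WBs(1)] half[OF WBs(2)] by simp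
  have "c (own B e) (other v e) = k"
  proof (rule ccontr)
    assume nk: "c (own B e) (other v e) \<noteq> k"
    have "c (own W e') (other v e') = k \<longleftrightarrow> e' = e \<or> c (own B e') (other v e') = k"
      if e': "e' \<in> E" "v \<in> bd e'" for e'
    proof (cases "e' = e")
      case False
      have "other v e' \<in> bd e'" using bd_other(1)[OF e'] by blast
      then show ?thesis using agreeD[OF others[OF e' False]] False by simp
    qed (simp add: k_def)
    then have "?K W = insert e (?K B)" using e by blast
    then have "card (?K W) = Suc (card (?K B))" using nk fin by simp
    then show False using KK by simp
  qed
  moreover have "c (own W e) v = c (own B e) v"
    using c0[of "own W e"] c0[of "own B e"] own_around[OF WBs(1) e] own_around[OF WBs(2) e] by auto
  ultimately show ?thesis
    unfolding agree_def using bd_other(1)[OF e] k_def by auto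
qed

theorem three_colourable: "\<exists>c. \<forall>f\<in>W \<union> B. proper3 c f"
proof -
  have "\<exists>D. tree_on inc E (W \<union> B) D"
  proof (rule spanning_tree_exists[OF finF ne])
    fix X assume X: "X \<subseteq> W \<union> B" "X \<noteq> {}" "X \<noteq> W \<union> B"
    show "\<exists>e\<in>E. \<exists>f\<in>X. \<exists>g\<in>W \<union> B - X. inc e = {f, g}"
    proof (rule ccontr)
      assume no: "\<not> ?thesis"
      have "X = W \<union> B"
      proof (rule dual[OF X(1,2)])
        fix e f g assume a: "e \<in> E" "f \<in> X" "e \<in> te f" "g \<in> W \<union> B" "e \<in> te g"
        show "g \<in> X"
        proof (rule ccontr)
          assume "g \<notin> X"
          then have "inc e = {f, g}"
            using a X(1) by (intro inc_eq) auto
          then show False using no a \<open>g \<notin> X\<close> by blast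
        qed
      qed
      then show False using X by simp
    qed
  qed
  then obtain D where D: "tree_on inc E (W \<union> B) D" by blast
  obtain c where c: "\<And>f. f \<in> W \<union> B \<Longrightarrow> proper3 (c f) f" and cD: "\<And>e. e \<in> D \<Longrightarrow> agree c e"
    using colour_along_tree[OF D order_refl] by blast
  let ?bad = "{e \<in> E. \<not> agree c e}"
  have "?bad = {}"
  proof (rule ccontr)
    assume ne: "?bad \<noteq> {}"
    have "acyclic_edges bd ?bad"
      by (rule acyclic_edges_subset[OF acyclic_off_tree[OF D]]) (use cD in auto)
    then have "\<exists>e\<in>?bad. \<exists>v\<in>bd e. \<forall>f\<in>?bad. v \<in> bd f \<longrightarrow> f = e"
      by (intro acyclic_edges_leaf ne) (use finE bd in auto)
    then obtain e v where e: "e \<in> E" "\<not> agree c e" "v \<in> bd e" and v: "\<forall>f\<in>?bad. v \<in> bd f \<longrightarrow> f = e"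
      by blast
    have "agree c e"
      by (rule agree_at_leaf[where c = c, OF c e(1,3)]) (use v in blast)+
    then show False using e(2) by simp
  qed
  then have ag: "agree c e" if "e \<in> E" for e using that by blast
  \<comment> \<open>The triangles around \<open>v\<close> are connected across edges along which the
    colourings agree, so the local colourings glue to one on \<open>V\<close>.\<close>
  have const: "c f v = c g v" if f: "f \<in> W \<union> B" "v \<in> tv f" and g: "g \<in> W \<union> B" "v \<in> tv g" for f g v
  proof -
    have vV: "v \<in> V" using tri(1) f by blast
    let ?X = "{h \<in> W \<union> B. v \<in> tv h \<and> c h v = c f v}"
    have "?X = {h \<in> W \<union> B. v \<in> tv h}"
    proof (rule link[OF vV])
      fix e h h' assume a: "e \<in> E" "v \<in> bd e" "h \<in> ?X" "e \<in> te h" "h' \<in> W \<union> B" "e \<in> te h'"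
      show "h' \<in> ?X"
      proof (cases "h' = h")
        case False
        then have "inc e = {h, h'}" using a by (intro inc_eq) auto
        then have "c h v = c h' v"
          by (intro agree_incD[OF ag[OF a(1)] _ _ a(2)]) auto
        then show ?thesis using a bd_subset_tv[OF a(5,6)] by auto
      qed (use a in simp)
    qed (use f in auto)
    then have "g \<in> ?X" using g by blast
    then show ?thesis by simp
  qed
  define c' where "c' v = c (SOME f. f \<in> W \<union> B \<and> v \<in> tv f) v" for v
  have c': "c' v = c f v" if "f \<in> W \<union> B" "v \<in> tv f" for f v
    unfolding c'_def using const[of _ v f] someI[of "\<lambda>f. f \<in> W \<union> B \<and> v \<in> tv f"] that by blast
  have "proper3 c' f" if f: "f \<in> W \<union> B" for f
    using c[OF f] c'[OF f] unfolding proper3_def by (simp add: inj_on_def image_subset_iff)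
  then show ?thesis by blast
qed

end

subsection \<open>Eliminating two colour classes\<close>

lemma sum_constant_frag: "(\<Sum>e\<in>A. x) = frag_cmul (int (card A)) x"
  by (induction A rule: infinite_finite_induct) (simp_all add: frag_cmul_distrib)

text \<open>
  An edge \<open>e\<close> of this locale stands for an edge avoiding the colour class \<open>R\<close>; \<open>a e\<close> and \<open>b e\<close>
  are the vertices opposite to it in its white and in its black triangle.
\<close>

locale trinity =
  fixes V R :: "'v set" and E :: "'e set" and s t a b :: "'e \<Rightarrow> 'v"
  assumes finV: "finite V" and finE: "finite E" and RV: "R \<subseteq> V" and neE: "E \<noteq> {}"
    and ab: "e \<in> E \<Longrightarrow> a e \<in> R" "e \<in> E \<Longrightarrow> b e \<in> R"
    and st: "e \<in> E \<Longrightarrow> s e \<in> V - R" "e \<in> E \<Longrightarrow> t e \<in> V - R" "s ` E \<inter> t ` E = {}"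
    and conn: "(\<And>e. e \<in> E \<Longrightarrow> s e \<in> Y \<longleftrightarrow> t e \<in> Y) \<Longrightarrow> v \<in> V - R \<Longrightarrow> v \<in> Y \<Longrightarrow> V - R \<subseteq> Y"
    and card_ab: "r \<in> R \<Longrightarrow> card {e \<in> E. a e = r} = card {e \<in> E. b e = r}"
    and balance: "r \<in> R \<Longrightarrow> (\<Sum>e | e \<in> E \<and> a e = r. frag_of (s e) + frag_of (t e))
      = (\<Sum>e | e \<in> E \<and> b e = r. frag_of (s e) + frag_of (t e))"
    and exact: "add_subgroup N \<Longrightarrow> add_subgroup H \<Longrightarrow> (\<And>e. e \<in> E \<Longrightarrow> \<phi> e \<in> H) \<Longrightarrow>
      (\<And>r. r \<in> R \<Longrightarrow> (\<Sum>e | e \<in> E \<and> a e = r. \<phi> e) - (\<Sum>e | e \<in> E \<and> b e = r. \<phi> e) \<in> N) \<Longrightarrow>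
      \<exists>p :: 'v \<Rightarrow> ('v \<Rightarrow>\<^sub>0 int). (\<forall>v. p v \<in> H) \<and> (\<forall>e\<in>E. p (t e) - p (s e) - \<phi> e \<in> N)"
begin

definition rel :: "'e \<Rightarrow> ('v \<Rightarrow>\<^sub>0 int)" where
  "rel e = frag_of (a e) + frag_of (s e) + frag_of (t e)"

text \<open>Adjacency minus degree for arcs from \<open>b e\<close> to \<open>a e\<close>. Row and
  column vanish at an index outside \<open>R\<close>, which is how \<open>s e0\<close> will
  contribute the free summand.\<close>

definition laplacian :: "'v \<Rightarrow> 'v \<Rightarrow> int" where
  "laplacian r r' = int (card {e \<in> E. b e = r \<and> a e = r'})
    - (if r = r' then int (card {e \<in> E. b e = r}) else 0)"

lemma row_relator_laplacian:
  assumes I: "finite I" "R \<subseteq> I"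
  shows "row_relator I laplacian r = (\<Sum>e | e \<in> E \<and> b e = r. frag_of (a e) - frag_of r)"
proof -
  let ?D = "{e \<in> E. b e = r}"
  have fD: "finite ?D" using finE by simp
  have aD: "a ` ?D \<subseteq> I" using ab I(2) by blast
  have "(\<Sum>e\<in>?D. frag_of (a e)) = (\<Sum>j\<in>I. \<Sum>e | e \<in> ?D \<and> a e = j. frag_of (a e))"
    by (rule sum.group[symmetric, OF fD I(1) aD])
  also have "\<dots> = (\<Sum>j\<in>I. frag_cmul (int (card {e \<in> E. b e = r \<and> a e = j})) (frag_of j))"
  proof (rule sum.cong)
    fix j
    have "(\<Sum>e | e \<in> ?D \<and> a e = j. frag_of (a e)) = (\<Sum>e | e \<in> ?D \<and> a e = j. frag_of j)"
      by (rule sum.cong) auto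
    also have "\<dots> = frag_cmul (int (card {e \<in> E. b e = r \<and> a e = j})) (frag_of j)"
      by (simp add: sum_constant_frag conj_assoc)
    finally show "(\<Sum>e | e \<in> ?D \<and> a e = j. frag_of (a e)) = \<dots>" .
  qed simp
  finally have 1: "(\<Sum>e\<in>?D. frag_of (a e)) = \<dots>" .
  have 2: "(\<Sum>e\<in>?D. frag_of r) = (\<Sum>j\<in>I. frag_cmul (if r = j then int (card ?D) else 0) (frag_of j))"
  proof (cases "r \<in> I")
    case True
    have "(\<Sum>j\<in>I. frag_cmul (if r = j then int (card ?D) else 0) (frag_of j))
        = (\<Sum>j\<in>I. if r = j then frag_cmul (int (card ?D)) (frag_of r) else 0)"
      by (rule sum.cong) auto
    then show ?thesis using True I(1) by (simp add: sum_constant_frag)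
  next
    case False
    then have "?D = {}" using ab I(2) by blast
    moreover have "(\<Sum>j\<in>I. frag_cmul (if r = j then int (card ?D) else 0) (frag_of j)) = 0"
      using False by (intro sum.neutral) auto
    ultimately show ?thesis by (simp only: sum.empty)
  qed
  show ?thesis
    unfolding row_relator_def laplacian_def
    by (simp add: frag_cmul_diff_distrib sum_subtractf 1 2)
qed

lemma rel_frags: "e \<in> E \<Longrightarrow> rel e \<in> frags V"
  unfolding rel_def using ab st RV
  by (intro add_subgroup_add[OF add_subgroup_frags]) auto

text \<open>By \<open>balance\<close> the ends of the edges cancel, and \<open>card_ab\<close>
  matches the copies of \<open>r\<close>. What is left is a Laplacian row: a consequence of the
  relations that involves \<open>R\<close> alone.\<close>

lemma sum_rel:
  assumes "r \<in> R"
  shows "(\<Sum>e | e \<in> E \<and> b e = r. rel e) - (\<Sum>e | e \<in> E \<and> a e = r. rel e)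
    = (\<Sum>e | e \<in> E \<and> b e = r. frag_of (a e) - frag_of r)"
proof -
  have A: "(\<Sum>e | e \<in> E \<and> a e = r. rel e)
      = (\<Sum>e | e \<in> E \<and> a e = r. frag_of r) + (\<Sum>e | e \<in> E \<and> a e = r. frag_of (s e) + frag_of (t e))"
    by (simp add: rel_def sum.distrib[symmetric] add.assoc)
  have B: "(\<Sum>e | e \<in> E \<and> b e = r. rel e)
      = (\<Sum>e | e \<in> E \<and> b e = r. frag_of (a e)) + (\<Sum>e | e \<in> E \<and> b e = r. frag_of (s e) + frag_of (t e))"
    by (simp add: rel_def sum.distrib[symmetric] add.assoc)
  have "(\<Sum>e | e \<in> E \<and> a e = r. frag_of r) = (\<Sum>e | e \<in> E \<and> b e = r. frag_of r)"
    using card_ab[OF assms] by (simp add: sum_constant_frag)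
  then show ?thesis
    unfolding A B balance[OF assms] by (simp add: sum_subtractf)
qed

text \<open>In one direction the map is the inclusion of \<open>R\<close> and the base vertex
  \<open>s e0\<close> into \<open>V\<close>; in the other, every vertex outside \<open>R\<close> is
  expressed by these through a potential.\<close>

theorem presentation_iso_coker:
  assumes e0: "e0 \<in> E"
  shows "abelian_presentation V (rel ` E) \<cong> coker (insert (s e0) R) laplacian"
proof -
  let ?I = "insert (s e0) R"
  let ?R' = "row_relator ?I laplacian ` ?I"
  let ?N = "relators V (rel ` E)" and ?M = "relators ?I ?R'"
  have finI: "finite ?I" using finV RV finite_subset by auto
  have IV: "?I \<subseteq> V" using RV st e0 by auto
  have relV: "rel ` E \<subseteq> frags V" using rel_frags by blast
  have R'I: "?R' \<subseteq> frags ?I" by (rule row_relators_frags)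
  have N: "add_subgroup ?N" by (rule add_subgroup_relators[OF relV])
  have M: "add_subgroup ?M" by (rule add_subgroup_relators[OF R'I])
  have row: "row_relator ?I laplacian r = (\<Sum>e | e \<in> E \<and> b e = r. frag_of (a e) - frag_of r)" for r
    by (rule row_relator_laplacian[OF finI]) auto
  \<comment> \<open>The values that the relations prescribe. Their vertex condition at
    \<open>r\<close> is exactly the Laplacian row of \<open>r\<close>, hence holds modulo
    \<open>?M\<close>.\<close>
  let ?\<phi> = "\<lambda>e. - frag_of (a e) :: 'v \<Rightarrow>\<^sub>0 int"
  have "\<exists>p. (\<forall>v. p v \<in> frags ?I) \<and> (\<forall>e\<in>E. p (t e) - p (s e) - ?\<phi> e \<in> ?M)"
  proof (rule exact[OF M add_subgroup_frags])
    fix e assume "e \<in> E"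
    then show "?\<phi> e \<in> frags ?I" using ab by simp
  next
    fix r assume r: "r \<in> R"
    have "(\<Sum>e | e \<in> E \<and> a e = r. ?\<phi> e) = - (\<Sum>e | e \<in> E \<and> a e = r. frag_of r)"
      by (simp add: sum_negf)
    also have "(\<Sum>e | e \<in> E \<and> a e = r. frag_of r) = (\<Sum>e | e \<in> E \<and> b e = r. frag_of r)"
      using card_ab[OF r] by (simp add: sum_constant_frag)
    finally have "(\<Sum>e | e \<in> E \<and> a e = r. ?\<phi> e) - (\<Sum>e | e \<in> E \<and> b e = r. ?\<phi> e)
        = row_relator ?I laplacian r"
      unfolding row by (simp add: sum_subtractf sum_negf)
    then show "(\<Sum>e | e \<in> E \<and> a e = r. ?\<phi> e) - (\<Sum>e | e \<in> E \<and> b e = r. ?\<phi> e) \<in> ?M"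
      using r by (auto intro: relators_incl)
  qed
  then obtain p where p1: "\<forall>v. p v \<in> frags ?I"
    and p2: "\<forall>e\<in>E. p (t e) - p (s e) - ?\<phi> e \<in> ?M"
    by blast
  \<comment> \<open>\<open>p\<close> solves for differences. Negating it on the sources turns these
    into the sums in the relations; the constant shift is chosen so that \<open>\<alpha>\<close>
    fixes \<open>s e0\<close>.\<close>
  define q where "q v = p v - p (s e0) - frag_of (s e0)" for v
  define \<alpha> where "\<alpha> v = (if v \<in> R then frag_of v else if v \<in> s ` E then - q v else q v)" for v
  have q: "q v \<in> frags ?I" for v
    unfolding q_def using p1
    by (intro add_subgroup_diff[OF add_subgroup_frags]) auto
  have \<alpha>I: "\<alpha> v \<in> frags ?I" for v
    using add_subgroup_minus[OF add_subgroup_frags q[of v]] q[of v] by (auto simp: \<alpha>_def)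
  have \<alpha>_ab: "\<alpha> (a e) = frag_of (a e)" if "e \<in> E" for e
    using ab that by (simp add: \<alpha>_def)
  have \<alpha>_st: "\<alpha> (s e) = - q (s e)" "\<alpha> (t e) = q (t e)" if "e \<in> E" for e
    using st that by (auto simp: \<alpha>_def)
  have \<alpha>rel: "frag_of (a e) + \<alpha> (s e) + \<alpha> (t e) \<in> ?M" if "e \<in> E" for e
  proof -
    have "frag_of (a e) + \<alpha> (s e) + \<alpha> (t e) = p (t e) - p (s e) - ?\<phi> e"
      by (simp add: \<alpha>_st[OF that] q_def)
    moreover have "p (t e) - p (s e) - ?\<phi> e \<in> ?M" using p2 that by blast
    ultimately show ?thesis by (simp only:)
  qed
  have \<alpha>s: "\<alpha> (s e0) = frag_of (s e0)"
    using \<alpha>_st(1)[OF e0] by (simp add: q_def)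
  have row_N: "row_relator ?I laplacian r \<in> ?N" if "r \<in> ?I" for r
  proof (cases "r \<in> R")
    case True
    have "(\<Sum>e | e \<in> E \<and> b e = r. rel e) - (\<Sum>e | e \<in> E \<and> a e = r. rel e) \<in> ?N"
      by (intro add_subgroup_diff[OF N] add_subgroup_sum[OF N] relators_incl) auto
    then show ?thesis by (simp only: row sum_rel[OF True])
  next
    case False
    then have "{e \<in> E. b e = r} = {}" using ab by blast
    then show ?thesis using add_subgroup_0[OF N] by (simp only: row sum.empty)
  qed
  have MN: "x \<in> ?N" if "x \<in> ?M" for x
    using frag_extend_relators[OF R'I N _ that, of frag_of] row_N
    by (auto simp flip: frag_expansion)
  show ?thesis
    unfolding coker_def
  proof (rule abelian_presentation_iso[OF relV R'I, of \<alpha> frag_of])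
    show "\<alpha> v \<in> frags ?I" for v by (rule \<alpha>I)
    show "frag_of w \<in> frags V" if "w \<in> ?I" for w
      using that IV by auto
    show "frag_extend \<alpha> x \<in> ?M" if "x \<in> rel ` E" for x
      using that \<alpha>rel \<alpha>_ab by (auto simp: rel_def frag_extend_add)
    show "frag_extend frag_of x \<in> ?N" if "x \<in> ?R'" for x
      using that row_N by (auto simp flip: frag_expansion)
    show "frag_extend \<alpha> (frag_of w) - frag_of w \<in> ?M" if "w \<in> ?I" for w
      using that \<alpha>s add_subgroup_0[OF M] by (auto simp: \<alpha>_def)
    show "frag_extend frag_of (\<alpha> v) - frag_of v \<in> ?N" if v: "v \<in> V" for v
    proof -
      let ?Y = "{v. \<alpha> v - frag_of v \<in> ?N}"
      \<comment> \<open>Modulo \<open>?N\<close> the errors of \<open>\<alpha>\<close> at the two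
        ends of \<open>e\<close> are opposite, so correctness spreads from \<open>s e0\<close> by
        \<open>conn\<close>.\<close>
      have "s e \<in> ?Y \<longleftrightarrow> t e \<in> ?Y" if e: "e \<in> E" for e
      proof -
        let ?x = "\<alpha> (s e) - frag_of (s e)" and ?y = "\<alpha> (t e) - frag_of (t e)"
        have "(frag_of (a e) + \<alpha> (s e) + \<alpha> (t e)) - rel e \<in> ?N"
          by (rule add_subgroup_diff[OF N MN[OF \<alpha>rel[OF e]] relators_incl]) (use e in blast)
        moreover have "(frag_of (a e) + \<alpha> (s e) + \<alpha> (t e)) - rel e = ?x + ?y"
          by (simp add: rel_def)
        ultimately have xy: "?x + ?y \<in> ?N" by simp
        show ?thesis
          using add_subgroup_diff[OF N xy, of ?x] add_subgroup_diff[OF N xy, of ?y] by auto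
      qed
      then have "V - R \<subseteq> ?Y"
        by (rule conn[of _ "s e0"]) (use st e0 \<alpha>s add_subgroup_0[OF N] in auto)
      moreover have "R \<subseteq> ?Y"
        using add_subgroup_0[OF N] by (auto simp: \<alpha>_def)
      ultimately have "\<alpha> v - frag_of v \<in> ?N" using v by blast
      then show ?thesis by (simp flip: frag_expansion)
    qed
  qed
qed

text \<open>In-degree equals out-degree, so transposition keeps the diagonal and amounts to
  exchanging \<open>a\<close> and \<open>b\<close>.\<close>

lemma transp_laplacian:
  "transp laplacian r r' = int (card {e \<in> E. a e = r \<and> b e = r'})
    - (if r = r' then int (card {e \<in> E. a e = r}) else 0)"
proof -
  have "card {e \<in> E. a e = r} = card {e \<in> E. b e = r}" for r
  proof (cases "r \<in> R")
    case False
    then have "{e \<in> E. a e = r} = {}" "{e \<in> E. b e = r} = {}" using ab by blast+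
    then show ?thesis by (simp only:)
  qed (rule card_ab)
  moreover have "{e \<in> E. b e = r' \<and> a e = r} = {e \<in> E. a e = r \<and> b e = r'}" by blast
  ultimately show ?thesis by (simp add: laplacian_def)
qed

end

lemma trinity_swap:
  assumes "trinity V R E s t a b"
  shows "trinity V R E s t b a"
proof -
  interpret trinity V R E s t a b by (rule assms)
  show ?thesis
  proof
    fix N H :: "('a \<Rightarrow>\<^sub>0 int) set" and \<phi>
    assume N: "add_subgroup N" and H: "add_subgroup H" "\<And>e. e \<in> E \<Longrightarrow> \<phi> e \<in> H"
      and flat: "\<And>r. r \<in> R \<Longrightarrow> (\<Sum>e | e \<in> E \<and> b e = r. \<phi> e) - (\<Sum>e | e \<in> E \<and> a e = r. \<phi> e) \<in> N"
    show "\<exists>p :: 'a \<Rightarrow> ('a \<Rightarrow>\<^sub>0 int). (\<forall>v. p v \<in> H) \<and> (\<forall>e\<in>E. p (t e) - p (s e) - \<phi> e \<in> N)"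
      by (rule exact[OF N H]) (use add_subgroup_minus[OF N flat] in simp_all)
  qed (use finV finE RV neE ab st conn card_ab balance in \<open>simp_all\<close>)
qed

theorem trinity_iso:
  assumes "trinity V R E s t a b"
  shows "abelian_presentation V ((\<lambda>e. frag_of (a e) + frag_of (s e) + frag_of (t e)) ` E)
    \<cong> abelian_presentation V ((\<lambda>e. frag_of (b e) + frag_of (s e) + frag_of (t e)) ` E)"
    (is "?A \<cong> ?B")
proof -
  interpret A: trinity V R E s t a b by (rule assms)
  interpret B: trinity V R E s t b a by (rule trinity_swap[OF assms])
  obtain e0 where e0: "e0 \<in> E" using A.neE by blast
  \<comment> \<open>Neither \<open>R\<close> nor \<open>s\<close> depends on the colour, so both
    cokernels have the same index set.\<close>
  let ?I = "insert (s e0) R"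
  have "finite ?I" using A.finV A.RV finite_subset by auto
  then have "coker ?I A.laplacian \<cong> coker ?I (transp A.laplacian)" by (rule coker_transp)
  moreover have "transp A.laplacian = B.laplacian"
    by (intro ext) (simp only: A.transp_laplacian B.laplacian_def)
  ultimately have "coker ?I A.laplacian \<cong> coker ?I B.laplacian" by simp
  moreover have "?A \<cong> coker ?I A.laplacian"
    using A.presentation_iso_coker[OF e0] by (simp add: A.rel_def[abs_def])
  moreover have "?B \<cong> coker ?I B.laplacian"
    using B.presentation_iso_coker[OF e0] by (simp add: B.rel_def[abs_def])
  then have "coker ?I B.laplacian \<cong> ?B"
  proof (rule abelian_presentation_sym[rotated])
    show "(\<lambda>e. frag_of (b e) + frag_of (s e) + frag_of (t e)) ` E \<subseteq> frags V"
      using B.rel_frags by (auto simp: B.rel_def image_subset_iff)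
  qed
  ultimately show ?thesis by (blast intro: iso_trans)
qed

section \<open>The edges between two colour classes\<close>

locale three_coloured_triangulation = coloured_triangulation +
  fixes c :: "'a \<Rightarrow> nat"
  assumes proper: "f \<in> W \<union> B \<Longrightarrow> proper3 c f"
begin

definition vx :: "nat \<Rightarrow> 'c \<Rightarrow> 'a" where
  "vx k f = (THE v. v \<in> tv f \<and> c v = k)"

lemma vx:
  assumes f: "f \<in> W \<union> B" and k: "k < 3"
  shows "vx k f \<in> tv f" "c (vx k f) = k"
proof -
  have "\<exists>!v. v \<in> tv f \<and> c v = k"
    using proper[OF f] proper3_image[OF f proper[OF f]] k
    unfolding proper3_def inj_on_def by (metis imageE lessThan_iff)
  from theI'[OF this] show "vx k f \<in> tv f" "c (vx k f) = k"
    by (simp_all add: vx_def)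
qed

lemma vx_eqI:
  assumes f: "f \<in> W \<union> B" and v: "v \<in> tv f" "c v = k"
  shows "v = vx k f"
proof -
  have "k < 3" using proper[OF f] v by (auto simp: proper3_def)
  then show ?thesis
    using inj_onD[of c "tv f" v "vx k f"] vx[OF f, of k] proper[OF f] v unfolding proper3_def by simp
qed

lemma tv_eq:
  assumes f: "f \<in> W \<union> B"
  shows "tv f = {vx 0 f, vx 1 f, vx 2 f}"
proof (intro equalityI subsetI)
  fix v assume v: "v \<in> tv f"
  then have "c v < 3" using proper[OF f] by (auto simp: proper3_def)
  then have "c v = 0 \<or> c v = 1 \<or> c v = 2" by linarith
  then show "v \<in> {vx 0 f, vx 1 f, vx 2 f}"
    using vx_eqI[OF f v] by blast
next
  fix v assume "v \<in> {vx 0 f, vx 1 f, vx 2 f}"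
  then show "v \<in> tv f"
    using vx(1)[OF f, of 0] vx(1)[OF f, of 1] vx(1)[OF f, of 2] by auto
qed

lemma vx_neq: "f \<in> W \<union> B \<Longrightarrow> i < 3 \<Longrightarrow> j < 3 \<Longrightarrow> i \<noteq> j \<Longrightarrow> vx i f \<noteq> vx j f"
  using vx(2)[of f i] vx(2)[of f j] by metis

definition E0 :: "'b set" where
  "E0 = {e \<in> E. 0 \<notin> c ` bd e}"

definition R :: "'a set" where
  "R = {v \<in> V. c v = 0}"

text \<open>The ends are read off the white triangle; by \<open>E0_ends\<close> the black one gives
  the same.\<close>

definition src :: "'b \<Rightarrow> 'a" where "src e = vx 1 (own W e)"
definition tgt :: "'b \<Rightarrow> 'a" where "tgt e = vx 2 (own W e)"
definition apex :: "'c set \<Rightarrow> 'b \<Rightarrow> 'a" where "apex C e = vx 0 (own C e)"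

lemma bd_E0:
  assumes e: "e \<in> E0" "f \<in> W \<union> B" "e \<in> te f"
  shows "bd e = {vx 1 f, vx 2 f}"
proof -
  have "vx 0 f \<notin> bd e"
    using e(1) vx(2)[OF e(2), of 0] unfolding E0_def by (auto simp: image_iff)
  then have "bd e \<subseteq> {vx 1 f, vx 2 f}"
    using bd_subset_tv[OF e(2,3)] tv_eq[OF e(2)] by auto
  moreover have "card (bd e) = card {vx 1 f, vx 2 f}"
    using bd[of e] e(1) vx_neq[OF e(2), of 1 2] by (simp add: E0_def)
  ultimately show ?thesis by (intro card_subset_eq) auto
qed

lemma E0_of_face:
  assumes C: "C \<in> {W, B}" and f: "f \<in> C"
  shows "\<exists>e\<in>E0. own C e = f"
proof -
  have f': "f \<in> W \<union> B" using C f by auto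
  have "{vx 1 f, vx 2 f} \<subseteq> tv f" "card {vx 1 f, vx 2 f} = 2"
    using vx(1)[OF f'] vx_neq[OF f', of 1 2] by auto
  then have "{vx 1 f, vx 2 f} \<in> bd ` te f"
    using bij_betw_imp_surj_on[OF tri(4)[OF f']] by blast
  then obtain e where e: "e \<in> te f" "bd e = {vx 1 f, vx 2 f}" by auto
  then have eE: "e \<in> E" using tri(3)[OF f'] by blast
  have "e \<in> E0"
    unfolding E0_def using eE e(2) vx(2)[OF f', of 1] vx(2)[OF f', of 2] by auto
  moreover have "own C e = f" using own(4)[OF C eE f e(1)] by simp
  ultimately show ?thesis by blast
qed

lemma E0_E: "e \<in> E0 \<Longrightarrow> e \<in> E"
  by (simp add: E0_def)

lemma E0_ends:
  assumes C: "C \<in> {W, B}" and e: "e \<in> E0"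
  shows "vx 1 (own C e) = src e" "vx 2 (own C e) = tgt e"
proof -
  have W: "W \<in> {W, B}" by simp
  note oC = own(2,3)[OF C E0_E[OF e]]
  have "bd e = {src e, tgt e}"
    unfolding src_def tgt_def by (rule bd_E0[OF e own(2,3)[OF W E0_E[OF e]]])
  then have "src e \<in> tv (own C e)" "tgt e \<in> tv (own C e)"
    using bd_subset_tv[OF oC] by auto
  moreover have "c (src e) = 1" "c (tgt e) = 2"
    unfolding src_def tgt_def using vx(2)[OF own(2)[OF W E0_E[OF e]]] by auto
  ultimately show "vx 1 (own C e) = src e" "vx 2 (own C e) = tgt e"
    using vx_eqI[OF oC(1)] by metis+
qed

lemma bd_src_tgt: "e \<in> E0 \<Longrightarrow> bd e = {src e, tgt e}"
  unfolding src_def tgt_def by (rule bd_E0) (use own(2,3)[of W e] E0_E in auto)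

lemma colour_src_tgt:
  assumes "e \<in> E0"
  shows "c (src e) = 1" "c (tgt e) = 2"
  unfolding src_def tgt_def using vx(2)[OF own(2)[OF _ E0_E[OF assms], of W]] by auto

lemma colour_apex:
  assumes "C \<in> {W, B}" "e \<in> E0"
  shows "c (apex C e) = 0" "apex C e \<in> R"
proof -
  note o = own(2)[OF assms(1) E0_E[OF assms(2)]]
  show "c (apex C e) = 0" using vx(2)[OF o, of 0] by (simp add: apex_def)
  then show "apex C e \<in> R" using vx(1)[OF o, of 0] tri(1)[OF o] by (auto simp: R_def apex_def)
qed

lemma tv_own:
  assumes "C \<in> {W, B}" "e \<in> E0"
  shows "tv (own C e) = {apex C e, src e, tgt e}"
  using tv_eq[OF own(2)[OF assms(1) E0_E[OF assms(2)]]] E0_ends[OF assms] by (simp add: apex_def)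

text \<open>A triangle has exactly one edge avoiding colour 0, so edges of \<open>E0\<close> with
  apex \<open>r\<close> stand for the triangles at \<open>r\<close>, in either colour.\<close>

lemma bij_betw_own:
  assumes C: "C \<in> {W, B}" and r: "r \<in> R"
  shows "bij_betw (own C) {e \<in> E0. apex C e = r} {f \<in> C. r \<in> tv f}"
proof (rule bij_betw_imageI)
  show "inj_on (own C) {e \<in> E0. apex C e = r}"
  proof (rule inj_onI)
    fix e e' assume e: "e \<in> {e \<in> E0. apex C e = r}" "e' \<in> {e \<in> E0. apex C e = r}" "own C e = own C e'"
    then have eE: "e \<in> E0" "e' \<in> E0" by auto
    note oC = own(2,3)[OF C E0_E[OF eE(1)]] and oC' = own(3)[OF C E0_E[OF eE(2)]]
    have "bd e = bd e'"
      using bd_E0[OF eE(1) oC] bd_E0[OF eE(2) oC(1)] oC' e(3) by simp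
    then show "e = e'"
      using bij_betw_imp_inj_on[OF tri(4)[OF oC(1)]] oC(2) oC' e(3) by (simp add: inj_onD)
  qed
  show "own C ` {e \<in> E0. apex C e = r} = {f \<in> C. r \<in> tv f}"
  proof (intro equalityI subsetI)
    fix f assume "f \<in> own C ` {e \<in> E0. apex C e = r}"
    then show "f \<in> {f \<in> C. r \<in> tv f}"
      using own(1)[OF C] tv_own[OF C] E0_E by auto
  next
    fix f assume f: "f \<in> {f \<in> C. r \<in> tv f}"
    then obtain e where e: "e \<in> E0" "own C e = f" using E0_of_face[OF C, of f] by auto
    have "f \<in> W \<union> B" using f C by auto
    then have "r = vx 0 f" using f r by (intro vx_eqI) (auto simp: R_def)
    then show "f \<in> own C ` {e \<in> E0. apex C e = r}"
      using e by (auto simp: apex_def)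
  qed
qed

text \<open>The right-hand side does not mention the colour: white and black triangles at
  \<open>r\<close> cover its neighbours with the same multiplicities. Degree equality,
  \<open>balance\<close> and flatness of differences all arise by choosing \<open>g\<close>.\<close>

lemma sum_link:
  fixes g :: "'a \<Rightarrow> 'g::comm_monoid_add"
  assumes C: "C \<in> {W, B}" and r: "r \<in> R"
  shows "(\<Sum>e | e \<in> E0 \<and> apex C e = r. g (src e) + g (tgt e)) = (\<Sum>e | e \<in> E \<and> r \<in> bd e. g (other r e))"
proof -
  have "(\<Sum>e | e \<in> E0 \<and> apex C e = r. g (src e) + g (tgt e))
      = (\<Sum>e | e \<in> E0 \<and> apex C e = r. \<Sum>x\<in>tv (own C e) - {r}. g x)"
  proof (rule sum.cong)
    fix e assume "e \<in> {e \<in> E0. apex C e = r}"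
    then have e: "e \<in> E0" "apex C e = r" by auto
    have "tv (own C e) - {r} = {src e, tgt e}"
      using tv_own[OF C e(1)] e colour_src_tgt[OF e(1)] r by (auto simp: R_def)
    moreover have "src e \<noteq> tgt e" using colour_src_tgt[OF e(1)] by auto
    ultimately show "g (src e) + g (tgt e) = (\<Sum>x\<in>tv (own C e) - {r}. g x)" by simp
  qed simp
  also have "\<dots> = (\<Sum>f | f \<in> C \<and> r \<in> tv f. \<Sum>x\<in>tv f - {r}. g x)"
    by (rule sum.reindex_bij_betw[OF bij_betw_own[OF C r]])
  also have "\<dots> = (\<Sum>e | e \<in> E \<and> r \<in> bd e \<and> own C e \<in> {f \<in> C. r \<in> tv f}. g (other r e))"
    by (rule sum_around[OF C order_refl])
  also have "{e. e \<in> E \<and> r \<in> bd e \<and> own C e \<in> {f \<in> C. r \<in> tv f}} = {e. e \<in> E \<and> r \<in> bd e}"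
    using own_around[OF C] by blast
  finally show ?thesis .
qed

lemma sum_link_eq:
  fixes g :: "'a \<Rightarrow> 'g::comm_monoid_add"
  assumes "r \<in> R"
  shows "(\<Sum>e | e \<in> E0 \<and> apex W e = r. g (src e) + g (tgt e))
    = (\<Sum>e | e \<in> E0 \<and> apex B e = r. g (src e) + g (tgt e))"
  using sum_link[of W r g] sum_link[of B r g] assms by simp

lemma apex_pair:
  assumes e: "e \<in> E0" and f: "f \<in> W \<union> B" "e \<in> te f" and g: "g \<in> W \<union> B" "e \<in> te g" and "f \<noteq> g"
  shows "{apex W e, apex B e} = {vx 0 f, vx 0 g}"
proof -
  have "inc e = {f, g}" by (rule inc_eq[OF E0_E[OF e] f(1) g(1) f(2) g(2) assms(6)])
  then have "vx 0 ` inc e = {vx 0 f, vx 0 g}" by simp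
  then show ?thesis by (simp add: inc_def apex_def)
qed

text \<open>Stepping to an adjacent triangle either keeps the vertex of colour 0 or crosses an edge
  of \<open>E0\<close>, whose two apexes are joined; so connectivity of the dual graph descends to
  \<open>R\<close>.\<close>

lemma R_tree: "\<exists>D. tree_on (\<lambda>e. {apex W e, apex B e}) E0 R D"
proof (rule spanning_tree_exists)
  show "finite R" using finV by (simp add: R_def)
  obtain f where f: "f \<in> W \<union> B" using ne by blast
  then have "vx 0 f \<in> R" using vx[OF f, of 0] tri(1)[OF f] by (auto simp: R_def)
  then show "R \<noteq> {}" by blast
next
  fix X assume X: "X \<subseteq> R" "X \<noteq> {}" "X \<noteq> R"
  let ?F = "{f \<in> W \<union> B. vx 0 f \<in> X}"
  have face: "\<exists>f\<in>W \<union> B. vx 0 f = r" if "r \<in> R" for r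
  proof -
    have r: "r \<in> V" "c r = 0" using that by (auto simp: R_def)
    from cover[OF r(1)] obtain f where "f \<in> W \<union> B" "r \<in> tv f" by blast
    then show ?thesis using vx_eqI[of f r 0] r by auto
  qed
  show "\<exists>e\<in>E0. \<exists>r\<in>X. \<exists>r'\<in>R - X. {apex W e, apex B e} = {r, r'}"
  proof (rule ccontr)
    assume no: "\<not> ?thesis"
    have "?F = W \<union> B"
    proof (rule dual)
      show "?F \<noteq> {}" using face X by blast
      fix e f g assume a: "e \<in> E" "f \<in> ?F" "e \<in> te f" "g \<in> W \<union> B" "e \<in> te g"
      show "g \<in> ?F"
      proof (rule ccontr)
        assume "g \<notin> ?F"
        then have g: "vx 0 g \<notin> X" using a by blast
        have f: "f \<in> W \<union> B" "vx 0 f \<in> X" using a by auto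
        have "0 \<notin> c ` bd e"
        proof
          assume "0 \<in> c ` bd e"
          then obtain w where w: "w \<in> bd e" "c w = 0" by auto
          have "w = vx 0 f" "w = vx 0 g"
            using vx_eqI[OF f(1) _ w(2)] vx_eqI[OF a(4) _ w(2)]
              bd_subset_tv[OF f(1) a(3)] bd_subset_tv[OF a(4,5)] w(1) by auto
          then show False using f g by simp
        qed
        then have "e \<in> E0" using a by (simp add: E0_def)
        moreover have "f \<noteq> g" using f g by blast
        ultimately have "{apex W e, apex B e} = {vx 0 f, vx 0 g}"
          by (intro apex_pair) (use a f in auto)
        moreover have "vx 0 g \<in> R"
          using vx[OF a(4), of 0] tri(1)[OF a(4)] by (auto simp: R_def)
        ultimately show False using no \<open>e \<in> E0\<close> f g by blast
      qed
    qed auto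
    then have "R \<subseteq> X" using face by blast
    then show False using X by blast
  qed
qed

text \<open>A cycle in \<open>E0 - D\<close> would separate the triangles. But edges at a vertex of
  \<open>R\<close> are outside \<open>E0\<close>, so a part \<open>X\<close> closed across the other
  edges consists of whole stars of such vertices, and the edges of \<open>D\<close> connect all
  these stars.\<close>

lemma R_tree_acyclic:
  assumes D: "tree_on (\<lambda>e. {apex W e, apex B e}) E0 R D"
  shows "acyclic_edges bd (E0 - D)"
proof (rule ccontr)
  assume na: "\<not> acyclic_edges bd (E0 - D)"
  have "E0 - D \<subseteq> E" using E0_E by blast
  from jordan[OF this na] obtain X where X: "X \<subseteq> W \<union> B" "X \<noteq> {}" "X \<noteq> W \<union> B"
    and cl: "\<forall>e\<in>E - (E0 - D). \<forall>f\<in>X. \<forall>g\<in>W \<union> B. e \<in> te f \<longrightarrow> e \<in> te g \<longrightarrow> g \<in> X"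
    by blast
  have DE: "D \<subseteq> E0" by (rule tree_on_edges[OF D])
  have star: "g \<in> X" if f: "f \<in> X" and g: "g \<in> W \<union> B" "vx 0 f = vx 0 g" for f g
  proof -
    let ?r = "vx 0 f"
    have f': "f \<in> W \<union> B" using f X by blast
    have r: "?r \<in> V" "c ?r = 0" "?r \<in> tv f" "?r \<in> tv g"
      using vx[OF f', of 0] vx[OF g(1), of 0] tri(1)[OF f'] g by auto
    have "{h \<in> X. ?r \<in> tv h} = {h \<in> W \<union> B. ?r \<in> tv h}"
    proof (rule link[OF r(1)])
      fix e h h' assume a: "e \<in> E" "?r \<in> bd e" "h \<in> {h \<in> X. ?r \<in> tv h}" "e \<in> te h"
        "h' \<in> W \<union> B" "e \<in> te h'"
      have "0 \<in> c ` bd e" using a(2) r(2) by (metis imageI)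
      then have "e \<notin> E0" by (simp add: E0_def)
      then have "h' \<in> X" using cl a by blast
      then show "h' \<in> {h \<in> X. ?r \<in> tv h}"
        using bd_subset_tv[OF a(5,6)] a(2) by blast
    qed (use X f r in auto)
    then show ?thesis using g r by blast
  qed
  let ?Y = "vx 0 ` X"
  obtain f0 where f0: "f0 \<in> X" using X by blast
  have "R \<subseteq> ?Y"
  proof (rule tree_on_connected[OF D, where x = "vx 0 f0"])
    fix e r r' assume e: "e \<in> D" "{apex W e, apex B e} = {r, r'}" "r \<in> ?Y"
    have e0: "e \<in> E0" using e DE by blast
    have r: "apex C' e \<in> ?Y" if C: "C \<in> {W, B}" "apex C e \<in> ?Y" and C': "C' \<in> {W, B}" for C C'
    proof -
      from C(2) obtain f where f: "f \<in> X" "vx 0 f = vx 0 (own C e)" by (auto simp: apex_def)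
      have "own C e \<in> X"
        by (rule star[OF f(1) _ f(2)]) (rule own(2)[OF C(1) E0_E[OF e0]])
      moreover have "e \<in> E - (E0 - D)" using e DE E0_E by blast
      ultimately have "own C' e \<in> X"
        using cl own(2,3)[OF C' E0_E[OF e0]] own(3)[OF C(1) E0_E[OF e0]] by blast
      then show "apex C' e \<in> ?Y" by (simp add: apex_def)
    qed
    have rr: "r = apex W e \<or> r = apex B e" "r' = apex W e \<or> r' = apex B e"
      using e(2) by (auto simp: doubleton_eq_iff)
    have "apex W e \<in> ?Y \<or> apex B e \<in> ?Y" using rr(1) e(3) by metis
    then have all: "apex C' e \<in> ?Y" if "C' \<in> {W, B}" for C'
    proof (rule disjE)
      show "apex C' e \<in> ?Y" if "apex W e \<in> ?Y"
        by (rule r[OF insertI1 that \<open>C' \<in> {W, B}\<close>])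
      show "apex C' e \<in> ?Y" if "apex B e \<in> ?Y"
        by (rule r[OF insertI2[OF singletonI] that \<open>C' \<in> {W, B}\<close>])
    qed
    have "apex W e \<in> ?Y" "apex B e \<in> ?Y" by (rule all, simp)+
    then show "r' \<in> ?Y" using rr(2) by metis
  next
    have f0': "f0 \<in> W \<union> B" using f0 X by blast
    show "vx 0 f0 \<in> R" using vx[OF f0', of 0] tri(1)[OF f0'] by (auto simp: R_def)
    show "vx 0 f0 \<in> ?Y" using f0 by blast
  qed
  have "g \<in> X" if g: "g \<in> W \<union> B" for g
  proof -
    have "vx 0 g \<in> R" using vx[OF g, of 0] tri(1)[OF g] by (auto simp: R_def)
    then obtain f where "f \<in> X" "vx 0 g = vx 0 f" using \<open>R \<subseteq> ?Y\<close> by auto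
    then show ?thesis using star[of f g] g by simp
  qed
  then show False using X by blast
qed

text \<open>An edge has at most one end of colour 0, so adjacent triangles share a vertex outside
  \<open>R\<close>, through which membership in \<open>Y\<close> passes.\<close>

lemma src_tgt_connected:
  assumes Y: "\<And>e. e \<in> E0 \<Longrightarrow> src e \<in> Y \<longleftrightarrow> tgt e \<in> Y" and v: "v \<in> V - R" "v \<in> Y"
  shows "V - R \<subseteq> Y"
proof -
  have iff: "vx 1 f \<in> Y \<longleftrightarrow> vx 2 f \<in> Y" if "f \<in> W \<union> B" for f
  proof -
    from that obtain C where C: "C \<in> {W, B}" "f \<in> C" by auto
    from E0_of_face[OF this] obtain e where "e \<in> E0" "own C e = f" by blast
    then show ?thesis using E0_ends[OF C(1), of e] Y[of e] by simp
  qed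
  have col: "w = vx 1 f \<or> w = vx 2 f" if "f \<in> W \<union> B" "w \<in> tv f" "c w \<noteq> 0" for f w
    using tv_eq[OF that(1)] that(2,3) vx(2)[OF that(1), of 0] by auto
  have nz: "\<exists>f\<in>W \<union> B. w \<in> tv f \<and> c w \<noteq> 0" if "w \<in> V - R" for w
    using that cover[of w] by (auto simp: R_def)
  let ?X = "{f \<in> W \<union> B. vx 1 f \<in> Y}"
  have "?X = W \<union> B"
  proof (rule dual)
    obtain f where f: "f \<in> W \<union> B" "v \<in> tv f" "c v \<noteq> 0" using nz[OF v(1)] by blast
    then show "?X \<noteq> {}" using col[OF f] iff[OF f(1)] v(2) by blast
    fix e f g assume a: "e \<in> E" "f \<in> ?X" "e \<in> te f" "g \<in> W \<union> B" "e \<in> te g"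
    have f: "f \<in> W \<union> B" using a by blast
    have "\<not> bd e \<subseteq> {vx 0 f}"
      using bd[OF a(1)] card_mono[of "{vx 0 f}" "bd e"] by auto
    then obtain w where w: "w \<in> bd e" "w \<noteq> vx 0 f" by blast
    have wf: "w \<in> tv f" "w \<in> tv g"
      using bd_subset_tv[OF f a(3)] bd_subset_tv[OF a(4,5)] w by auto
    then have cw: "c w \<noteq> 0" using vx_eqI[OF f] w by auto
    have "w \<in> Y" using col[OF f wf(1) cw] iff[OF f] a by blast
    then show "g \<in> ?X" using col[OF a(4) wf(2) cw] iff[OF a(4)] a(4) by blast
  qed auto
  then have "vx 1 f \<in> Y" "vx 2 f \<in> Y" if "f \<in> W \<union> B" for f
    using that iff by blast+
  then show ?thesis using nz col by blast
qed

lemma trinity: "trinity V R E0 src tgt (apex W) (apex B)"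
proof
  show "finite V" by (rule finV)
  show "finite E0" using finE by (simp add: E0_def)
  show "R \<subseteq> V" by (auto simp: R_def)
  show "E0 \<noteq> {}" using ne E0_of_face[of W] E0_of_face[of B] by blast
  show "apex W e \<in> R" "apex B e \<in> R" if "e \<in> E0" for e
    using colour_apex(2) that by auto
  show "src e \<in> V - R" "tgt e \<in> V - R" if "e \<in> E0" for e
    using colour_src_tgt[OF that] bd_in_V[OF E0_E[OF that]] bd_src_tgt[OF that] by (auto simp: R_def)
  show "src ` E0 \<inter> tgt ` E0 = {}"
    using colour_src_tgt by fastforce
  show "V - R \<subseteq> Y" if "\<And>e. e \<in> E0 \<Longrightarrow> src e \<in> Y \<longleftrightarrow> tgt e \<in> Y" "v \<in> V - R" "v \<in> Y" for Y v
    by (rule src_tgt_connected[OF that])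
  \<comment> \<open>With \<open>g\<close> constantly 1 every edge counts twice on both
    sides.\<close>
  show "card {e \<in> E0. apex W e = r} = card {e \<in> E0. apex B e = r}" if "r \<in> R" for r
    using sum_link_eq[OF that, of "\<lambda>_. 1 :: nat"] by simp
  show "(\<Sum>e | e \<in> E0 \<and> apex W e = r. frag_of (src e) + frag_of (tgt e))
      = (\<Sum>e | e \<in> E0 \<and> apex B e = r. frag_of (src e) + frag_of (tgt e))" if "r \<in> R" for r
    by (rule sum_link_eq[OF that])
next
  fix N H :: "('a \<Rightarrow>\<^sub>0 int) set" and \<phi>
  assume N: "add_subgroup N" and H: "add_subgroup H" "\<And>e. e \<in> E0 \<Longrightarrow> \<phi> e \<in> H"
    and flat: "\<And>r. r \<in> R \<Longrightarrow>
      (\<Sum>e | e \<in> E0 \<and> apex W e = r. \<phi> e) - (\<Sum>e | e \<in> E0 \<and> apex B e = r. \<phi> e) \<in> N"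
  obtain D where D: "tree_on (\<lambda>e. {apex W e, apex B e}) E0 R D" using R_tree by blast
  have fin: "finite E0" using finE by (simp add: E0_def)
  have ef: "(\<Sum>e | e \<in> E0 \<and> apex W e = r. p (tgt e) - p (src e))
      = (\<Sum>e | e \<in> E0 \<and> apex B e = r. p (tgt e) - p (src e))"
    if "r \<in> R" for r and p :: "'a \<Rightarrow> ('a \<Rightarrow>\<^sub>0 int)"
  proof -
    \<comment> \<open>The sign is flipped on the class of the sources, so that differences become
      the sums treated by \<open>sum_link_eq\<close>.\<close>
    let ?g = "\<lambda>v. if c v = 2 then p v else - p v"
    have "(\<Sum>e | e \<in> E0 \<and> apex C e = r. p (tgt e) - p (src e))
        = (\<Sum>e | e \<in> E0 \<and> apex C e = r. ?g (src e) + ?g (tgt e))" for C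
      by (rule sum.cong) (use colour_src_tgt in auto)
    then show ?thesis using sum_link_eq[OF that, of ?g] by simp
  qed
  obtain p where "\<And>v. p v \<in> H" "\<And>e. e \<in> E0 \<Longrightarrow> p (tgt e) - p (src e) - \<phi> e \<in> N"
    by (rule flat_imp_exact[OF fin bd_src_tgt refl D R_tree_acyclic[OF D] N H flat ef]) auto
  then show "\<exists>p. (\<forall>v. p v \<in> H) \<and> (\<forall>e\<in>E0. p (tgt e) - p (src e) - \<phi> e \<in> N)" by blast
qed

lemma triangle_relators_eq:
  assumes C: "C \<in> {W, B}"
  shows "{frag_of x + frag_of y + frag_of z | x y z. \<exists>f\<in>C. tv f = {x, y, z}}
    = (\<lambda>e. frag_of (apex C e) + frag_of (src e) + frag_of (tgt e)) ` E0" (is "?L = ?g ` E0")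
proof (intro equalityI subsetI)
  fix u assume "u \<in> ?L"
  then obtain x y z f where u: "u = frag_of x + frag_of y + frag_of z" and f: "f \<in> C" "tv f = {x, y, z}"
    by blast
  from E0_of_face[OF C f(1)] obtain e where e: "e \<in> E0" "own C e = f" by blast
  have f': "f \<in> W \<union> B" using f C by auto
  have "card {x, y, z} = 3" using tri(2)[OF f'] f by simp
  then have d: "x \<noteq> y" "y \<noteq> z" "x \<noteq> z" by (auto simp: card_insert_if split: if_splits)
  have "apex C e \<noteq> src e" "src e \<noteq> tgt e" "apex C e \<noteq> tgt e"
    using colour_apex[OF C e(1)] colour_src_tgt[OF e(1)] by auto
  then have "?g e = (\<Sum>v\<in>tv f. frag_of v)"
    using tv_own[OF C e(1)] e(2) by (simp add: add.assoc)
  also have "\<dots> = u" using d f(2) u by (simp add: add.assoc)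
  finally show "u \<in> ?g ` E0" using e(1) by blast
next
  fix u assume "u \<in> ?g ` E0"
  then obtain e where e: "e \<in> E0" "u = ?g e" by blast
  then show "u \<in> ?L" using tv_own[OF C e(1)] own(1)[OF C E0_E[OF e(1)]] by blast
qed

end

theorem (in coloured_triangulation) triangle_presentations_iso:
  "abelian_presentation V {frag_of x + frag_of y + frag_of z | x y z. \<exists>f\<in>W. tv f = {x, y, z}}
    \<cong> abelian_presentation V {frag_of x + frag_of y + frag_of z | x y z. \<exists>f\<in>B. tv f = {x, y, z}}"
proof -
  from three_colourable obtain c where c: "\<forall>f\<in>W \<union> B. proper3 c f" ..
  interpret three_coloured_triangulation V E bd W B tv te c
    by unfold_locales (use c in blast)
  show ?thesis
    using trinity_iso[OF trinity] by (simp add: triangle_relators_eq)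
qed

subsection \<open>Topology of the sphere\<close>

lemma openin_diff_closed: "closed C \<Longrightarrow> openin (top_of_set S) (S - C)"
  by (metis Diff_eq openin_open_Int open_Compl)

text \<open>Stereographic projection. The plane is \<open>complex\<close> because the Jordan curve
  theorem will be applied there.\<close>

lemma sphere_chart:
  assumes "q \<in> unit_sphere"
  obtains h k where "homeomorphism (unit_sphere - {q}) (UNIV :: complex set) h k"
proof -
  have "(unit_sphere - {q}) homeomorphic (UNIV :: complex set)"
    using assms by (intro homeomorphic_punctured_sphere_affine) auto
  then show ?thesis using that unfolding homeomorphic_def by blast
qed

lemma chart_open_image:
  assumes hk: "homeomorphism (unit_sphere - {q}) (UNIV :: complex set) h k" and D: "open D"
  shows "openin (top_of_set unit_sphere) (k ` D)"
proof -
  have "openin (top_of_set (unit_sphere - {q})) (k ` D)"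
    by (rule homeomorphism_imp_open_map[OF homeomorphism_symD[OF hk]]) (use D in simp)
  moreover have "openin (top_of_set unit_sphere) (unit_sphere - {q})"
    by (intro openin_delete openin_subtopology_self)
  ultimately show ?thesis by (rule openin_trans)
qed

text \<open>Discs in the chart from the antipode of \<open>x\<close>. That they survive the loss of
  a point connected is what two-dimensionality contributes: it keeps arcs from having interior and
  connects the faces around a vertex.\<close>

lemma sphere_nbhd:
  assumes U: "openin (top_of_set unit_sphere) U" and x: "x \<in> U"
  obtains N where "openin (top_of_set unit_sphere) N" "x \<in> N" "N \<subseteq> U" "infinite N"
    "connected N" "\<And>y. connected (N - {y})"
proof -
  have xS: "x \<in> unit_sphere" using U x openin_imp_subset by blast
  have q: "- x \<in> unit_sphere" "- x \<noteq> x"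
  proof -
    show "- x \<in> unit_sphere" using xS by simp
    have "x = 0" if "- x = x"
    proof -
      have "x + x = 0" using that by (metis add.right_inverse)
      then have "2 *\<^sub>R x = 0" by (simp add: scaleR_2)
      then show ?thesis by simp
    qed
    then show "- x \<noteq> x" using xS by auto
  qed
  obtain h k where hk: "homeomorphism (unit_sphere - {- x}) (UNIV :: complex set) h k"
    using sphere_chart[OF q(1)] .
  have xq: "x \<in> unit_sphere - {- x}" using xS q by auto
  have "openin (top_of_set (unit_sphere - {- x})) (U - {- x})"
    using U by (meson Diff_mono openin_delete openin_imp_subset openin_subset_trans order_refl Diff_subset)
  then have "open (h ` (U - {- x}))"
    using homeomorphism_imp_open_map[OF hk] by simp
  moreover have "h x \<in> h ` (U - {- x})" using x q by auto
  ultimately obtain \<epsilon> where \<epsilon>: "\<epsilon> > 0" "ball (h x) \<epsilon> \<subseteq> h ` (U - {- x})"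
    by (meson openE)
  let ?N = "k ` ball (h x) \<epsilon>"
  have kh: "k (h y) = y" if "y \<in> unit_sphere - {- x}" for y
    using hk that by (simp add: homeomorphism_def)
  have hk': "h (k z) = z" for z
    using hk by (simp add: homeomorphism_def)
  have injk: "inj k" by (rule inj_on_inverseI[of _ h]) (rule hk')
  have contk: "continuous_on T k" for T
    using hk continuous_on_subset[of UNIV k T] by (simp add: homeomorphism_def)
  have punct: "connected (ball (h x) \<epsilon> - {z})" for z
    by (rule connected_punctured_convex) (use aff_dim_open[of "ball (h x) \<epsilon>"] \<epsilon> in auto)
  show ?thesis
  proof (rule that)
    show "openin (top_of_set unit_sphere) ?N"
      by (rule chart_open_image[OF hk]) simp
    show "x \<in> ?N" using kh[OF xq] \<epsilon> by (intro image_eqI[of _ _ "h x"]) auto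
    show "?N \<subseteq> U"
    proof
      fix y assume "y \<in> ?N"
      then obtain u where "u \<in> U - {- x}" "y = k (h u)" using \<epsilon> by blast
      then show "y \<in> U" using kh[of u] openin_imp_subset[OF U] by auto
    qed
    have "uncountable (ball (h x) \<epsilon>)" using \<epsilon> by (simp add: uncountable_ball)
    then show "infinite ?N"
      using injk finite_imageD[of k "ball (h x) \<epsilon>"] inj_on_subset[OF injk] countable_finite by blast
    show "connected ?N" by (rule connected_continuous_image[OF contk]) simp
    show "connected (?N - {y})" for y
    proof (cases "y \<in> range k")
      case True
      then obtain z where "y = k z" by blast
      then have "?N - {y} = k ` (ball (h x) \<epsilon> - {z})"
        using injk by (auto simp: inj_eq)
      then show ?thesis using connected_continuous_image[OF contk punct] by simp
    next
      case False
      then have "?N - {y} = ?N" by blast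
      then show ?thesis using connected_continuous_image[OF contk, of "ball (h x) \<epsilon>"] by simp
    qed
  qed
qed

section \<open>Sets with empty interior and the Jordan curve theorem on the sphere\<close>

definition thin :: "(real ^ 3) set \<Rightarrow> bool" where
  "thin C \<longleftrightarrow> closed C \<and> (\<forall>U. openin (top_of_set unit_sphere) U \<longrightarrow> U \<subseteq> C \<longrightarrow> U = {})"

text \<open>A disc \<open>N\<close> inside the arc would be carried injectively and continuously
  into an interval. Deleting an inner point disconnects its image there, but not
  \<open>N\<close>.\<close>

lemma thin_arc:
  assumes g: "arc g"
  shows "thin (path_image g)"
  unfolding thin_def
proof (intro conjI allI impI)
  show "closed (path_image g)" using g by (rule closed_arc_image)
  fix U assume U: "openin (top_of_set unit_sphere) U" "U \<subseteq> path_image g"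
  show "U = {}"
  proof (rule ccontr)
    assume "U \<noteq> {}"
    then obtain x where "x \<in> U" by blast
    from sphere_nbhd[OF U(1) this]
    obtain N where N: "x \<in> N" "N \<subseteq> U" "infinite N" "connected N" "\<And>y. connected (N - {y})"
      by metis
    obtain r where r: "homeomorphism {0..1} (path_image g) g r"
      using homeomorphism_arc[OF g] .
    have gr: "g (r y) = y" if "y \<in> N" for y
      using r that N(2) U(2) unfolding homeomorphism_def by blast
    have cont: "continuous_on T r" if "T \<subseteq> N" for T
      using r that N(2) U(2) unfolding homeomorphism_def by (blast intro: continuous_on_subset)
    have "N - {x} \<noteq> {}" using N(3) by (metis finite.emptyI infinite_remove)
    then obtain y where y: "y \<in> N" "y \<noteq> x" by blast
    define s t where "s = min (r x) (r y)" and "t = max (r x) (r y)"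
    have "r x \<noteq> r y" using gr[OF N(1)] gr[OF y(1)] y(2) by metis
    then have st: "s < t" by (auto simp: s_def t_def)
    have sN: "s \<in> r ` N" "t \<in> r ` N"
      using N(1) y(1) by (auto simp: s_def t_def min_def max_def)
    obtain m where m: "s < m" "m < t" using st dense by blast
    have "connected (r ` N)"
      by (rule connected_continuous_image[OF cont[OF order_refl] N(4)])
    then have "m \<in> r ` N"
      using connected_contains_Icc[of "r ` N" s t] sN m by auto
    then obtain z where z: "z \<in> N" "m = r z" by blast
    have c: "connected (r ` (N - {z}))"
      by (rule connected_continuous_image[OF cont N(5)]) blast
    have "u \<in> r ` (N - {z})" if "u \<in> r ` N" "u \<noteq> m" for u
      using that z(2) by blast
    then have "s \<in> r ` (N - {z})" "t \<in> r ` (N - {z})"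
      using sN m by auto
    then have "{s..t} \<subseteq> r ` (N - {z})" by (rule connected_contains_Icc[OF c])
    moreover have "m \<in> {s..t}" using m by simp
    ultimately have "m \<in> r ` (N - {z})" by blast
    then obtain z' where z': "z' \<in> N - {z}" "m = r z'" by blast
    then have "z' = z" using gr[of z'] gr[OF z(1)] z(2) by simp
    then show False using z'(1) by blast
  qed
qed

lemma thin_singleton: "thin {p}"
  unfolding thin_def
proof (intro conjI allI impI)
  fix U assume U: "openin (top_of_set unit_sphere) U" "U \<subseteq> {p}"
  show "U = {}"
  proof (rule ccontr)
    assume "U \<noteq> {}"
    then obtain x where "x \<in> U" by blast
    from sphere_nbhd[OF U(1) this] obtain N where "N \<subseteq> U" "infinite N" by metis
    then show False using U(2) finite_subset[of N "{p}"] by auto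
  qed
qed simp

lemma thin_Un:
  assumes C: "thin C" and D: "thin D"
  shows "thin (C \<union> D)"
  unfolding thin_def
proof (intro conjI allI impI)
  show "closed (C \<union> D)" using C D by (auto simp: thin_def)
  fix U assume U: "openin (top_of_set unit_sphere) U" "U \<subseteq> C \<union> D"
  have "closedin (top_of_set unit_sphere) (unit_sphere \<inter> C)"
    using C by (intro closedin_closed_Int) (simp add: thin_def)
  then have "openin (top_of_set unit_sphere) (U - unit_sphere \<inter> C)"
    by (rule openin_diff[OF U(1)])
  moreover have "U - unit_sphere \<inter> C = U - C"
    using openin_imp_subset[OF U(1)] by blast
  ultimately have "openin (top_of_set unit_sphere) (U - C)" by (simp only:)
  then have "U - C = {}" using D U(2) unfolding thin_def by blast
  then show "U = {}" using C U(1) unfolding thin_def by blast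
qed

lemma thin_UN: "finite I \<Longrightarrow> (\<And>i. i \<in> I \<Longrightarrow> thin (C i)) \<Longrightarrow> thin (\<Union>i\<in>I. C i)"
proof (induction I rule: finite_induct)
  case empty
  then show ?case by (auto simp: thin_def)
qed (auto intro: thin_Un)

lemma Jordan_sphere:
  assumes c: "simple_path c" "pathfinish c = pathstart c" and cS: "path_image c \<subseteq> unit_sphere"
    and q: "q \<in> unit_sphere - path_image c"
  obtains A D where "openin (top_of_set unit_sphere) A" "openin (top_of_set unit_sphere) D"
    "A \<inter> D = {}" "A \<union> D = unit_sphere - path_image c"
    "path_image c \<subseteq> closure A" "path_image c \<subseteq> closure D"
proof -
  obtain h k where hk: "homeomorphism (unit_sphere - {q}) (UNIV :: complex set) h k"
    using sphere_chart[of q] q by blast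
  have kh: "k (h y) = y" if "y \<in> unit_sphere - {q}" for y
    using hk that by (simp add: homeomorphism_def)
  have hk': "h (k z) = z" "k z \<in> unit_sphere - {q}" for z
    using hk unfolding homeomorphism_def by blast+
  have contk: "continuous_on T k" for T
    using hk continuous_on_subset[of UNIV k T] by (simp add: homeomorphism_def)
  have cq: "path_image c \<subseteq> unit_sphere - {q}" using cS q by blast
  have "continuous_on (unit_sphere - {q}) h"
    using hk by (simp add: homeomorphism_def)
  then have conth: "continuous_on (path_image c) h"
    using cq by (rule continuous_on_subset)
  have injh: "inj_on h (path_image c)"
    by (rule inj_on_inverseI[of _ k]) (use kh cq in blast)
  let ?c = "h \<circ> c"
  let ?I = "inside (path_image ?c)" and ?O = "outside (path_image ?c)"
  have img: "path_image ?c = h ` path_image c" by (rule path_image_compose)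
  have J: "open ?I" "bounded ?I" "?I \<inter> ?O = {}" "?I \<union> ?O = - path_image ?c"
    "frontier ?I = path_image ?c" "frontier ?O = path_image ?c"
    using Jordan_inside_outside[OF simple_path_continuous_image[OF c(1) conth injh]] c(2)
    by (auto simp: pathfinish_compose pathstart_compose)
  define A where "A = k ` ?I"
  \<comment> \<open>The outer side contains the puncture \<open>q\<close>, which the chart misses.
    As the complement of a compact image it includes \<open>q\<close> and is open.\<close>
  define D where "D = unit_sphere - k ` closure ?I"
  have clI: "closure ?I = ?I \<union> path_image ?c"
    using closure_Un_frontier[of ?I] J(5) by simp
  have kJ: "k ` path_image ?c = path_image c"
    using kh cq unfolding img by (force simp: image_image)
  have cl: "path_image c \<subseteq> closure (k ` T)" if "frontier T = path_image ?c" for T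
  proof -
    have "k ` closure T \<subseteq> closure (k ` T)"
      by (rule image_closure_subset[OF contk closed_closure closure_subset])
    moreover have "path_image ?c \<subseteq> closure T" using that by (auto simp: frontier_def)
    ultimately show ?thesis using kJ by blast
  qed
  have kO: "k ` ?O \<subseteq> D"
  proof
    fix y assume "y \<in> k ` ?O"
    then obtain z where z: "z \<in> ?O" "y = k z" by blast
    have "z \<notin> closure ?I" using z(1) J(3,4) clI by blast
    then have "k z \<notin> k ` closure ?I" by (metis hk'(1) imageE)
    then show "y \<in> D" using z hk'(2)[of z] by (auto simp: D_def)
  qed
  show ?thesis
  proof (rule that)
    show "openin (top_of_set unit_sphere) A"
      unfolding A_def by (rule chart_open_image[OF hk J(1)])
    have "compact (closure ?I)" using J(2) by (simp add: compact_closure)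
    then have "closed (k ` closure ?I)"
      by (intro compact_imp_closed compact_continuous_image[OF contk])
    then show "openin (top_of_set unit_sphere) D"
      unfolding D_def by (rule openin_diff_closed)
    show "A \<inter> D = {}" unfolding A_def D_def clI by blast
    have "A \<subseteq> unit_sphere" using hk'(2) by (auto simp: A_def)
    moreover have "A \<inter> path_image c = {}"
    proof -
      have "?I \<inter> path_image ?c = {}" using J(4) by blast
      then have "k z \<noteq> k w" if "z \<in> ?I" "w \<in> path_image ?c" for z w
        using hk'(1) that by (metis disjoint_iff)
      then show ?thesis unfolding A_def kJ[symmetric] by blast
    qed
    moreover have "D = unit_sphere - (A \<union> path_image c)"
      unfolding D_def clI image_Un kJ A_def ..
    ultimately show "A \<union> D = unit_sphere - path_image c" by blast
    show "path_image c \<subseteq> closure A" unfolding A_def by (rule cl[OF J(5)])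
    show "path_image c \<subseteq> closure D" using cl[OF J(6)] closure_mono[OF kO] by blast
  qed
qed

subsection \<open>From drawings to combinatorial triangulations\<close>

locale drawn_triangulation =
  fixes G :: "('v, 'e) drawn_graph" and W B :: "(real ^ 3) set set"
  assumes triangulation: "sphere_triangulation G" and colouring: "proper_face_2_colouring G W B"
begin

abbreviation img :: "'e \<Rightarrow> (real ^ 3) set" where
  "img e \<equiv> path_image (curve G e)"

abbreviation points :: "(real ^ 3) set" where
  "points \<equiv> point G ` verts G"

lemma finite_graph: "finite (verts G)" "finite (edges G)"
  and ends: "e \<in> edges G \<Longrightarrow> ends G e \<subseteq> verts G" "e \<in> edges G \<Longrightarrow> card (ends G e) = 2"
  using triangulation by (auto simp: sphere_triangulation_def finite_loopless_multigraph_def)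

lemma embedded: "embedded_in_sphere G"
  using triangulation by (simp add: sphere_triangulation_def two_cell_embedding_def)

lemma inj_point: "inj_on (point G) (verts G)"
  and points_sphere: "points \<subseteq> unit_sphere"
  using embedded by (simp_all add: embedded_in_sphere_def)

lemma edge:
  assumes "e \<in> edges G"
  shows "arc (curve G e)" "img e \<subseteq> unit_sphere"
    "{pathstart (curve G e), pathfinish (curve G e)} = point G ` ends G e"
    "img e \<inter> points = point G ` ends G e"
proof -
  have "\<forall>e\<in>edges G. arc (curve G e) \<and> img e \<subseteq> unit_sphere \<and>
      {pathstart (curve G e), pathfinish (curve G e)} = point G ` ends G e \<and>
      img e \<inter> points = point G ` ends G e"
    using embedded unfolding embedded_in_sphere_def by (elim conjE)
  note * = bspec[OF this assms]
  show "arc (curve G e)" by (rule *[THEN conjunct1])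
  show "img e \<subseteq> unit_sphere" by (rule *[THEN conjunct2, THEN conjunct1])
  show "{pathstart (curve G e), pathfinish (curve G e)} = point G ` ends G e"
    by (rule *[THEN conjunct2, THEN conjunct2, THEN conjunct1])
  show "img e \<inter> points = point G ` ends G e"
    by (rule *[THEN conjunct2, THEN conjunct2, THEN conjunct2])
qed

lemma edges_meet:
  assumes "e \<in> edges G" "f \<in> edges G" "e \<noteq> f"
  shows "img e \<inter> img f \<subseteq> points"
proof -
  have "\<forall>e\<in>edges G. \<forall>f\<in>edges G. e \<noteq> f \<longrightarrow> img e \<inter> img f \<subseteq> points"
    using embedded unfolding embedded_in_sphere_def by (elim conjE)
  from bspec[OF bspec[OF this assms(1)] assms(2)] show ?thesis using assms(3) by (rule mp)
qed

lemma bounded: "F \<in> faces G \<Longrightarrow> bounded_by_3_cycle G F"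
  using triangulation by (auto simp: sphere_triangulation_def)

lemma thin_drawing: "thin (drawing G)"
proof -
  have "drawing G = (\<Union>p\<in>points. {p}) \<union> (\<Union>e\<in>edges G. img e)"
    by (simp add: drawing_def)
  moreover have "thin (\<Union>p\<in>points. {p})"
    by (rule thin_UN) (use finite_graph thin_singleton in auto)
  moreover have "thin (\<Union>e\<in>edges G. img e)"
    by (rule thin_UN) (use finite_graph edge(1) thin_arc in auto)
  ultimately show ?thesis using thin_Un by metis
qed

lemma drawing_sphere: "drawing G \<subseteq> unit_sphere"
  using points_sphere edge(2) by (auto simp: drawing_def)

lemma closed_drawing: "closed (drawing G)"
  using thin_drawing by (simp add: thin_def)

lemma openin_complement: "openin (top_of_set unit_sphere) (unit_sphere - drawing G)"
  by (rule openin_diff_closed[OF closed_drawing])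

lemma face_openin:
  assumes "F \<in> faces G"
  shows "openin (top_of_set unit_sphere) F"
proof -
  have "locally connected (unit_sphere - drawing G)"
    by (rule locally_open_subset[OF locally_connected_sphere openin_complement])
  then have "openin (top_of_set (unit_sphere - drawing G)) F"
    using assms unfolding faces_def by (rule openin_components_locally_connected)
  then show ?thesis using openin_complement by (rule openin_trans)
qed

lemma face_subset: "F \<in> faces G \<Longrightarrow> F \<subseteq> unit_sphere - drawing G"
  unfolding faces_def by (rule in_components_subset)

lemma face_connected: "F \<in> faces G \<Longrightarrow> connected F"
  unfolding faces_def by (rule in_components_connected)

lemma face_nonempty: "F \<in> faces G \<Longrightarrow> F \<noteq> {}"
  unfolding faces_def by (rule in_components_nonempty)

lemma faces_eqI: "F \<in> faces G \<Longrightarrow> F' \<in> faces G \<Longrightarrow> F \<inter> F' \<noteq> {} \<Longrightarrow> F = F'"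
  unfolding faces_def by (simp add: components_eq)

lemma Union_faces: "\<Union> (faces G) = unit_sphere - drawing G"
  unfolding faces_def by (rule Union_components)

text \<open>The sphere is closed and faces are open in it, so the relative frontier can be computed
  with closures in space.\<close>

lemma face_boundary_eq:
  assumes "F \<in> faces G"
  shows "face_boundary F = closure F - F"
proof -
  have F: "F \<subseteq> unit_sphere" using face_subset[OF assms] by blast
  have "closure F \<subseteq> unit_sphere" using F by (intro closure_minimal) auto
  then have "top_of_set unit_sphere closure_of F = closure F"
    using F by (simp add: closure_of_subtopology Int_absorb1)
  moreover have "top_of_set unit_sphere interior_of F = F"
    using face_openin[OF assms] by (simp add: interior_of_eq)
  ultimately show ?thesis by (simp add: face_boundary_def frontier_of_def)
qed

text \<open>A point of the edge away from all vertices, at which incidence with faces is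
  tested.\<close>

definition mid :: "'e \<Rightarrow> real ^ 3" where
  "mid e = curve G e (1 / 2)"

lemma mid:
  assumes e: "e \<in> edges G"
  shows "mid e \<in> img e" "mid e \<notin> points"
proof -
  show m: "mid e \<in> img e" by (auto simp: mid_def path_image_def)
  have i: "inj_on (curve G e) {0..1}" using edge(1)[OF e] by (simp add: arc_def)
  have "mid e \<noteq> pathstart (curve G e)" "mid e \<noteq> pathfinish (curve G e)"
    unfolding mid_def pathstart_def pathfinish_def
    using inj_onD[OF i, of "1 / 2" 0] inj_onD[OF i, of "1 / 2" 1] by auto
  then have "mid e \<notin> point G ` ends G e" using edge(3)[OF e] by auto
  then show "mid e \<notin> points" using m edge(4)[OF e] by blast
qed

lemma inner_point_edge: "x \<in> img e \<Longrightarrow> x \<notin> points \<Longrightarrow> x \<in> img f \<Longrightarrow> e \<in> edges G \<Longrightarrow> f \<in> edges G \<Longrightarrow> e = f"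
  using edges_meet[of e f] by blast

lemma img_drawing: "e \<in> edges G \<Longrightarrow> img e \<subseteq> drawing G"
  by (auto simp: drawing_def)

lemma point_img: "e \<in> edges G \<Longrightarrow> v \<in> verts G \<Longrightarrow> point G v \<in> img e \<longleftrightarrow> v \<in> ends G e"
  using edge(4)[of e] inj_onD[OF inj_point] ends(1)[of e] by (auto simp: image_iff set_eq_iff)

lemma face_cycle:
  assumes F: "F \<in> faces G"
  obtains u v w a b c where "card {u, v, w} = 3" "{u, v, w} \<subseteq> verts G"
    "{a, b, c} \<subseteq> edges G" "ends G a = {u, v}" "ends G b = {v, w}" "ends G c = {w, u}"
    "face_boundary F = img a \<union> img b \<union> img c"
    "boundary_edges G F = {a, b, c}" "boundary_verts G F = {u, v, w}"
proof -
  obtain u v w a b c where uvw: "u \<in> verts G" "v \<in> verts G" "w \<in> verts G" "distinct [u, v, w]"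
    and abc: "a \<in> edges G" "b \<in> edges G" "c \<in> edges G"
    and en: "ends G a = {u, v}" "ends G b = {v, w}" "ends G c = {w, u}"
    and bd: "face_boundary F = img a \<union> img b \<union> img c"
    using bounded[OF F] unfolding bounded_by_3_cycle_def by blast
  have "boundary_edges G F = {a, b, c}"
  proof (intro equalityI subsetI)
    fix e assume e: "e \<in> boundary_edges G F"
    then have eE: "e \<in> edges G" and "mid e \<in> img a \<union> img b \<union> img c"
      using mid(1)[of e] by (auto simp: boundary_edges_def bd)
    then obtain f where "f \<in> {a, b, c}" "mid e \<in> img f" by blast
    then show "e \<in> {a, b, c}"
      using inner_point_edge[OF mid[OF eE] _ eE, of f] abc by auto
  qed (use abc bd in \<open>auto simp: boundary_edges_def\<close>)
  moreover have "x \<in> boundary_verts G F \<longleftrightarrow> x \<in> {u, v, w}" for x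
  proof -
    have "x \<in> boundary_verts G F \<longleftrightarrow> x \<in> verts G \<and> (x \<in> {u, v} \<or> x \<in> {v, w} \<or> x \<in> {w, u})"
      unfolding boundary_verts_def bd en[symmetric]
      using point_img[OF abc(1)] point_img[OF abc(2)] point_img[OF abc(3)] by blast
    then show ?thesis using uvw(1-3) by blast
  qed
  then have "boundary_verts G F = {u, v, w}" by blast
  ultimately show ?thesis
    using that[of u v w a b c] uvw abc en bd by simp
qed

lemma closure_face_vertex:
  assumes F: "F \<in> faces G" and v: "v \<in> verts G" "point G v \<in> closure F"
  shows "v \<in> boundary_verts G F"
proof -
  have "point G v \<notin> F" using face_subset[OF F] v by (auto simp: drawing_def)
  then show ?thesis using v face_boundary_eq[OF F] by (simp add: boundary_verts_def)
qed

text \<open>The boundary of a face consists of three whole edges, and distinct edges meet only in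
  vertices; so one inner point of \<open>e\<close> brings in all of \<open>e\<close>.\<close>

lemma closure_face_edge:
  assumes F: "F \<in> faces G" and e: "e \<in> edges G" and x: "x \<in> img e" "x \<notin> points" "x \<in> closure F"
  shows "e \<in> boundary_edges G F"
proof -
  have "x \<notin> F" using face_subset[OF F] img_drawing[OF e] x by blast
  then have "x \<in> face_boundary F" using x face_boundary_eq[OF F] by simp
  obtain u v w a b c where cyc: "{a, b, c} \<subseteq> edges G" "face_boundary F = img a \<union> img b \<union> img c"
    "boundary_edges G F = {a, b, c}"
    by (rule face_cycle[OF F]) (rule that)
  then obtain f where "f \<in> {a, b, c}" "x \<in> img f"
    using \<open>x \<in> face_boundary F\<close> by blast
  then show ?thesis
    using inner_point_edge[OF x(1,2) _ e, of f] cyc by auto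
qed

lemma boundary_edge_closure: "F \<in> faces G \<Longrightarrow> e \<in> boundary_edges G F \<Longrightarrow> img e \<subseteq> closure F"
  using face_boundary_eq[of F] by (auto simp: boundary_edges_def)

lemma WB_faces: "W \<union> B = faces G"
  using colouring by (simp add: proper_face_2_colouring_def)

lemma WB_disjoint: "W \<inter> B = {}"
  using colouring by (simp add: proper_face_2_colouring_def)

lemma colour_class:
  assumes "C \<in> {W, B}" "F \<in> C" "F' \<in> C" "e \<in> boundary_edges G F" "e \<in> boundary_edges G F'"
  shows "F = F'"
proof -
  have "\<forall>C\<in>{W, B}. \<forall>F\<in>C. \<forall>F'\<in>C. F \<noteq> F' \<longrightarrow> boundary_edges G F \<inter> boundary_edges G F' = {}"
    using colouring unfolding proper_face_2_colouring_def by (elim conjE)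
  from bspec[OF bspec[OF bspec[OF this assms(1)] assms(2)] assms(3)] show ?thesis
    using assms(4,5) by blast
qed

lemma boundary_edges_edges: "e \<in> boundary_edges G F \<Longrightarrow> e \<in> edges G"
  by (simp add: boundary_edges_def)

text \<open>The colouring bounds the number of faces, as each edge bounds at most one face of each colour.\<close>

lemma finite_faces: "finite (faces G)"
proof -
  have "finite C" if C: "C \<in> {W, B}" for C
  proof -
    define pick where "pick F = (SOME e. e \<in> boundary_edges G F)" for F
    have pick: "pick F \<in> boundary_edges G F" if "F \<in> C" for F
    proof -
      have F: "F \<in> faces G" using that C WB_faces by auto
      obtain u v w a b c where "boundary_edges G F = {a, b, c}"
        by (rule face_cycle[OF F]) (rule that)
      then have "\<exists>e. e \<in> boundary_edges G F" by blast
      then show ?thesis unfolding pick_def by (rule someI_ex)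
    qed
    have "inj_on pick C"
    proof (rule inj_onI)
      fix F F' assume "F \<in> C" "F' \<in> C" "pick F = pick F'"
      then show "F = F'" using colour_class[OF C, of F F' "pick F"] pick[of F] pick[of F'] by simp
    qed
    moreover have "pick ` C \<subseteq> edges G" using pick boundary_edges_edges by blast
    ultimately show ?thesis using finite_graph(2) inj_on_finite by blast
  qed
  then have "finite W" "finite B" by blast+
  then show ?thesis using WB_faces by (metis finite_Un)
qed

text \<open>The drawing has empty interior, so \<open>x\<close> is a limit of points of
  \<open>U\<close> lying in faces; as there are finitely many faces, one of them suffices.\<close>

lemma face_near:
  assumes U: "openin (top_of_set unit_sphere) U" and x: "x \<in> closure U"
  obtains F where "F \<in> faces G" "x \<in> closure (F \<inter> U)"
proof -
  have US: "U \<subseteq> unit_sphere" by (rule openin_imp_subset[OF U])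
  have "x \<in> closure (U - drawing G)"
    unfolding closure_iff_nhds_not_empty
  proof (intro allI impI)
    fix T N assume N: "N \<subseteq> T" "open N" "x \<in> N"
    have "U \<inter> N \<noteq> {}" using x N closure_iff_nhds_not_empty by blast
    moreover have "openin (top_of_set unit_sphere) (U \<inter> N)"
      using U N(2) by (rule openin_Int_open)
    ultimately have "\<not> U \<inter> N \<subseteq> drawing G"
      using thin_drawing by (auto simp: thin_def)
    then show "(U - drawing G) \<inter> T \<noteq> {}" using N(1) by blast
  qed
  also have "U - drawing G = (\<Union>F\<in>faces G. F \<inter> U)"
    using Union_faces US by blast
  also have "closure (\<Union>F\<in>faces G. F \<inter> U) \<subseteq> (\<Union>F\<in>faces G. closure (F \<inter> U))"
  proof (rule closure_minimal)
    show "(\<Union>F\<in>faces G. F \<inter> U) \<subseteq> (\<Union>F\<in>faces G. closure (F \<inter> U))"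
      by (rule UN_mono[OF order_refl closure_subset])
    show "closed (\<Union>F\<in>faces G. closure (F \<inter> U))"
      by (rule closed_UN[OF finite_faces]) simp
  qed
  finally have "x \<in> (\<Union>F\<in>faces G. closure (F \<inter> U))" .
  then show ?thesis using that by blast
qed

section \<open>Cycles of the graph as Jordan curves\<close>

lemma path_component_of_edge_reach:
  assumes "edge_reach (ends G) F x y" "F \<subseteq> edges G" "x \<in> verts G"
  shows "path_component ((\<Union>e\<in>F. img e) \<union> points) (point G x) (point G y)"
  using assms(1) unfolding edge_reach_def
proof (induction rule: rtranclp_induct)
  case base
  then show ?case using assms(3) by (intro path_component_refl) auto
next
  case (step y z)
  then obtain e where e: "e \<in> F" "ends G e = {y, z}" by blast
  then have eE: "e \<in> edges G" using assms(2) by blast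
  have yz: "y \<in> verts G" "z \<in> verts G" using ends(1)[OF eE] e(2) by auto
  then have "point G y \<in> img e" "point G z \<in> img e"
    using point_img[OF eE] e(2) by auto
  moreover have "path_connected (img e)"
    using edge(1)[OF eE] by (simp add: arc_imp_path path_connected_path_image)
  ultimately have "path_component (img e) (point G y) (point G z)"
    by (simp add: path_connected_component)
  then have "path_component ((\<Union>e\<in>F. img e) \<union> points) (point G y) (point G z)"
    by (rule path_component_of_subset[rotated]) (use e in blast)
  with step.IH show ?case by (rule path_component_trans)
qed

lemma edge_reach_sym: "edge_reach bd F x y \<Longrightarrow> edge_reach bd F y x"
  unfolding edge_reach_def
  by (rule sympD[OF symp_rtranclp]) (auto simp: symp_def insert_commute)

text \<open>The edge \<open>e\<close> is closed up through the other edges. A walk may repeat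
  points, so an arc is extracted from it; that arc meets \<open>e\<close> only in vertices, hence
  only in its ends. Both sides of the resulting Jordan curve accumulate at
  \<open>mid e\<close>.\<close>

lemma cycle_separates:
  assumes F: "F \<subseteq> edges G" and e: "e \<in> F" "ends G e = {x, y}" and r: "edge_reach (ends G) (F - {e}) x y"
  obtains A D where "openin (top_of_set unit_sphere) A" "openin (top_of_set unit_sphere) D"
    "A \<inter> D = {}" "A \<union> D \<subseteq> unit_sphere" "unit_sphere - (A \<union> D) \<subseteq> (\<Union>e\<in>F. img e) \<union> points"
    "mid e \<in> closure A" "mid e \<in> closure D"
proof -
  have eE: "e \<in> edges G" using F e by blast
  let ?K = "(\<Union>e'\<in>F - {e}. img e') \<union> points"
  have xy: "x \<in> verts G" "y \<in> verts G" using ends(1)[OF eE] e(2) by auto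
  obtain s t where st: "pathstart (curve G e) = point G s" "pathfinish (curve G e) = point G t"
    "{s, t} = {x, y}"
  proof -
    have "{pathstart (curve G e), pathfinish (curve G e)} = {point G x, point G y}"
      using edge(3)[OF eE] e(2) by simp
    then show thesis using that[of x y] that[of y x] by (auto simp: doubleton_eq_iff)
  qed
  have "edge_reach (ends G) (F - {e}) t s"
    using st(3) r edge_reach_sym[OF r] by (auto simp: doubleton_eq_iff)
  moreover have "t \<in> verts G" using st(3) xy by (auto simp: doubleton_eq_iff)
  ultimately have "path_component ?K (point G t) (point G s)"
    using F by (intro path_component_of_edge_reach) auto
  then obtain p where p: "path p" "path_image p \<subseteq> ?K" "pathstart p = point G t" "pathfinish p = point G s"
    unfolding path_component_def by blast
  have "point G t \<noteq> point G s"
    using arc_distinct_ends[OF edge(1)[OF eE]] st by simp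
  with p obtain q where q: "arc q" "path_image q \<subseteq> path_image p" "pathstart q = point G t"
      "pathfinish q = point G s"
    using path_contains_arc[of p "point G t" "point G s"] by blast
  have "img e \<inter> ?K \<subseteq> points"
    using edges_meet[OF eE] F by blast
  from subset_trans[OF Int_mono[OF order_refl subset_trans[OF q(2) p(2)]] this]
  have "img e \<inter> path_image q \<subseteq> img e \<inter> points"
    by (intro Int_greatest Int_lower1)
  also have "\<dots> = {pathstart (curve G e), pathstart q}"
    by (simp only: edge(4)[OF eE] edge(3)[OF eE, symmetric] st(2) q(3))
  finally have "img e \<inter> path_image q \<subseteq> {pathstart (curve G e), pathstart q}" .
  then have simple: "simple_path (curve G e +++ q)"
    using edge(1)[OF eE] q st by (intro simple_path_join_loop) auto
  let ?J = "path_image (curve G e +++ q)"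
  have J: "?J = img e \<union> path_image q"
    using st q by (intro path_image_join) auto
  have Jsub: "?J \<subseteq> (\<Union>e\<in>F. img e) \<union> points"
    unfolding J using q(2) p(2) e(1) by blast
  then have Jd: "?J \<subseteq> drawing G"
    using F by (auto simp: drawing_def)
  have "openin (top_of_set unit_sphere) unit_sphere" by simp
  moreover have "unit_sphere \<noteq> ({} :: (real ^ 3) set)" by simp
  ultimately have "\<not> unit_sphere \<subseteq> drawing G"
    using thin_drawing unfolding thin_def by blast
  then obtain z where z: "z \<in> unit_sphere - ?J" using Jd by blast
  have "pathfinish (curve G e +++ q) = pathstart (curve G e +++ q)" using st q by simp
  moreover have "?J \<subseteq> unit_sphere" using Jd drawing_sphere by blast
  ultimately obtain A D where AD: "openin (top_of_set unit_sphere) A" "openin (top_of_set unit_sphere) D"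
    "A \<inter> D = {}" "A \<union> D = unit_sphere - ?J" "?J \<subseteq> closure A" "?J \<subseteq> closure D"
    by (rule Jordan_sphere[OF simple _ _ z]) (rule that)
  have "mid e \<in> ?J" using mid(1)[OF eE] J by blast
  then show ?thesis
    using AD Jsub by (intro that[OF AD(1-3)]) blast+
qed

lemma face_side:
  assumes F: "F \<in> faces G" and AD: "openin (top_of_set unit_sphere) A" "openin (top_of_set unit_sphere) D"
    "A \<inter> D = {}" "unit_sphere - (A \<union> D) \<subseteq> drawing G"
  shows "F \<subseteq> A \<or> F \<subseteq> D"
proof -
  have sub: "F \<subseteq> A \<union> D" using face_subset[OF F] AD(4) by blast
  have "openin (top_of_set F) (F \<inter> A)" "openin (top_of_set F) (F \<inter> D)"
    using AD(1,2) face_subset[OF F] by (auto simp: openin_open)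
  then have "F \<inter> A = {} \<or> F \<inter> D = {}"
    using face_connected[OF F] AD(3) sub unfolding connected_openin by blast
  then show ?thesis using sub by blast
qed

lemma closure_meets_open:
  assumes "openin (top_of_set unit_sphere) A" "x \<in> A" "x \<in> closure T" "T \<subseteq> unit_sphere"
  shows "T \<inter> A \<noteq> {}"
proof -
  obtain U where U: "open U" "A = unit_sphere \<inter> U" using assms(1) by (auto simp: openin_open)
  then have "T \<inter> U \<noteq> {}"
    using assms(2,3) open_Int_closure_eq_empty[of U T] by blast
  then show ?thesis using U assms(4) by blast
qed

text \<open>The 3-cycle around one face \<open>F\<close> at \<open>e\<close> is a Jordan curve
  through \<open>mid e\<close>. \<open>F\<close> stays on one side, while the other side also
  accumulates at \<open>mid e\<close> and so supplies a second face.\<close>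

lemma two_faces:
  assumes e: "e \<in> edges G"
  obtains F F' where "F \<in> faces G" "F' \<in> faces G" "F \<noteq> F'" "e \<in> boundary_edges G F" "e \<in> boundary_edges G F'"
proof -
  have "mid e \<in> unit_sphere" using mid(1)[OF e] edge(2)[OF e] by blast
  then have "mid e \<in> closure unit_sphere" by simp
  then obtain F where F: "F \<in> faces G" "mid e \<in> closure (F \<inter> unit_sphere)"
    using face_near[of unit_sphere "mid e"] by auto
  have "mid e \<in> closure F" using F(2) closure_mono[of "F \<inter> unit_sphere" F] by blast
  then have eF: "e \<in> boundary_edges G F" by (rule closure_face_edge[OF F(1) e mid[OF e]])
  obtain u v w a b c where cyc: "card {u, v, w} = 3" "{a, b, c} \<subseteq> edges G"
    "ends G a = {u, v}" "ends G b = {v, w}" "ends G c = {w, u}"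
    "boundary_edges G F = {a, b, c}"
    by (rule face_cycle[OF F(1)]) (rule that)
  have reach: "\<exists>x y. ends G e = {x, y} \<and> edge_reach (ends G) ({a, b, c} - {e}) x y"
  proof -
    have d: "u \<noteq> v" "v \<noteq> w" "u \<noteq> w" using cyc(1) by (auto simp: card_insert_if split: if_splits)
    then have dabc: "a \<noteq> b" "b \<noteq> c" "a \<noteq> c" using cyc(3-5) by (auto simp: doubleton_eq_iff)
    have two_step: "edge_reach (ends G) H x z"
      if "f \<in> H" "ends G f = {x, y}" "g \<in> H" "ends G g = {y, z}" for f g H x y z
    proof -
      have "edge_reach (ends G) H x y"
        by (rule edge_reach_step[where e = f, OF edge_reach_refl]) (use that in auto)
      then show ?thesis
        by (rule edge_reach_step[where e = g]) (use that in auto)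
    qed
    consider "e = a" | "e = b" | "e = c" using eF cyc(6) by blast
    then show ?thesis
    proof cases
      case 1
      have "edge_reach (ends G) ({a, b, c} - {e}) v u"
        by (rule two_step[of b _ _ w c]) (use 1 cyc(3-5) dabc in auto)
      moreover have "ends G e = {v, u}" using 1 cyc(3) by auto
      ultimately show ?thesis by blast
    next
      case 2
      have "edge_reach (ends G) ({a, b, c} - {e}) w v"
        by (rule two_step[of c _ _ u a]) (use 2 cyc(3-5) dabc in auto)
      moreover have "ends G e = {w, v}" using 2 cyc(4) by auto
      ultimately show ?thesis by blast
    next
      case 3
      have "edge_reach (ends G) ({a, b, c} - {e}) u w"
        by (rule two_step[of a _ _ v b]) (use 3 cyc(3-5) dabc in auto)
      moreover have "ends G e = {u, w}" using 3 cyc(5) by auto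
      ultimately show ?thesis by blast
    qed
  qed
  then obtain x y where xy: "ends G e = {x, y}" "edge_reach (ends G) ({a, b, c} - {e}) x y" by blast
  have eabc: "e \<in> {a, b, c}" using eF cyc(6) by simp
  obtain A D where AD: "openin (top_of_set unit_sphere) A" "openin (top_of_set unit_sphere) D"
    "A \<inter> D = {}" "unit_sphere - (A \<union> D) \<subseteq> (\<Union>e\<in>{a, b, c}. img e) \<union> points"
    "mid e \<in> closure A" "mid e \<in> closure D"
    using cycle_separates[OF cyc(2) eabc xy] by metis
  have dr: "unit_sphere - (A \<union> D) \<subseteq> drawing G"
    using AD(4) cyc(2) by (auto simp: drawing_def)
  obtain D' where D': "openin (top_of_set unit_sphere) D'" "mid e \<in> closure D'" "F \<inter> D' = {}"
    using face_side[OF F(1) AD(1-3) dr] AD by blast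
  obtain F' where F': "F' \<in> faces G" "mid e \<in> closure (F' \<inter> D')"
    using face_near[OF D'(1,2)] .
  have "mid e \<in> closure F'" using F'(2) closure_mono[of "F' \<inter> D'" F'] by blast
  then have "e \<in> boundary_edges G F'" by (rule closure_face_edge[OF F'(1) e mid[OF e]])
  moreover have "F' \<inter> D' \<noteq> {}" using F'(2) by auto
  then have "F \<noteq> F'" using D'(3) by blast
  ultimately show ?thesis using that F(1) F'(1) eF by blast
qed

lemma edge_own_face:
  assumes C: "C \<in> {W, B}" and e: "e \<in> edges G"
  shows "\<exists>!F. F \<in> C \<and> e \<in> boundary_edges G F"
proof -
  obtain F F' where F: "F \<in> W \<union> B" "F' \<in> W \<union> B" "F \<noteq> F'" "e \<in> boundary_edges G F" "e \<in> boundary_edges G F'"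
    using two_faces[OF e] WB_faces by metis
  have "\<not> (F \<in> W \<and> F' \<in> W)" "\<not> (F \<in> B \<and> F' \<in> B)"
    using F colour_class[of W F F' e] colour_class[of B F F' e] by auto
  then have "(F \<in> W \<and> F' \<in> B) \<or> (F \<in> B \<and> F' \<in> W)" using F(1,2) by blast
  then have "\<exists>F. F \<in> C \<and> e \<in> boundary_edges G F" using C F(4,5) by blast
  then show ?thesis using colour_class[OF C] by blast
qed

lemma face_at_vertex:
  assumes "v \<in> verts G"
  shows "\<exists>F\<in>faces G. v \<in> boundary_verts G F"
proof -
  have "point G v \<in> unit_sphere" using assms points_sphere by blast
  then obtain F where F: "F \<in> faces G" "point G v \<in> closure (F \<inter> unit_sphere)"
    using face_near[of unit_sphere "point G v"] by auto
  then have "point G v \<in> closure F" using closure_mono[of "F \<inter> unit_sphere" F] by blast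
  then show ?thesis using closure_face_vertex[OF F(1) assms] F(1) by blast
qed

lemma boundary_vertex_closure:
  "F \<in> faces G \<Longrightarrow> v \<in> boundary_verts G F \<Longrightarrow> point G v \<in> closure F"
  using face_boundary_eq[of F] by (auto simp: boundary_verts_def)

section \<open>Connectivity around a vertex and of the dual graph\<close>

lemma sphere_covered: "unit_sphere \<subseteq> (\<Union>F\<in>faces G. closure F)"
proof
  fix x :: "real ^ 3" assume "x \<in> unit_sphere"
  then obtain F where F: "F \<in> faces G" "x \<in> closure (F \<inter> unit_sphere)"
    using face_near[of unit_sphere x] by auto
  then show "x \<in> (\<Union>F\<in>faces G. closure F)"
    using closure_mono[of "F \<inter> unit_sphere" F] by blast
qed

text \<open>Off the drawing, \<open>x\<close> would lie in an open face meeting both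
  \<open>F\<close> and \<open>F'\<close>, which makes them equal.\<close>

lemma common_closure_point:
  assumes F: "F \<in> faces G" "F' \<in> faces G" "F \<noteq> F'" and x: "x \<in> closure F" "x \<in> closure F'"
  shows "x \<in> points \<or> (\<exists>e\<in>edges G. x \<in> img e \<and> e \<in> boundary_edges G F \<and> e \<in> boundary_edges G F')"
proof (cases "x \<in> drawing G")
  case True
  then show ?thesis
    using closure_face_edge[OF F(1) _ _ _ x(1)] closure_face_edge[OF F(2) _ _ _ x(2)]
    unfolding drawing_def by blast
next
  case False
  have "closure F \<subseteq> unit_sphere"
    using face_subset[OF F(1)] by (intro closure_minimal) auto
  then obtain H where H: "H \<in> faces G" "x \<in> H" using False x(1) Union_faces by blast
  have "F \<inter> H \<noteq> {}" "F' \<inter> H \<noteq> {}"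
    using closure_meets_open[OF face_openin[OF H(1)] H(2)] x face_subset F by blast+
  then show ?thesis using faces_eqI[OF _ H(1)] F by metis
qed

text \<open>A suitable neighbourhood of \<open>v\<close> stays connected without \<open>v\<close>.
  If \<open>X\<close> missed a face at \<open>v\<close>, the closures of the faces in
  \<open>X\<close> and of the remaining ones would split it into disjoint closed parts, as points
  common to both lie on edges at \<open>v\<close>.\<close>

lemma link_connected:
  assumes v: "v \<in> verts G" and X: "X \<subseteq> {F \<in> faces G. v \<in> boundary_verts G F}" "X \<noteq> {}"
    and cl: "\<And>e F F'. e \<in> edges G \<Longrightarrow> v \<in> ends G e \<Longrightarrow> F \<in> X \<Longrightarrow> e \<in> boundary_edges G F \<Longrightarrow>
      F' \<in> faces G \<Longrightarrow> e \<in> boundary_edges G F' \<Longrightarrow> F' \<in> X"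
  shows "X = {F \<in> faces G. v \<in> boundary_verts G F}"
proof (rule ccontr)
  assume nX: "X \<noteq> {F \<in> faces G. v \<in> boundary_verts G F}"
  define Y where "Y = {F \<in> faces G. v \<in> boundary_verts G F} - X"
  have Y: "Y \<noteq> {}" "Y \<subseteq> faces G" using nX X(1) by (auto simp: Y_def)
  have XF: "X \<subseteq> faces G" using X(1) by blast
  \<comment> \<open>All edges, other vertices and closed faces that do not touch \<open>v\<close>;
    away from them only the star of \<open>v\<close> is visible.\<close>
  let ?far = "(\<Union>e\<in>{e \<in> edges G. v \<notin> ends G e}. img e) \<union> (\<Union>p\<in>points - {point G v}. {p})
    \<union> (\<Union>F\<in>{F \<in> faces G. v \<notin> boundary_verts G F}. closure F)"
  have "closed (\<Union>e\<in>{e \<in> edges G. v \<notin> ends G e}. img e)"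
    by (rule closed_UN) (use finite_graph edge(1) closed_arc_image in auto)
  moreover have "closed (\<Union>p\<in>points - {point G v}. {p})"
    by (rule closed_UN) (use finite_graph in auto)
  moreover have "closed (\<Union>F\<in>{F \<in> faces G. v \<notin> boundary_verts G F}. closure F)"
    by (rule closed_UN) (use finite_faces in auto)
  ultimately have "closed ?far" by (intro closed_Un)
  then have op: "openin (top_of_set unit_sphere) (unit_sphere - ?far)"
    by (rule openin_diff_closed)
  have pS: "point G v \<in> unit_sphere" using v points_sphere by blast
  have "point G v \<notin> ?far"
    using point_img[OF _ v] closure_face_vertex[OF _ v] by auto
  then have "point G v \<in> unit_sphere - ?far" using pS by blast
  then obtain N where N: "openin (top_of_set unit_sphere) N" "point G v \<in> N"
    "N \<subseteq> unit_sphere - ?far" and conn: "\<And>y. connected (N - {y})"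
    by (rule sphere_nbhd[OF op]) (rule that)
  let ?N = "N - {point G v}"
  have fin: "finite X" "finite Y" using finite_faces XF Y(2) finite_subset by auto
  have clos: "closed (\<Union>F\<in>X. closure F)" "closed (\<Union>F\<in>Y. closure F)"
    using fin by (auto intro: closed_UN)
  have far: "v \<in> ends G e" if "x \<in> N" "e \<in> edges G" "x \<in> img e" for x e
    using subsetD[OF N(3) that(1)] that(2,3) by auto
  have far': "x = point G v" if "x \<in> N" "x \<in> points" for x
    using subsetD[OF N(3) that(1)] that(2) by auto
  have far'': "v \<in> boundary_verts G F" if "x \<in> N" "F \<in> faces G" "x \<in> closure F" for x F
    using subsetD[OF N(3) that(1)] that(2,3) by auto
  have NS: "N \<subseteq> unit_sphere" by (rule openin_imp_subset[OF N(1)])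
  have cov: "?N \<subseteq> (\<Union>F\<in>X. closure F) \<union> (\<Union>F\<in>Y. closure F)"
  proof
    fix x assume x: "x \<in> ?N"
    then obtain F where F: "F \<in> faces G" "x \<in> closure F"
      using NS sphere_covered by blast
    then have "F \<in> X \<or> F \<in> Y" using far''[of x F] x by (auto simp: Y_def)
    then show "x \<in> (\<Union>F\<in>X. closure F) \<union> (\<Union>F\<in>Y. closure F)" using F(2) by blast
  qed
  have disj: "(\<Union>F\<in>X. closure F) \<inter> (\<Union>F\<in>Y. closure F) \<inter> ?N = {}"
  proof (rule ccontr)
    assume "\<not> ?thesis"
    then obtain x F F' where x: "x \<in> N" "x \<noteq> point G v" "F \<in> X" "F' \<in> Y" "x \<in> closure F" "x \<in> closure F'"
      by blast
    have FF: "F \<in> faces G" "F' \<in> faces G" "F \<noteq> F'" using x(3,4) XF Y(2) by (auto simp: Y_def)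
    have "x \<notin> points" using far'[of x] x(1,2) by blast
    then obtain e where e: "e \<in> edges G" "x \<in> img e" "e \<in> boundary_edges G F" "e \<in> boundary_edges G F'"
      using common_closure_point[OF FF x(5,6)] by blast
    have "F' \<in> X" by (rule cl[OF e(1) far[OF x(1) e(1,2)] x(3) e(3) FF(2) e(4)])
    then show False using x(4) by (simp add: Y_def)
  qed
  have meets: "(\<Union>F\<in>Z. closure F) \<inter> ?N \<noteq> {}"
    if Z: "Z \<noteq> {}" "Z \<subseteq> {F \<in> faces G. v \<in> boundary_verts G F}" for Z
  proof -
    obtain F where F: "F \<in> Z" "F \<in> faces G" "v \<in> boundary_verts G F" using Z by blast
    have "F \<inter> N \<noteq> {}"
      using closure_meets_open[OF N(1,2) boundary_vertex_closure[OF F(2,3)]] face_subset[OF F(2)] by blast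
    moreover have "point G v \<notin> F" using face_subset[OF F(2)] v by (auto simp: drawing_def)
    ultimately have "F \<inter> ?N \<noteq> {}" by blast
    then show ?thesis using F(1) closure_subset by blast
  qed
  have "(\<Union>F\<in>X. closure F) \<inter> ?N \<noteq> {}" "(\<Union>F\<in>Y. closure F) \<inter> ?N \<noteq> {}"
    using X Y(1) by (intro meets; auto simp: Y_def)+
  then show False
    using conn[of "point G v"] clos cov disj unfolding connected_closed by blast
qed

text \<open>The sphere is connected, so the two closed families of faces share a point. If it lies
  inside an edge, \<open>cl\<close> applies directly; if it is a vertex,
  \<open>link_connected\<close> leads from one face to the other across edges at it.\<close>

lemma dual_connected:
  assumes X: "X \<subseteq> faces G" "X \<noteq> {}"
    and cl: "\<And>e F F'. e \<in> edges G \<Longrightarrow> F \<in> X \<Longrightarrow> e \<in> boundary_edges G F \<Longrightarrow>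
      F' \<in> faces G \<Longrightarrow> e \<in> boundary_edges G F' \<Longrightarrow> F' \<in> X"
  shows "X = faces G"
proof (rule ccontr)
  assume nX: "X \<noteq> faces G"
  define Y where "Y = faces G - X"
  have Y: "Y \<noteq> {}" "Y \<subseteq> faces G" using nX X(1) by (auto simp: Y_def)
  have fin: "finite X" "finite Y" using finite_faces X Y(2) finite_subset by auto
  have clos: "closed (\<Union>F\<in>X. closure F)" "closed (\<Union>F\<in>Y. closure F)"
    using fin by (auto intro: closed_UN)
  have cov: "unit_sphere \<subseteq> (\<Union>F\<in>X. closure F) \<union> (\<Union>F\<in>Y. closure F)"
    using sphere_covered unfolding Y_def by blast
  have disj: "(\<Union>F\<in>X. closure F) \<inter> (\<Union>F\<in>Y. closure F) \<inter> unit_sphere = {}"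
  proof (rule ccontr)
    assume "\<not> ?thesis"
    then obtain x F F' where x: "F \<in> X" "F' \<in> Y" "x \<in> closure F" "x \<in> closure F'" by blast
    have FF: "F \<in> faces G" "F' \<in> faces G" "F \<noteq> F'" using x X Y(2) by (auto simp: Y_def)
    have "F' \<in> X"
    proof (cases "x \<in> points")
      case False
      then show ?thesis
        using common_closure_point[OF FF x(3,4)] cl[OF _ x(1) _ FF(2)] by blast
    next
      case True
      then obtain v where v: "v \<in> verts G" "x = point G v" by blast
      have vF: "v \<in> boundary_verts G F" "v \<in> boundary_verts G F'"
        using closure_face_vertex FF x v by auto
      have "{F \<in> X. v \<in> boundary_verts G F} = {F \<in> faces G. v \<in> boundary_verts G F}"
      proof (rule link_connected[OF v(1)])
        fix e H H' assume a: "e \<in> edges G" "v \<in> ends G e" "H \<in> {F \<in> X. v \<in> boundary_verts G F}"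
          "e \<in> boundary_edges G H" "H' \<in> faces G" "e \<in> boundary_edges G H'"
        have "point G v \<in> img e" using point_img[OF a(1) v(1)] a(2) by simp
        then have "v \<in> boundary_verts G H'"
          using closure_face_vertex[OF a(5) v(1)] boundary_edge_closure[OF a(5,6)] by blast
        then show "H' \<in> {F \<in> X. v \<in> boundary_verts G F}"
          using cl[OF a(1) _ a(4,5,6)] a(3) by blast
      qed (use X x vF in auto)
      then show ?thesis using vF FF(2) by blast
    qed
    then show False using x(2) by (simp add: Y_def)
  qed
  have meets: "(\<Union>F\<in>Z. closure F) \<inter> unit_sphere \<noteq> {}" if Z: "Z \<noteq> {}" "Z \<subseteq> faces G" for Z
  proof -
    obtain F where F: "F \<in> Z" "F \<in> faces G" using Z by blast
    show ?thesis using F(1) closure_subset[of F] face_subset[OF F(2)] face_nonempty[OF F(2)] by blast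
  qed
  have "connected (unit_sphere :: (real ^ 3) set)"
    by (rule connected_sphere) simp
  then show False
    using clos cov disj meets[OF X(2,1)] meets[OF Y] unfolding connected_closed by blast
qed

text \<open>\<open>X\<close> consists of the faces on one side of a Jordan curve drawn with edges of
  \<open>F\<close>. The midpoint of an edge outside \<open>F\<close> lies in one of the two open
  sides and pulls both faces at that edge to it.\<close>

lemma jordan_faces:
  assumes F: "F \<subseteq> edges G" and na: "\<not> acyclic_edges (ends G) F"
  shows "\<exists>X \<subseteq> faces G. X \<noteq> {} \<and> X \<noteq> faces G \<and>
    (\<forall>e\<in>edges G - F. \<forall>H\<in>X. \<forall>H'\<in>faces G. e \<in> boundary_edges G H \<longrightarrow> e \<in> boundary_edges G H' \<longrightarrow> H' \<in> X)"
proof -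
  obtain e x y where e: "e \<in> F" "ends G e = {x, y}" "edge_reach (ends G) (F - {e}) x y"
    using na unfolding acyclic_edges_def by blast
  obtain A D where AD: "openin (top_of_set unit_sphere) A" "openin (top_of_set unit_sphere) D"
    "A \<inter> D = {}" "unit_sphere - (A \<union> D) \<subseteq> (\<Union>e\<in>F. img e) \<union> points"
    "mid e \<in> closure A" "mid e \<in> closure D"
    using cycle_separates[OF F e] by metis
  have dr: "unit_sphere - (A \<union> D) \<subseteq> drawing G"
    using AD(4) F by (auto simp: drawing_def)
  note side = face_side[OF _ AD(1-3) dr]
  let ?X = "{H \<in> faces G. H \<subseteq> A}"
  have meet: "\<exists>H\<in>faces G. H \<inter> U \<noteq> {}" if U: "openin (top_of_set unit_sphere) U" "mid e \<in> closure U" for U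
  proof -
    obtain H where "H \<in> faces G" "mid e \<in> closure (H \<inter> U)" using face_near[OF U] .
    then show ?thesis by (metis closure_empty empty_iff)
  qed
  obtain H where H: "H \<in> faces G" "H \<inter> A \<noteq> {}" using meet[OF AD(1,5)] by blast
  obtain H' where H': "H' \<in> faces G" "H' \<inter> D \<noteq> {}" using meet[OF AD(2,6)] by blast
  have "H \<in> ?X" using H side[OF H(1)] AD(3) by blast
  moreover have "H' \<notin> ?X" using H' AD(3) by blast
  moreover have "K' \<in> ?X" if f: "f \<in> edges G - F" and K: "K \<in> ?X" "f \<in> boundary_edges G K"
    and K': "K' \<in> faces G" "f \<in> boundary_edges G K'" for f K K'
  proof -
    have fE: "f \<in> edges G" using f by blast
    have m: "mid f \<in> unit_sphere" "mid f \<in> closure K" "mid f \<in> closure K'"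
      using mid(1)[OF fE] edge(2)[OF fE] boundary_edge_closure K K' by blast+
    have "mid f \<notin> (\<Union>e\<in>F. img e) \<union> points"
      using mid[OF fE] inner_point_edge[OF mid[OF fE] _ fE] f F by blast
    then consider "mid f \<in> A" | "mid f \<in> D" using AD(4) m(1) by blast
    then show ?thesis
    proof cases
      case 1
      then have "K' \<inter> A \<noteq> {}" using closure_meets_open[OF AD(1) 1 m(3)] face_subset[OF K'(1)] by blast
      then show ?thesis using side[OF K'(1)] AD(3) K'(1) by blast
    next
      case 2
      have "K \<inter> D \<noteq> {}" using closure_meets_open[OF AD(2) 2 m(2)] face_subset[of K] K(1) by blast
      then show ?thesis using K(1) AD(3) by blast
    qed
  qed
  ultimately show ?thesis using H'(1) by (intro exI[of _ ?X]) blast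
qed

lemma triangle:
  assumes F: "F \<in> faces G"
  shows "boundary_verts G F \<subseteq> verts G" "card (boundary_verts G F) = 3" "boundary_edges G F \<subseteq> edges G"
    "bij_betw (ends G) (boundary_edges G F) {A. A \<subseteq> boundary_verts G F \<and> card A = 2}"
proof -
  obtain u v w a b c where cyc: "card {u, v, w} = 3"
    "ends G a = {u, v}" "ends G b = {v, w}" "ends G c = {w, u}"
    "boundary_edges G F = {a, b, c}" "boundary_verts G F = {u, v, w}"
    by (rule face_cycle[OF F]) (rule that)
  show "boundary_verts G F \<subseteq> verts G" "boundary_edges G F \<subseteq> edges G"
    by (auto simp: boundary_verts_def boundary_edges_def)
  show "card (boundary_verts G F) = 3" using cyc by simp
  have d: "u \<noteq> v" "v \<noteq> w" "u \<noteq> w" using cyc(1) by (auto simp: card_insert_if split: if_splits)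
  show "bij_betw (ends G) (boundary_edges G F) {A. A \<subseteq> boundary_verts G F \<and> card A = 2}"
  proof (rule bij_betw_imageI)
    show "inj_on (ends G) (boundary_edges G F)"
      unfolding cyc(5) using cyc(2-4) d by (auto simp: inj_on_def doubleton_eq_iff)
    show "ends G ` boundary_edges G F = {A. A \<subseteq> boundary_verts G F \<and> card A = 2}"
      unfolding cyc(5,6) using d by (auto simp: cyc(2-4) card_2_iff)
  qed
qed

lemma coloured_triangulation:
  "coloured_triangulation (verts G) (edges G) (ends G) W B (boundary_verts G) (boundary_edges G)"
proof
  show "finite (verts G)" "finite (edges G)" by (rule finite_graph)+
  show "finite (W \<union> B)" using finite_faces WB_faces by simp
  show "W \<inter> B = {}" by (rule WB_disjoint)
  show "W \<union> B \<noteq> {}"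
  proof -
    have "(unit_sphere :: (real ^ 3) set) \<noteq> {}" by simp
    then show ?thesis using sphere_covered WB_faces by blast
  qed
  show "card (ends G e) = 2" if "e \<in> edges G" for e using ends(2)[OF that] .
  show "boundary_verts G F \<subseteq> verts G" "card (boundary_verts G F) = 3" "boundary_edges G F \<subseteq> edges G"
    "bij_betw (ends G) (boundary_edges G F) {A. A \<subseteq> boundary_verts G F \<and> card A = 2}"
    if "F \<in> W \<union> B" for F
    using triangle[of F] that unfolding WB_faces by blast+
  show "\<exists>!F. F \<in> C \<and> e \<in> boundary_edges G F" if "C \<in> {W, B}" "e \<in> edges G" for C e
    by (rule edge_own_face[OF that])
  show "\<exists>F\<in>W \<union> B. v \<in> boundary_verts G F" if "v \<in> verts G" for v
    unfolding WB_faces by (rule face_at_vertex[OF that])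
qed (unfold WB_faces, rule link_connected dual_connected jordan_faces; assumption)+

end

theorem theorem1:
  fixes G :: "('v, 'e) drawn_graph"
    and W B :: "(real ^ 3) set set"
  assumes "sphere_triangulation G"
    and "proper_face_2_colouring G W B"
  shows "triangle_group G W \<cong> triangle_group G B"
proof -
  interpret drawn_triangulation G W B
    by unfold_locales (rule assms)+
  interpret coloured_triangulation "verts G" "edges G" "ends G" W B "boundary_verts G" "boundary_edges G"
    by (rule coloured_triangulation)
  show ?thesis
    unfolding triangle_group_def triangle_relations_def by (rule triangle_presentations_iso)
qed

end
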